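(* Let $n\ge2$. For any $t\in(0,1]$, the CAT($-1$) space $C_t$ is locally compact and the action of $\mathrm{Isom}(\mathbf{H}^n)$ on $C_t$ is cocompact. Moreover, for $t,t'\in(0,1]$, the spaces $C_t$ and $C_{t'}$ are isometric only if $t=t'$, even upon rescaling the metric (i.e. if there are $\mu>0$ and a bijection $h\colon C_t\to C_{t'}$ with $d(h(x),h(y))=\mu\,d(x,y)$ for all $x,y\in C_t$, then $t=t'$).
   Context: $\mathbf{H}^n$ is real hyperbolic $n$-space. The infinite-dimensional hyperbolic space: let $\mathscr{H}$ be an infinite-dimensional separable real Hilbert space, $L\subset\mathscr{H}$ a line, $0\ne e\in L$, and let $B$ be the symmetric bilinear form with $B(v,v)=|v_L|^2-|v_{L^\perp}|^2$. Then $\mathbf{H}^\infty=\{v\in\mathscr{H}: B(v,v)=1,\ B(v,e)>0\}$ with $\cosh d(x,y)=B(x,y)$, a complete CAT($-1$) space. For $t\in(0,1)$, $\varrho_t\colon\mathrm{Isom}(\mathbf{H}^n)\to\mathrm{Isom}(\mathbf{H}^\infty)$ denotes the irreducible continuous representation (the associated linear representation on $\mathscr{H}$ has no non-trivial closed invariant subspace; orbit maps are continuous), which exists and is unique up to conjugacy, whose translation length function satisfies $\inf_{x\in\mathbf{H}^\infty}d(\varrho_t(g)x,x)=t\inf_{x\in\mathbf{H}^n}d(gx,x)$ for all $g$. For $t\in(0,1)$, $C_t\subseteq\mathbf{H}^\infty$ is the unique minimal non-empty closed convex $\varrho_t(\mathrm{Isom}(\mathbf{H}^n))$-invariant subset,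 with the induced metric and action. By convention $C_1=\mathbf{H}^n$ with the standard action. *)

theory Defs
  imports "HOL-Analysis.Analysis" "HOL-Algebra.Bij"
begin

section \<open>The hyperboloid model\<close>

definition line_proj :: "'a::real_inner \<Rightarrow> 'a \<Rightarrow> 'a" where
  "line_proj e v = ((v \<bullet> e) / (e \<bullet> e)) *\<^sub>R e"

text \<open>
  The symmetric bilinear form whose quadratic form is the squared norm of the component
  along the line spanned by \<open>e\<close> minus the squared norm of the orthogonal component.
\<close>

definition minkowski :: "'a::real_inner \<Rightarrow> 'a \<Rightarrow> 'a \<Rightarrow> real" where
  "minkowski e v w =
     line_proj e v \<bullet> line_proj e w - (v - line_proj e v) \<bullet> (w - line_proj e w)"

definition hyperboloid :: "'a::real_inner \<Rightarrow> 'a set" where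
  "hyperboloid e = {v. minkowski e v v = 1 \<and> minkowski e v e > 0}"

text \<open>
  The metric characterised by \<open>cosh (d x y) = minkowski e x y\<close>.  The value off the hyperboloid
  is irrelevant, but the library's type of metrics wants a globally non-negative function.
\<close>

definition hyp_dist :: "'a::real_inner \<Rightarrow> 'a \<Rightarrow> 'a \<Rightarrow> real" where
  "hyp_dist e x y =
     (if x \<in> hyperboloid e \<and> y \<in> hyperboloid e then arcosh (minkowski e x y) else 0)"

definition hyp_space :: "'a::real_inner \<Rightarrow> 'a metric" where
  "hyp_space e = metric (hyperboloid e, hyp_dist e)"

text \<open>Here \<open>n\<close> is \<open>CARD('n)\<close>; the form is \<open>s * s' - v \<bullet> v'\<close> (see \<open>minkowski_Pair\<close> below).\<close>

definition hyp_space_n :: "(real \<times> (real ^ 'n)) metric" where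
  "hyp_space_n = hyp_space (1, 0)"

lemma minkowski_Pair:
  fixes v v' :: "real ^ 'n"
  shows "minkowski (1, 0) (s, v) (s', v') = s * s' - v \<bullet> v'"
  by (simp add: minkowski_def line_proj_def)

lemma minkowski_commute: "minkowski e v w = minkowski e w v"
  by (simp add: minkowski_def inner_commute)

lemma line_proj_add: "line_proj e (v + w) = line_proj e v + line_proj e w"
  by (simp add: line_proj_def inner_add_left add_divide_distrib scaleR_add_left)

lemma line_proj_scaleR: "line_proj e (c *\<^sub>R v) = c *\<^sub>R line_proj e v"
  by (simp add: line_proj_def)

lemma minkowski_add_left: "minkowski e (u + v) w = minkowski e u w + minkowski e v w"
  by (simp add: minkowski_def line_proj_add algebra_simps)

lemma minkowski_scaleR_left: "minkowski e (c *\<^sub>R v) w = c * minkowski e v w"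
  by (simp add: minkowski_def line_proj_scaleR algebra_simps)

lemma minkowski_add_right: "minkowski e w (u + v) = minkowski e w u + minkowski e w v"
  by (metis minkowski_add_left minkowski_commute)

lemma minkowski_scaleR_right: "minkowski e w (c *\<^sub>R v) = c * minkowski e w v"
  by (metis minkowski_scaleR_left minkowski_commute)

lemma minkowski_diff_left: "minkowski e (u - v) w = minkowski e u w - minkowski e v w"
  by (metis add_diff_cancel diff_add_cancel minkowski_add_left)

lemma minkowski_diff_right: "minkowski e w (u - v) = minkowski e w u - minkowski e w v"
  by (metis minkowski_diff_left minkowski_commute)

lemmas minkowski_bilinear =
  minkowski_add_left minkowski_add_right minkowski_diff_left minkowski_diff_right
  minkowski_scaleR_left minkowski_scaleR_right

lemma minkowski_self: "minkowski e v v = (norm (line_proj e v))\<^sup>2 - (norm (v - line_proj e v))\<^sup>2"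
  by (simp add: minkowski_def power2_norm_eq_inner)

lemma hyperboloid_coordinates:
  assumes "e \<noteq> 0"
  obtains p :: "'a::real_inner \<Rightarrow> real" and q :: "'a \<Rightarrow> 'a"
  where "\<And>v w. minkowski e v w = p v * p w - q v \<bullet> q w"
    and "\<And>v w. p v = p w \<Longrightarrow> q v = q w \<Longrightarrow> v = w"
    and "\<And>v. v \<in> hyperboloid e \<Longrightarrow> p v > 0 \<and> (p v)\<^sup>2 = 1 + (norm (q v))\<^sup>2"
proof -
  define p where "p = (\<lambda>v. (v \<bullet> e) / norm e)"
  define q where "q = (\<lambda>v. v - line_proj e v)"
  have ne: "norm e > 0" "e \<bullet> e \<noteq> 0"
    using assms by auto
  have lp: "line_proj e v = (p v / norm e) *\<^sub>R e" for v
    by (simp add: line_proj_def p_def dot_square_norm power2_eq_square)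
  have 1: "minkowski e v w = p v * p w - q v \<bullet> q w" for v w
  proof -
    have "line_proj e v \<bullet> line_proj e w = p v * p w"
      using ne by (simp add: lp dot_square_norm power2_eq_square)
    then show ?thesis
      by (simp add: minkowski_def q_def)
  qed
  have 2: "v = w" if "p v = p w" "q v = q w" for v w
    using that by (simp add: q_def lp)
  have "p e = norm e" and "q e = 0"
    using ne by (simp_all add: p_def q_def line_proj_def dot_square_norm power2_eq_square)
  then have 3: "p v > 0 \<and> (p v)\<^sup>2 = 1 + (norm (q v))\<^sup>2" if "v \<in> hyperboloid e" for v
    using that ne unfolding hyperboloid_def mem_Collect_eq 1
    by (auto simp: zero_less_mult_iff power2_norm_eq_inner power2_eq_square[of "p v"])
  show ?thesis
    using that 1 2 3 by blast
qed

lemma hyperboloid_nonzero: "v \<in> hyperboloid e \<Longrightarrow> e \<noteq> 0"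
  by (auto simp: hyperboloid_def minkowski_def line_proj_def)

lemma minkowski_ge_1:
  assumes x: "x \<in> hyperboloid e" and y: "y \<in> hyperboloid e"
  shows "minkowski e x y \<ge> 1" and "minkowski e x y = 1 \<longleftrightarrow> x = y"
proof -
  obtain p :: "'a \<Rightarrow> real" and q :: "'a \<Rightarrow> 'a"
    where B: "\<And>v w. minkowski e v w = p v * p w - q v \<bullet> q w"
      and inj: "\<And>v w. p v = p w \<Longrightarrow> q v = q w \<Longrightarrow> v = w"
      and H: "\<And>v. v \<in> hyperboloid e \<Longrightarrow> p v > 0 \<and> (p v)\<^sup>2 = 1 + (norm (q v))\<^sup>2"
    using hyperboloid_coordinates[OF hyperboloid_nonzero[OF x]] by blast
  let ?a = "norm (q x)" and ?b = "norm (q y)"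
  have cs: "q x \<bullet> q y \<le> ?a * ?b"
    by (rule norm_cauchy_schwarz)
  have sq: "(p x * p y)\<^sup>2 = (1 + ?a * ?b)\<^sup>2 + (?a - ?b)\<^sup>2"
  proof -
    have "(p x * p y)\<^sup>2 = (1 + ?a\<^sup>2) * (1 + ?b\<^sup>2)"
      using H[OF x] H[OF y] by (metis power_mult_distrib)
    also have "\<dots> = (1 + ?a * ?b)\<^sup>2 + (?a - ?b)\<^sup>2"
      by (simp add: power2_eq_square algebra_simps)
    finally show ?thesis .
  qed
  have ge: "p x * p y \<ge> 1 + ?a * ?b"
  proof -
    have "p x * p y \<ge> 0"
      using H[OF x] H[OF y] by simp
    moreover have "(1 + ?a * ?b)\<^sup>2 \<le> (p x * p y)\<^sup>2"
      unfolding sq by simp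
    ultimately show ?thesis
      by (rule power2_le_imp_le[rotated])
  qed
  then show "minkowski e x y \<ge> 1"
    using cs B[of x y] by linarith
  show "minkowski e x y = 1 \<longleftrightarrow> x = y"
  proof
    assume "minkowski e x y = 1"
    then have eq: "p x * p y = 1 + ?a * ?b" "q x \<bullet> q y = ?a * ?b"
      using cs ge B[of x y] by linarith+
    then have ab: "?a = ?b"
      using sq by simp
    have "(norm (q x - q y))\<^sup>2 = ?a\<^sup>2 - 2 * (q x \<bullet> q y) + ?b\<^sup>2"
      by (simp add: power2_norm_eq_inner inner_diff_left inner_diff_right inner_commute)
    also have "\<dots> = 0"
      using eq(2) ab by (simp add: power2_eq_square)
    finally have "(norm (q x - q y))\<^sup>2 = 0" .
    then have "q x = q y"
      by simp
    moreover have "p x = p y"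
      using H[OF x] H[OF y] ab by (metis order_less_imp_le power2_eq_iff_nonneg)
    ultimately show "x = y"
      by (rule inj[rotated])
  qed (use x in \<open>simp add: hyperboloid_def\<close>)
qed

lemma minkowski_nonpos_orthogonal:
  assumes y: "y \<in> hyperboloid e" and v: "minkowski e v y = 0"
  shows "minkowski e v v \<le> 0"
proof -
  obtain p :: "'a \<Rightarrow> real" and q :: "'a \<Rightarrow> 'a"
    where B: "\<And>v w. minkowski e v w = p v * p w - q v \<bullet> q w"
      and "\<And>v w. p v = p w \<Longrightarrow> q v = q w \<Longrightarrow> v = w"
      and H: "\<And>v. v \<in> hyperboloid e \<Longrightarrow> p v > 0 \<and> (p v)\<^sup>2 = 1 + (norm (q v))\<^sup>2"
    using hyperboloid_coordinates[OF hyperboloid_nonzero[OF y]] by blast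
  have "(p v)\<^sup>2 * (p y)\<^sup>2 = (q v \<bullet> q y)\<^sup>2"
    using v B[of v y] by (metis eq_iff_diff_eq_0 power_mult_distrib)
  also have "\<dots> \<le> (norm (q v))\<^sup>2 * (norm (q y))\<^sup>2"
    by (simp add: power2_norm_eq_inner Cauchy_Schwarz_ineq)
  also have "\<dots> \<le> (norm (q v))\<^sup>2 * (p y)\<^sup>2"
    using H[OF y] by (intro mult_left_mono) auto
  finally have "(p v)\<^sup>2 \<le> (norm (q v))\<^sup>2"
    using H[OF y] by (metis mult_le_cancel_right_pos zero_less_power)
  then show ?thesis
    by (metis B diff_le_0_iff_le power2_eq_square power2_norm_eq_inner)
qed

lemma minkowski_cauchy_schwarz:
  assumes y: "y \<in> hyperboloid e" and u: "minkowski e u y = 0" and w: "minkowski e w y = 0"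
  shows "(minkowski e u w)\<^sup>2 \<le> minkowski e u u * minkowski e w w"
proof -
  define \<alpha> \<beta> \<gamma> where "\<alpha> = minkowski e u u" and "\<beta> = minkowski e w w" and "\<gamma> = minkowski e u w"
  have *: "a\<^sup>2 * \<alpha> + 2 * a * b * \<gamma> + b\<^sup>2 * \<beta> \<le> 0" for a b
  proof -
    have "minkowski e (a *\<^sub>R u + b *\<^sub>R w) (a *\<^sub>R u + b *\<^sub>R w) \<le> 0"
      by (rule minkowski_nonpos_orthogonal[OF y]) (simp add: minkowski_bilinear u w)
    then show ?thesis
      by (simp add: minkowski_bilinear minkowski_commute[of e w u] \<alpha>_def \<beta>_def \<gamma>_def
          power2_eq_square algebra_simps)
  qed
  have \<beta>: "\<beta> \<le> 0"
    using *[of 0 1] by simp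
  show ?thesis
  proof (cases "\<beta> = 0")
    case True
    have "\<gamma> = 0"
    proof (rule ccontr)
      assume "\<gamma> \<noteq> 0"
      then have "2 * ((1 - \<alpha>) / (2 * \<gamma>)) * \<gamma> = 1 - \<alpha>"
        by simp
      then show False
        using *[of 1 "(1 - \<alpha>) / (2 * \<gamma>)"] True by auto
    qed
    then show ?thesis
      using True by (simp add: \<alpha>_def \<beta>_def \<gamma>_def)
  next
    case False
    have "\<beta> * (\<beta> * \<alpha> - \<gamma>\<^sup>2) \<le> 0"
      using *[of \<beta> "- \<gamma>"] by (simp add: power2_eq_square algebra_simps)
    then have "\<beta> * \<alpha> - \<gamma>\<^sup>2 \<ge> 0"
      using False \<beta> by (simp add: mult_le_0_iff)
    then show ?thesis
      by (simp add: \<alpha>_def \<beta>_def \<gamma>_def mult.commute)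
  qed
qed

lemma hyp_dist_triangle:
  assumes x: "x \<in> hyperboloid e" and y: "y \<in> hyperboloid e" and z: "z \<in> hyperboloid e"
  shows "hyp_dist e x z \<le> hyp_dist e x y + hyp_dist e y z"
proof -
  let ?B = "minkowski e"
  have ge: "?B x y \<ge> 1" "?B y z \<ge> 1" "?B x z \<ge> 1"
    using minkowski_ge_1(1) assms by blast+
  have 1: "?B x x = 1" "?B y y = 1" "?B z z = 1"
    using assms by (simp_all add: hyperboloid_def)
  define u where "u = x - ?B x y *\<^sub>R y"
  define w where "w = z - ?B y z *\<^sub>R y"
  have "?B u y = 0" "?B w y = 0"
    by (simp_all add: u_def w_def minkowski_bilinear 1 minkowski_commute[of e z y])
  moreover have "?B u u = 1 - (?B x y)\<^sup>2" "?B w w = 1 - (?B y z)\<^sup>2"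
    "?B u w = ?B x z - ?B x y * ?B y z"
    by (simp_all add: u_def w_def minkowski_bilinear 1 minkowski_commute[of e z y]
        minkowski_commute[of e y x] power2_eq_square)
  ultimately have "(?B x z - ?B x y * ?B y z)\<^sup>2 \<le> (1 - (?B x y)\<^sup>2) * (1 - (?B y z)\<^sup>2)"
    by (metis minkowski_cauchy_schwarz[OF y])
  then have "(?B x z - ?B x y * ?B y z)\<^sup>2 \<le> ((?B x y)\<^sup>2 - 1) * ((?B y z)\<^sup>2 - 1)"
    by (simp add: algebra_simps)
  then have "\<bar>?B x z - ?B x y * ?B y z\<bar> \<le> sqrt (((?B x y)\<^sup>2 - 1) * ((?B y z)\<^sup>2 - 1))"
    using real_le_rsqrt[of "\<bar>?B x z - ?B x y * ?B y z\<bar>"] by simp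
  then have "?B x z \<le> ?B x y * ?B y z + sqrt ((?B x y)\<^sup>2 - 1) * sqrt ((?B y z)\<^sup>2 - 1)"
    by (simp add: real_sqrt_mult)
  also have "\<dots> = cosh (arcosh (?B x y) + arcosh (?B y z))"
    using ge by (simp add: cosh_add sinh_arcosh_real)
  finally have "cosh (arcosh (?B x z)) \<le> cosh (arcosh (?B x y) + arcosh (?B y z))"
    using ge by simp
  then show ?thesis
    using ge assms by (subst (asm) cosh_real_nonneg_le_iff) (simp_all add: hyp_dist_def)
qed

lemma Metric_space_hyperboloid: "Metric_space (hyperboloid e) (hyp_dist e)"
proof
  show "0 \<le> hyp_dist e x y" for x y
    by (auto simp: hyp_dist_def intro!: arcosh_nonneg_real minkowski_ge_1(1))
  show "hyp_dist e x y = hyp_dist e y x" for x y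
    by (simp add: hyp_dist_def minkowski_commute)
  show "hyp_dist e x y = 0 \<longleftrightarrow> x = y" if "x \<in> hyperboloid e" "y \<in> hyperboloid e" for x y
    using that minkowski_ge_1[OF that] by (simp add: hyp_dist_def)
qed (rule hyp_dist_triangle)

lemma mspace_hyp_space [simp]: "mspace (hyp_space e) = hyperboloid e"
  by (simp add: hyp_space_def Metric_space.mspace_metric Metric_space_hyperboloid)

lemma mdist_hyp_space [simp]: "mdist (hyp_space e) = hyp_dist e"
  by (simp add: hyp_space_def Metric_space.mdist_metric Metric_space_hyperboloid)

lemma cosh_hyp_dist:
  "x \<in> hyperboloid e \<Longrightarrow> y \<in> hyperboloid e \<Longrightarrow> cosh (hyp_dist e x y) = minkowski e x y"
  by (simp add: hyp_dist_def minkowski_ge_1(1))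


section \<open>Isometries, geodesic convexity, similarity\<close>

definition isometry_group :: "'a metric \<Rightarrow> ('a \<Rightarrow> 'a) monoid" where
  "isometry_group m = BijGroup (mspace m)
     \<lparr>carrier := {f \<in> Bij (mspace m).
        \<forall>x\<in>mspace m. \<forall>y\<in>mspace m. mdist m (f x) (f y) = mdist m x y}\<rparr>"

text \<open>The topology of pointwise convergence; on isometries it is the compact-open topology.\<close>

definition isometry_topology :: "'a metric \<Rightarrow> ('a \<Rightarrow> 'a) topology" where
  "isometry_topology m =
     subtopology (product_topology (\<lambda>_. mtopology_of m) (mspace m)) (carrier (isometry_group m))"

definition translation_length :: "'a metric \<Rightarrow> ('a \<Rightarrow> 'a) \<Rightarrow> real" where
  "translation_length m g = (INF x\<in>mspace m. mdist m (g x) x)"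

definition geodesic :: "'a metric \<Rightarrow> real \<Rightarrow> (real \<Rightarrow> 'a) \<Rightarrow> bool" where
  "geodesic m l c \<longleftrightarrow> 0 \<le> l \<and> c ` {0..l} \<subseteq> mspace m \<and>
     (\<forall>s\<in>{0..l}. \<forall>t\<in>{0..l}. mdist m (c s) (c t) = \<bar>s - t\<bar>)"

definition geodesically_convex :: "'a metric \<Rightarrow> 'a set \<Rightarrow> bool" where
  "geodesically_convex m S \<longleftrightarrow> S \<subseteq> mspace m \<and>
     (\<forall>l c. geodesic m l c \<and> c 0 \<in> S \<and> c l \<in> S \<longrightarrow> c ` {0..l} \<subseteq> S)"

definition isometric_up_to_scaling :: "'a metric \<Rightarrow> 'b metric \<Rightarrow> bool" where
  "isometric_up_to_scaling m m' \<longleftrightarrow> (\<exists>\<mu>>0. \<exists>h. bij_betw h (mspace m) (mspace m') \<and>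
     (\<forall>x\<in>mspace m. \<forall>y\<in>mspace m. mdist m' (h x) (h y) = \<mu> * mdist m x y))"

definition cocompact_action :: "'g set \<Rightarrow> ('g \<Rightarrow> 'a \<Rightarrow> 'a) \<Rightarrow> 'a metric \<Rightarrow> bool" where
  "cocompact_action G act m \<longleftrightarrow>
     (\<exists>K. compactin (mtopology_of m) K \<and> mspace m = (\<Union>g\<in>G. act g ` K))"


section \<open>Representations into the isometry group of a hyperbolic space\<close>

text \<open>
  The hyperboloid spans the ambient space, so an isometry of it has exactly one linear
  extension; this extension is bounded and preserves the form.
\<close>

definition linear_extension :: "'a::real_inner \<Rightarrow> ('a \<Rightarrow> 'a) \<Rightarrow> 'a \<Rightarrow> 'a" where
  "linear_extension e f = (THE T. bounded_linear T \<and> (\<forall>x\<in>hyperboloid e. T x = f x))"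

definition irreducible_rep :: "'g set \<Rightarrow> 'a::real_inner \<Rightarrow> ('g \<Rightarrow> 'a \<Rightarrow> 'a) \<Rightarrow> bool" where
  "irreducible_rep G e \<rho> \<longleftrightarrow>
     (\<forall>W. subspace W \<and> closed W \<and> (\<forall>g\<in>G. linear_extension e (\<rho> g) ` W \<subseteq> W)
        \<longrightarrow> W = {0} \<or> W = UNIV)"

abbreviation isom_n :: "(real \<times> (real ^ 'n) \<Rightarrow> real \<times> (real ^ 'n)) set" where
  "isom_n \<equiv> carrier (isometry_group hyp_space_n)"

definition exotic_rep ::
  "'h::real_inner \<Rightarrow> real \<Rightarrow> ((real \<times> (real ^ 'n) \<Rightarrow> real \<times> (real ^ 'n)) \<Rightarrow> 'h \<Rightarrow> 'h) \<Rightarrow> bool" where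
  "exotic_rep e t \<rho> \<longleftrightarrow>
     \<rho> \<in> hom (isometry_group hyp_space_n) (isometry_group (hyp_space e)) \<and>
     (\<forall>x\<in>hyperboloid e. continuous_map (isometry_topology hyp_space_n)
        (mtopology_of (hyp_space e)) (\<lambda>g. \<rho> g x)) \<and>
     irreducible_rep isom_n e \<rho> \<and>
     (\<forall>g\<in>isom_n.
        translation_length (hyp_space e) (\<rho> g) = t * translation_length hyp_space_n g)"

definition closed_convex_invariant ::
  "'g set \<Rightarrow> ('g \<Rightarrow> 'a \<Rightarrow> 'a) \<Rightarrow> 'a metric \<Rightarrow> 'a set \<Rightarrow> bool" where
  "closed_convex_invariant G \<rho> m S \<longleftrightarrow>
     S \<noteq> {} \<and> closedin (mtopology_of m) S \<and> geodesically_convex m S \<and> (\<forall>g\<in>G. \<rho> g ` S \<subseteq> S)"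

definition minimal_closed_convex_invariant ::
  "'g set \<Rightarrow> ('g \<Rightarrow> 'a \<Rightarrow> 'a) \<Rightarrow> 'a metric \<Rightarrow> 'a set \<Rightarrow> bool" where
  "minimal_closed_convex_invariant G \<rho> m S \<longleftrightarrow>
     closed_convex_invariant G \<rho> m S \<and>
     (\<forall>S'. closed_convex_invariant G \<rho> m S' \<and> S' \<subseteq> S \<longrightarrow> S' = S)"


section \<open>The family of minimal sets\<close>

text \<open>
  The sets for \<open>t < 1\<close> and the space for \<open>t = 1\<close> live in different types;
  to have one family, we take isometric copies in the sum type.
\<close>

definition metric_copy :: "('a \<Rightarrow> 'b) \<Rightarrow> 'a metric \<Rightarrow> 'b metric" where
  "metric_copy f m =
     metric (f ` mspace m, \<lambda>x y. mdist m (inv_into (mspace m) f x) (inv_into (mspace m) f y))"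

lemma Metric_space_metric_copy:
  assumes "inj_on f (mspace m)"
  shows "Metric_space (f ` mspace m)
     (\<lambda>x y. mdist m (inv_into (mspace m) f x) (inv_into (mspace m) f y))"
proof
  show "mdist m (inv_into (mspace m) f x) (inv_into (mspace m) f y) = 0 \<longleftrightarrow> x = y"
    if "x \<in> f ` mspace m" "y \<in> f ` mspace m" for x y
    using that assms by (auto simp: inj_on_eq_iff)
qed (use assms in \<open>auto simp: mdist_commute mdist_triangle\<close>)

lemma mspace_metric_copy [simp]:
  "inj_on f (mspace m) \<Longrightarrow> mspace (metric_copy f m) = f ` mspace m"
  by (simp add: metric_copy_def Metric_space.mspace_metric[OF Metric_space_metric_copy])

lemma mdist_metric_copy [simp]:
  "inj_on f (mspace m) \<Longrightarrow> x \<in> mspace m \<Longrightarrow> y \<in> mspace m \<Longrightarrow>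
     mdist (metric_copy f m) (f x) (f y) = mdist m x y"
  by (simp add: metric_copy_def Metric_space.mdist_metric[OF Metric_space_metric_copy])

definition minimal_space ::
  "'h::real_inner \<Rightarrow> (real \<Rightarrow> 'h set) \<Rightarrow> real \<Rightarrow> ('h + real \<times> (real ^ 'n)) metric" where
  "minimal_space e C t =
     (if t = 1 then metric_copy Inr hyp_space_n
      else metric_copy Inl (submetric (hyp_space e) (C t)))"

definition minimal_action ::
  "(real \<Rightarrow> (real \<times> (real ^ 'n) \<Rightarrow> real \<times> (real ^ 'n)) \<Rightarrow> 'h \<Rightarrow> 'h) \<Rightarrow> real \<Rightarrow>
   (real \<times> (real ^ 'n) \<Rightarrow> real \<times> (real ^ 'n)) \<Rightarrow> 'h + real \<times> (real ^ 'n) \<Rightarrow> 'h + real \<times> (real ^ 'n)" where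
  "minimal_action \<rho> t g = map_sum (\<rho> t g) g"

end

(*
Fix an orbit of rho. Along the one-parameter group of boosts of translation length k the cosh D(k) of
the displacement of the base point has ratios D(k+1)/D(k) that converge exponentially fast, and the
translation lengths force the limit exp t; hence the displacement is t k + O(1). As every isometry of
H^n is a boost between two elements of a compact set, the orbit map is a rough isometry from t H^n.

In the Klein model the orbit is therefore totally bounded, so its closed convex hull is compact. By
minimality C is contained in every closed convex set that contains the orbit. Hence closed balls of C
are compact, and every point of C lies, up to a bounded error, between two orbit points, hence at
bounded distance from the orbit; this gives cocompactness.

A similarity of ratio mu from C_t to C_t' respects midpoints, and the hyperbolic law of the median
in large nearly equilateral triangles of both spaces forces mu = 1. Then H^n would have a rough
self-similarity of ratio t / t', and its inverse has ratio t' / t. A ratio s > 1 is impossible: a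
circle of radius R has length of order exp R, so that its image would have visual length of order
exp (R - s R), although it contains points that are almost opposite.
*)
theory Submission
  imports Defs
begin

section \<open>The hyperboloid\<close>

text \<open>Balls of the infinite-dimensional hyperboloid are not compact, so every compactness
  statement has to come from the group. The Klein model is chosen because it turns geodesic
  convexity into linear convexity, and in a Hilbert space the closed convex hull of a totally
  bounded set is compact. The orbit estimate must have an additive error: under \<open>cosh\<close>
  it becomes a constant factor, which all later estimates tolerate, while a multiplicative error in
  the distance would ruin them. A translation length, being an infimum, bounds displacements from
  below at once, but from above it gives only their growth rate, with a loss \<epsilon>; the fast
  convergence of the ratios removes this loss. The ratio \<mu> is determined first because the large
  scale alone cannot do it: \<open>C t\<close> looks like \<open>t\<close> times hyperbolic n-space,
  so a similarity of ratio \<mu> would only yield \<mu> t = t'. What fixes \<mu> is that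
  \<open>C t\<close> is convex in a space of curvature -1, where the law of the median holds
  exactly.\<close>

definition hyp_base :: "'a::real_inner \<Rightarrow> 'a" where
  "hyp_base e = e /\<^sub>R norm e"

text \<open>Up to a term of rank one the form is minus the Hilbert inner product. Hence it is
  continuous for the norm, and on the orthogonal complement of \<open>hyp_base e\<close> it is
  negative definite with the Hilbert norm.\<close>

lemma minkowski_inner:
  assumes "e \<noteq> 0"
  shows "minkowski e v w = 2 * (v \<bullet> hyp_base e) * (w \<bullet> hyp_base e) - v \<bullet> w"
proof -
  have *: "line_proj e x = (x \<bullet> hyp_base e) *\<^sub>R hyp_base e" for x
    using assms by (simp add: line_proj_def hyp_base_def dot_square_norm power2_eq_square divide_inverse)
  have "hyp_base e \<bullet> hyp_base e = 1"
    using assms by (simp add: hyp_base_def dot_square_norm power2_eq_square)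
  then show ?thesis
    unfolding minkowski_def *
    by (simp add: inner_diff_left inner_diff_right inner_commute algebra_simps)
qed

lemma hyp_base_inner_self: "e \<noteq> 0 \<Longrightarrow> hyp_base e \<bullet> hyp_base e = 1"
  by (simp add: hyp_base_def dot_square_norm power2_eq_square)

lemma minkowski_hyp_base: "e \<noteq> 0 \<Longrightarrow> minkowski e v (hyp_base e) = v \<bullet> hyp_base e"
  by (simp add: minkowski_inner hyp_base_inner_self)

lemma minkowski_axis: "minkowski e v e = norm e * minkowski e v (hyp_base e)"
  by (cases "e = 0") (simp_all add: hyp_base_def minkowski_bilinear, simp add: minkowski_def line_proj_def)

lemma hyp_base_mem: "e \<noteq> 0 \<Longrightarrow> hyp_base e \<in> hyperboloid e"
  unfolding hyperboloid_def mem_Collect_eq minkowski_axis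
  by (simp add: minkowski_hyp_base hyp_base_inner_self)

lemma hyperboloidD: "v \<in> hyperboloid e \<Longrightarrow> minkowski e v v = 1"
  by (simp add: hyperboloid_def)

lemma inner_hyp_base_ge_1: "v \<in> hyperboloid e \<Longrightarrow> v \<bullet> hyp_base e \<ge> 1"
  by (metis hyp_base_mem hyperboloid_nonzero minkowski_ge_1(1) minkowski_hyp_base)

lemma norm_sq_hyperboloid:
  "v \<in> hyperboloid e \<Longrightarrow> (norm v)\<^sup>2 = 2 * (v \<bullet> hyp_base e)\<^sup>2 - 1"
  using minkowski_inner[of e v v] hyperboloidD[of v e] hyperboloid_nonzero[of v e]
  by (simp add: dot_square_norm power2_eq_square)

text \<open>The vectors of square 1 form two sheets. If \<open>v\<close> were on the wrong one,
  \<open>- v\<close> would be a point of the hyperboloid, and its product with \<open>y\<close>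
  would be at least 1. So any point \<open>y\<close> can replace \<open>e\<close> in the test for
  the sheet; combinations, reflections and boosts are kept on the hyperboloid in this way.\<close>

lemma hyperboloid_forward:
  assumes v: "minkowski e v v = 1" and y: "y \<in> hyperboloid e" and vy: "minkowski e v y > 0"
  shows "v \<in> hyperboloid e"
proof (rule ccontr)
  assume n: "v \<notin> hyperboloid e"
  have e: "e \<noteq> 0" using hyperboloid_nonzero[OF y] .
  have "minkowski e v e \<le> 0"
    using n v by (auto simp: hyperboloid_def)
  then have le: "minkowski e v (hyp_base e) \<le> 0"
    using e by (simp add: minkowski_axis mult_le_0_iff)
  moreover have "minkowski e v (hyp_base e) \<noteq> 0"
    using minkowski_nonpos_orthogonal[OF hyp_base_mem[OF e], of v] v by auto
  ultimately have lt: "minkowski e (- v) e > 0"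
    using e minkowski_scaleR_left[of e "-1" v e] by (simp add: minkowski_axis mult_pos_neg)
  have "minkowski e (- v) (- v) = 1"
    using v minkowski_scaleR_left[of e "-1" v] minkowski_scaleR_right[of e _ "-1" v] by simp
  with lt have "- v \<in> hyperboloid e"
    by (simp add: hyperboloid_def)
  then have "minkowski e (- v) y \<ge> 1"
    using y by (rule minkowski_ge_1(1))
  then show False
    using vy minkowski_scaleR_left[of e "-1" v y] by simp
qed

lemma continuous_on_minkowski [continuous_intros]:
  assumes "continuous_on S f" "continuous_on S g"
  shows "continuous_on S (\<lambda>x. minkowski e (f x) (g x))"
proof (cases "e = 0")
  case True
  then show ?thesis
    unfolding minkowski_def line_proj_def by (auto intro!: continuous_intros assms)
next
  case False
  then show ?thesis
    unfolding minkowski_inner[OF False] by (intro continuous_intros assms)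
qed

lemma closed_hyperboloid: "closed (hyperboloid e)"
proof (cases "e = 0")
  case True
  then have "hyperboloid e = {}"
    using hyperboloid_nonzero by auto
  then show ?thesis by simp
next
  case False
  have "hyperboloid e = {v. minkowski e v v = 1} \<inter> {v. 1 \<le> v \<bullet> hyp_base e}"
    using False hyperboloid_forward[OF _ hyp_base_mem[OF False]] inner_hyp_base_ge_1
    by (auto simp: hyperboloidD minkowski_hyp_base)
  also have "closed \<dots>"
    by (intro closed_Int closed_Collect_eq closed_Collect_le continuous_intros)
  finally show ?thesis .
qed

lemma hyp_dist_eq_arcosh:
  "x \<in> hyperboloid e \<Longrightarrow> y \<in> hyperboloid e \<Longrightarrow> hyp_dist e x y = arcosh (minkowski e x y)"
  by (simp add: hyp_dist_def)

lemma hyp_dist_nonneg: "0 \<le> hyp_dist e x y"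
  by (rule Metric_space.nonneg[OF Metric_space_hyperboloid])

lemma hyp_dist_commute: "hyp_dist e x y = hyp_dist e y x"
  by (rule Metric_space.commute[OF Metric_space_hyperboloid])

lemma hyp_dist_self: "hyp_dist e x x = 0"
  by (simp add: hyp_dist_def hyperboloidD)

lemma hyp_dist_eq_iff:
  assumes "x \<in> hyperboloid e" "y \<in> hyperboloid e" "x' \<in> hyperboloid e'" "y' \<in> hyperboloid e'"
  shows "hyp_dist e x y = hyp_dist e' x' y' \<longleftrightarrow> minkowski e x y = minkowski e' x' y'"
  using assms by (metis cosh_hyp_dist hyp_dist_eq_arcosh)

lemma hyp_dist_le_iff:
  assumes "x \<in> hyperboloid e" "y \<in> hyperboloid e" "0 \<le> a"
  shows "hyp_dist e x y \<le> a \<longleftrightarrow> minkowski e x y \<le> cosh a"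
  using assms cosh_real_nonneg_le_iff[of "hyp_dist e x y" a] by (simp add: hyp_dist_nonneg cosh_hyp_dist)

lemma hyp_distI:
  assumes "x \<in> hyperboloid e" "y \<in> hyperboloid e" "minkowski e x y = cosh a"
  shows "hyp_dist e x y = \<bar>a\<bar>"
  using assms by (metis abs_ge_zero arcosh_cosh_real cosh_real_abs hyp_dist_eq_arcosh)

lemma cosh_exp_bounds:
  fixes a :: real
  assumes "0 \<le> a"
  shows "exp a / 2 \<le> cosh a" "cosh a \<le> exp a"
  using assms by (simp_all add: cosh_def)

lemma minkowski_exp_bounds:
  assumes "x \<in> hyperboloid e" "y \<in> hyperboloid e"
  shows "exp (hyp_dist e x y) / 2 \<le> minkowski e x y" "minkowski e x y \<le> exp (hyp_dist e x y)"
  using cosh_exp_bounds[OF hyp_dist_nonneg, of e x y] assms by (simp_all add: cosh_hyp_dist)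

text \<open>The form at \<open>x - y\<close> is evaluated by bilinearity and by
  \<open>minkowski_inner\<close>. The result controls the Hilbert distance by two hyperbolic
  quantities, the difference of the heights and the distance of the points.\<close>

lemma dist_sq_hyperboloid:
  assumes "x \<in> hyperboloid e" "y \<in> hyperboloid e"
  shows "(norm (x - y))\<^sup>2 = 2 * (x \<bullet> hyp_base e - y \<bullet> hyp_base e)\<^sup>2 + 2 * (minkowski e x y - 1)"
proof -
  have e: "e \<noteq> 0" using hyperboloid_nonzero[OF assms(1)] .
  have "minkowski e (x - y) (x - y) = 2 - 2 * minkowski e x y"
    using assms by (simp add: minkowski_bilinear hyperboloidD minkowski_commute[of e y x])
  moreover have "minkowski e (x - y) (x - y)
      = 2 * (x \<bullet> hyp_base e - y \<bullet> hyp_base e)\<^sup>2 - (norm (x - y))\<^sup>2"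
    unfolding minkowski_inner[OF e] dot_square_norm inner_diff_left[of x y "hyp_base e"]
    by (simp add: power2_eq_square)
  ultimately show ?thesis by simp
qed

lemma continuous_on_hyp_dist:
  assumes "continuous_on S f" "continuous_on S g" "f ` S \<subseteq> hyperboloid e" "g ` S \<subseteq> hyperboloid e"
  shows "continuous_on S (\<lambda>x. hyp_dist e (f x) (g x))"
proof -
  have "continuous_on S (\<lambda>x. arcosh (minkowski e (f x) (g x)))"
    by (rule continuous_on_compose2[OF continuous_on_arcosh[OF order_refl] continuous_on_minkowski])
      (use assms in \<open>auto simp: image_subset_iff intro: minkowski_ge_1(1)\<close>)
  then show ?thesis
    by (rule continuous_on_eq) (use assms in \<open>auto simp: hyp_dist_eq_arcosh subset_iff\<close>)
qed

text \<open>One of the two ends \<open>M\<close>, \<open>P\<close> is at least as far from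
  \<open>A\<close> as \<open>b\<close> is. The sum avoids deciding which end, and unlike a case
  distinction it is visibly continuous in the application.\<close>

lemma sq_diff_le_sum:
  fixes A b M P :: real
  assumes "b \<le> P" "M \<le> b"
  shows "(A - b)\<^sup>2 \<le> (P - A)\<^sup>2 + (M - A)\<^sup>2"
proof (cases "A \<le> b")
  case True
  then have "(b - A)\<^sup>2 \<le> (P - A)\<^sup>2"
    using assms by (intro power_mono) auto
  then show ?thesis
    using zero_le_power2[of "M - A"] power2_commute[of A b] by linarith
next
  case False
  then have "(A - b)\<^sup>2 \<le> (A - M)\<^sup>2"
    using assms by (intro power_mono) auto
  then show ?thesis
    using zero_le_power2[of "P - A"] power2_commute[of A M] by linarith
qed

text \<open>Closedness and compactness can henceforth be treated in the Hilbert norm.\<close>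

lemma mtopology_hyp_space: "mtopology_of (hyp_space e) = top_of_set (hyperboloid e)"
proof -
  interpret M: Metric_space "hyperboloid e" "hyp_dist e"
    by (rule Metric_space_hyperboloid)
  have "openin M.mtopology U \<longleftrightarrow> openin (top_of_set (hyperboloid e)) U" for U
  proof
    assume U: "openin M.mtopology U"
    show "openin (top_of_set (hyperboloid e)) U"
    proof (subst openin_subopen, intro ballI)
      fix x assume x: "x \<in> U"
      then obtain r where r: "r > 0" "M.mball x r \<subseteq> U"
        using U M.openin_mtopology by blast
      have xH: "x \<in> hyperboloid e"
        using U x M.openin_mtopology by blast
      have "openin (top_of_set (hyperboloid e)) (hyperboloid e \<inter> hyp_dist e x -` {..<r})"
        using xH by (intro continuous_openin_preimage_gen[OF continuous_on_hyp_dist])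
          (auto intro!: continuous_intros)
      moreover have "hyperboloid e \<inter> hyp_dist e x -` {..<r} = M.mball x r"
        using xH by auto
      ultimately show "\<exists>T. openin (top_of_set (hyperboloid e)) T \<and> x \<in> T \<and> T \<subseteq> U"
        using r xH by (metis M.centre_in_mball_iff)
    qed
  next
    assume U: "openin (top_of_set (hyperboloid e)) U"
    then have UH: "U \<subseteq> hyperboloid e"
      by (auto dest: openin_imp_subset)
    have "\<exists>r>0. M.mball x r \<subseteq> U" if x: "x \<in> U" for x
    proof -
      have xH: "x \<in> hyperboloid e" using x UH by blast
      define u where "u = hyp_base e"
      have uH: "u \<in> hyperboloid e"
        unfolding u_def by (rule hyp_base_mem[OF hyperboloid_nonzero[OF xH]])
      obtain \<epsilon> where \<epsilon>: "\<epsilon> > 0" "\<And>y. y \<in> hyperboloid e \<Longrightarrow> dist y x < \<epsilon> \<Longrightarrow> y \<in> U"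
        using U x unfolding openin_euclidean_subtopology_iff by metis
      \<comment> \<open>A point at hyperbolic distance \<open>s\<close> from \<open>x\<close> has
        its distance to \<open>u\<close> within \<open>s\<close> of that of \<open>x\<close>. So
        \<open>F s\<close> bounds the squared norm distance to \<open>x\<close>, uniformly over all
        such points, and it tends to 0 with \<open>s\<close>.\<close>
      define F where "F = (\<lambda>s. 2 * (cosh (hyp_dist e x u + s) - cosh (hyp_dist e x u))\<^sup>2
          + 2 * (cosh (hyp_dist e x u - s) - cosh (hyp_dist e x u))\<^sup>2 + 2 * (cosh s - 1))"
      have "isCont F 0"
        unfolding F_def by (intro continuous_intros)
      moreover have "F 0 = 0" by (simp add: F_def)
      ultimately obtain \<delta> where \<delta>: "\<delta> > 0" "\<And>s. \<bar>s\<bar> < \<delta> \<Longrightarrow> \<bar>F s\<bar> < \<epsilon>\<^sup>2"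
        using \<epsilon>(1) unfolding continuous_at_eps_delta dist_real_def
        by (metis diff_zero zero_less_power)
      have "M.mball x \<delta> \<subseteq> U"
      proof
        fix y assume "y \<in> M.mball x \<delta>"
        then have yH: "y \<in> hyperboloid e" and d: "hyp_dist e x y < \<delta>" by auto
        let ?a = "hyp_dist e x u" and ?b = "hyp_dist e y u" and ?s = "hyp_dist e x y"
        have tri: "?b \<le> ?a + ?s" "?a \<le> ?b + ?s" "?s \<le> ?a + ?b"
          using hyp_dist_triangle[OF yH xH uH] hyp_dist_triangle[OF xH yH uH]
            hyp_dist_triangle[OF xH uH yH]
          by (simp_all add: hyp_dist_commute[of e y x] hyp_dist_commute[of e u y])
        have "cosh ?b \<le> cosh (?a + ?s)"
          using tri by (subst cosh_real_nonneg_le_iff) (auto simp: hyp_dist_nonneg)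
        moreover have "cosh \<bar>?a - ?s\<bar> \<le> cosh ?b"
          using tri by (subst cosh_real_nonneg_le_iff) (auto simp: hyp_dist_nonneg)
        then have "cosh (?a - ?s) \<le> cosh ?b"
          by (simp only: cosh_real_abs)
        ultimately have "(cosh ?a - cosh ?b)\<^sup>2 \<le> (cosh (?a + ?s) - cosh ?a)\<^sup>2 +
            (cosh (?a - ?s) - cosh ?a)\<^sup>2"
          by (rule sq_diff_le_sum)
        then have "(norm (x - y))\<^sup>2 \<le> F ?s"
          using dist_sq_hyperboloid[OF xH yH] xH yH uH hyperboloid_nonzero[OF xH]
          by (simp add: F_def cosh_hyp_dist u_def minkowski_hyp_base)
        also have "\<dots> < \<epsilon>\<^sup>2"
          using \<delta>(2)[of ?s] d hyp_dist_nonneg[of e x y] by linarith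
        finally have "norm (x - y) < \<epsilon>"
          using \<epsilon>(1) by (simp add: power_less_imp_less_base)
        then show "y \<in> U"
          using \<epsilon>(2)[OF yH] by (simp add: dist_norm norm_minus_commute)
      qed
      then show ?thesis using \<delta>(1) by blast
    qed
    then show "openin M.mtopology U"
      using UH M.openin_mtopology by blast
  qed
  then show ?thesis
    by (simp add: mtopology_of_def topology_eq)
qed

lemma compactin_hyp_space:
  "compactin (mtopology_of (hyp_space e)) K \<longleftrightarrow> compact K \<and> K \<subseteq> hyperboloid e"
  by (simp add: mtopology_hyp_space compactin_subtopology)

lemma closedin_hyp_space:
  "closedin (mtopology_of (hyp_space e)) K \<longleftrightarrow> closed K \<and> K \<subseteq> hyperboloid e"
  by (simp add: mtopology_hyp_space closedin_closed_eq closed_hyperboloid)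

section \<open>Geodesics as linear combinations of their end points\<close>

text \<open>The coefficients solve the two linear equations that prescribe the products with
  \<open>x\<close> and \<open>y\<close>; the addition theorems then show that the square is
  1.\<close>

lemma hyp_combination:
  fixes a b :: real
  assumes x: "x \<in> hyperboloid e" and y: "y \<in> hyperboloid e" and B: "minkowski e x y = cosh (a + b)"
    and ab: "0 \<le> a" "0 \<le> b" "0 < a + b"
  defines "w \<equiv> (sinh b / sinh (a + b)) *\<^sub>R x + (sinh a / sinh (a + b)) *\<^sub>R y"
  shows "w \<in> hyperboloid e" "minkowski e w x = cosh a" "minkowski e w y = cosh b"
proof -
  have s: "sinh (a + b) > 0" using ab by simp
  have 1: "sinh b + sinh a * cosh (a + b) = cosh a * sinh (a + b)"
    using sinh_diff[of "a + b" a] by (simp add: algebra_simps)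
  have 2: "sinh b * cosh (a + b) + sinh a = cosh b * sinh (a + b)"
    using sinh_diff[of "a + b" b] by (simp add: algebra_simps)
  have "minkowski e w x = (sinh b + sinh a * cosh (a + b)) / sinh (a + b)"
    using B x y by (simp add: w_def minkowski_bilinear hyperboloidD minkowski_commute[of e y x] add_divide_distrib)
  then show wx: "minkowski e w x = cosh a"
    using s by (simp add: 1)
  have "minkowski e w y = (sinh b * cosh (a + b) + sinh a) / sinh (a + b)"
    using B x y by (simp add: w_def minkowski_bilinear hyperboloidD add_divide_distrib)
  then show wy: "minkowski e w y = cosh b"
    using s by (simp add: 2)
  have "minkowski e w w = (sinh b / sinh (a + b)) * minkowski e w x + (sinh a / sinh (a + b)) * minkowski e w y"
    by (subst (2) w_def) (simp add: minkowski_bilinear)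
  also have "\<dots> = (sinh b * cosh a + sinh a * cosh b) / sinh (a + b)"
    by (simp add: wx wy add_divide_distrib)
  also have "\<dots> = 1"
    using s by (simp add: sinh_add algebra_simps)
  finally show "w \<in> hyperboloid e"
    using x wx by (auto intro: hyperboloid_forward)
qed

text \<open>The product of \<open>z\<close> with the point found in \<open>hyp_combination\<close>
  turns out to be 1, and this happens only for equal points. Geodesics are therefore unique and lie
  in the plane of their ends.\<close>

lemma hyp_between:
  fixes a b :: real
  assumes x: "x \<in> hyperboloid e" and y: "y \<in> hyperboloid e" and z: "z \<in> hyperboloid e"
    and d: "hyp_dist e x z = a" "hyp_dist e z y = b" "hyp_dist e x y = a + b" and pos: "0 < a + b"
  shows "z = (sinh b / sinh (a + b)) *\<^sub>R x + (sinh a / sinh (a + b)) *\<^sub>R y"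
proof -
  have ab: "0 \<le> a" "0 \<le> b" using d hyp_dist_nonneg by metis+
  have B: "minkowski e x y = cosh (a + b)" "minkowski e z x = cosh a" "minkowski e z y = cosh b"
    using cosh_hyp_dist[OF x y] cosh_hyp_dist[OF z y] cosh_hyp_dist[OF x z] d
    by (simp_all add: minkowski_commute)
  let ?w = "(sinh b / sinh (a + b)) *\<^sub>R x + (sinh a / sinh (a + b)) *\<^sub>R y"
  have "minkowski e z ?w = (sinh b * cosh a + sinh a * cosh b) / sinh (a + b)"
    by (simp add: minkowski_bilinear B add_divide_distrib)
  also have "\<dots> = 1"
    using sinh_real_pos_iff[of "a + b"] pos by (simp add: sinh_add algebra_simps)
  finally show ?thesis
    using minkowski_ge_1(2)[OF z hyp_combination(1)[OF x y B(1) ab pos]] by blast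
qed

lemma geodesic_hyp_exists:
  assumes x: "x \<in> hyperboloid e" and y: "y \<in> hyperboloid e"
  obtains c where "geodesic (hyp_space e) (hyp_dist e x y) c" "c 0 = x" "c (hyp_dist e x y) = y"
proof (cases "hyp_dist e x y = 0")
  case True
  then have "x = y"
    using Metric_space.zero[OF Metric_space_hyperboloid] x y by blast
  then show ?thesis
    using that[of "\<lambda>_. x"] x by (simp add: geodesic_def hyp_dist_self)
next
  case False
  define l where "l = hyp_dist e x y"
  have l: "l > 0" using False hyp_dist_nonneg[of e x y] by (simp add: l_def)
  then have sl: "sinh l \<noteq> 0" by simp
  define c where "c = (\<lambda>s. (sinh (l - s) / sinh l) *\<^sub>R x + (sinh s / sinh l) *\<^sub>R y)"
  have B: "minkowski e x y = cosh l"
    using cosh_hyp_dist[OF x y] by (simp add: l_def)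
  have c: "c s \<in> hyperboloid e" "minkowski e (c s) x = cosh s" "minkowski e (c s) y = cosh (l - s)"
    if "s \<in> {0..l}" for s
    using hyp_combination[OF x y, of s "l - s"] that B l by (simp_all add: c_def)
  have "hyp_dist e (c s) (c t) = \<bar>s - t\<bar>" if st: "s \<in> {0..l}" "t \<in> {0..l}" for s t
  proof (rule hyp_distI)
    have "minkowski e (c s) (c t) = (sinh (l - t) / sinh l) * minkowski e (c s) x
        + (sinh t / sinh l) * minkowski e (c s) y"
      by (subst (2) c_def) (simp add: minkowski_bilinear)
    also have "\<dots> = (sinh (l - t) * cosh s + sinh t * cosh (l - s)) / sinh l"
      using c[OF st(1)] by (simp add: add_divide_distrib)
    also have "sinh (l - t) * cosh s + sinh t * cosh (l - s) = sinh l * cosh (s - t)"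
      by (simp add: sinh_diff cosh_diff algebra_simps)
    finally show "minkowski e (c s) (c t) = cosh (s - t)"
      using sl by simp
  qed (use c st in auto)
  moreover have "c 0 = x" "c l = y"
    using sl by (simp_all add: c_def)
  ultimately show ?thesis
    using that[of c] c(1) l unfolding geodesic_def by (simp add: image_subset_iff flip: l_def)
qed

text \<open>By \<open>hyp_between\<close> the points of a geodesic are nonnegative combinations of
  its ends. Intersections of the hyperboloid with convex cones are thus geodesically convex, in
  particular sets given by homogeneous linear inequalities.\<close>

lemma geodesically_convexI:
  assumes S: "S \<subseteq> hyperboloid e"
    and comb: "\<And>x y \<alpha> \<beta>. x \<in> S \<Longrightarrow> y \<in> S \<Longrightarrow> 0 \<le> \<alpha> \<Longrightarrow> 0 \<le> \<beta> \<Longrightarrow>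
      \<alpha> *\<^sub>R x + \<beta> *\<^sub>R y \<in> hyperboloid e \<Longrightarrow> \<alpha> *\<^sub>R x + \<beta> *\<^sub>R y \<in> S"
  shows "geodesically_convex (hyp_space e) S"
  unfolding geodesically_convex_def
proof (intro conjI allI impI subsetI)
  fix l c z assume c: "geodesic (hyp_space e) l c \<and> c 0 \<in> S \<and> c l \<in> S" and "z \<in> c ` {0..l}"
  then obtain s where s: "s \<in> {0..l}" "z = c s" by blast
  have l: "0 \<le> l" and cH: "\<And>s. s \<in> {0..l} \<Longrightarrow> c s \<in> hyperboloid e"
    and d: "\<And>s t. s \<in> {0..l} \<Longrightarrow> t \<in> {0..l} \<Longrightarrow> hyp_dist e (c s) (c t) = \<bar>s - t\<bar>"
    using c by (auto simp: geodesic_def)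
  show "z \<in> S"
  proof (cases "l = 0")
    case True
    then show ?thesis using s c by auto
  next
    case False
    have "c s = (sinh (l - s) / sinh (s + (l - s))) *\<^sub>R c 0 + (sinh s / sinh (s + (l - s))) *\<^sub>R c l"
      using s l False by (intro hyp_between[of _ e] cH) (auto simp: d)
    moreover have "0 \<le> sinh (l - s) / sinh (s + (l - s))" "0 \<le> sinh s / sinh (s + (l - s))"
      using s l by simp_all
    ultimately show ?thesis
      using comb[of "c 0" "c l"] c cH[OF s(1)] s(2) by metis
  qed
qed (use S in \<open>simp add: subset_iff\<close>)

lemma geodesically_convex_between:
  assumes S: "geodesically_convex (hyp_space e) S" and x: "x \<in> S" and y: "y \<in> S"
    and ab: "0 \<le> a" "0 \<le> b" "hyp_dist e x y = a + b"
  obtains z where "z \<in> S" "hyp_dist e x z = a" "hyp_dist e z y = b"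
proof -
  have "x \<in> hyperboloid e" "y \<in> hyperboloid e"
    using S x y by (auto simp: geodesically_convex_def)
  then obtain c where c: "geodesic (hyp_space e) (a + b) c" "c 0 = x" "c (a + b) = y"
    using geodesic_hyp_exists ab by metis
  have "c a \<in> S"
    using S c x y ab unfolding geodesically_convex_def
    by (metis atLeastAtMost_iff image_subset_iff le_add_same_cancel1)
  moreover have "hyp_dist e (c 0) (c a) = a" "hyp_dist e (c a) (c (a + b)) = b"
    using c ab by (auto simp: geodesic_def)
  ultimately show ?thesis
    using that c by metis
qed

text \<open>The law of the median: \<open>x + y\<close> equals \<open>2 * cosh a\<close> times the
  midpoint, and the product with \<open>z\<close> is linear.\<close>

lemma hyp_midpoint:
  assumes x: "x \<in> hyperboloid e" and y: "y \<in> hyperboloid e" and m: "m \<in> hyperboloid e"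
    and d: "hyp_dist e x m = a" "hyp_dist e m y = a" "hyp_dist e x y = 2 * a"
  shows "2 * cosh a * minkowski e z m = minkowski e z x + minkowski e z y"
proof (cases "a = 0")
  case True
  then have "x = m" "m = y"
    using Metric_space.zero[OF Metric_space_hyperboloid] x y m d by blast+
  then show ?thesis using True by simp
next
  case False
  then have a: "a > 0" using d hyp_dist_nonneg[of e x m] by simp
  have "m = (sinh a / sinh (a + a)) *\<^sub>R x + (sinh a / sinh (a + a)) *\<^sub>R y"
    using a by (intro hyp_between[of _ e] x y m) (auto simp: d)
  moreover have "sinh a / sinh (a + a) = 1 / (2 * cosh a)"
    using a by (simp add: sinh_double)
  ultimately have "m = (1 / (2 * cosh a)) *\<^sub>R (x + y)"
    by (simp add: scaleR_add_right)
  then show ?thesis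
    by (simp add: minkowski_bilinear)
qed

section \<open>The Klein model: central projection to the hyperplane of height 1\<close>

definition klein :: "'a::real_inner \<Rightarrow> 'a \<Rightarrow> 'a" where
  "klein e y = y /\<^sub>R (y \<bullet> hyp_base e)"

lemma klein_dist_sq:
  assumes x: "x \<in> hyperboloid e" and y: "y \<in> hyperboloid e"
  shows "(norm (klein e x - klein e y))\<^sup>2 = 2 * minkowski e x y / ((x \<bullet> hyp_base e) * (y \<bullet> hyp_base e))
     - 1 / (x \<bullet> hyp_base e)\<^sup>2 - 1 / (y \<bullet> hyp_base e)\<^sup>2"
proof -
  have e: "e \<noteq> 0" using hyperboloid_nonzero[OF x] .
  let ?p = "x \<bullet> hyp_base e" and ?q = "y \<bullet> hyp_base e"
  have pq: "?p \<noteq> 0" "?q \<noteq> 0"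
    using inner_hyp_base_ge_1[OF x] inner_hyp_base_ge_1[OF y] by auto
  let ?v = "klein e x - klein e y"
  \<comment> \<open>Both projections have height 1, so their difference lies where the form is minus
    the squared norm.\<close>
  have "?v \<bullet> hyp_base e = 0"
    using pq by (simp add: klein_def inner_diff_left)
  then have "(norm ?v)\<^sup>2 = - minkowski e ?v ?v"
    by (simp add: minkowski_inner[OF e] power2_norm_eq_inner)
  also have "\<dots> = 2 * minkowski e x y / (?p * ?q) - 1 / ?p\<^sup>2 - 1 / ?q\<^sup>2"
    using pq by (simp add: klein_def minkowski_bilinear hyperboloidD[OF x] hyperboloidD[OF y]
        minkowski_commute[of e y x] power2_eq_square field_simps)
  finally show ?thesis .
qed

text \<open>Up to a constant factor the bound is \<open>exp\<close> of d(x,y) - d(x,o) - d(y,o) with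
  o the base point, that is, \<open>exp\<close> of minus twice the Gromov product. Points far out in
  nearly the same direction are close in the Klein model.\<close>

lemma klein_dist_le:
  assumes x: "x \<in> hyperboloid e" and y: "y \<in> hyperboloid e"
  shows "(norm (klein e x - klein e y))\<^sup>2 \<le> 2 * minkowski e x y / ((x \<bullet> hyp_base e) * (y \<bullet> hyp_base e))"
  using klein_dist_sq[OF assms] zero_le_divide_1_iff[of "(x \<bullet> hyp_base e)\<^sup>2"]
    zero_le_divide_1_iff[of "(y \<bullet> hyp_base e)\<^sup>2"] zero_le_power2[of "x \<bullet> hyp_base e"]
    zero_le_power2[of "y \<bullet> hyp_base e"] by linarith

text \<open>The triangle inequality for the Klein model centred at \<open>y\<close>, in the form
  \<open>|a - c|\<^sup>2 \<le> 2 |a - b|\<^sup>2 + 2 |b - c|\<^sup>2\<close>.\<close>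

lemma hyp_four_point:
  assumes z: "z \<in> hyperboloid e" and w: "w \<in> hyperboloid e" and y: "y \<in> hyperboloid e"
    and v: "v \<in> hyperboloid e"
  shows "minkowski e z w * minkowski e y v
    \<le> 2 * (minkowski e z v * minkowski e w y + minkowski e w v * minkowski e z y)"
proof -
  let ?B = "minkowski e"
  define p q r where "p = ?B z y" and "q = ?B w y" and "r = ?B v y"
  have pos: "p \<ge> 1" "q \<ge> 1" "r \<ge> 1"
    unfolding p_def q_def r_def using minkowski_ge_1(1) assms by blast+
  \<comment> \<open>With a, b, c the projections of \<open>z\<close>, \<open>v\<close>,
    \<open>w\<close> this is a - 2 b + c, whose squared length is exactly the defect of the
    inequality, by the parallelogram law.\<close>
  define n where "n = z /\<^sub>R p - (2 / r) *\<^sub>R v + w /\<^sub>R q"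
  have "?B n y = 0"
    using pos by (simp add: n_def minkowski_bilinear flip: p_def q_def r_def)
  then have "?B n n \<le> 0"
    by (rule minkowski_nonpos_orthogonal[OF y])
  moreover have "?B n n = 1 / p\<^sup>2 + 4 / r\<^sup>2 + 1 / q\<^sup>2 - 4 * ?B z v / (p * r) - 4 * ?B w v / (q * r)
      + 2 * ?B z w / (p * q)"
    using pos by (simp add: n_def minkowski_bilinear hyperboloidD[OF z] hyperboloidD[OF v] hyperboloidD[OF w]
        minkowski_commute[of e v z] minkowski_commute[of e v w] minkowski_commute[of e w z]
        power2_eq_square field_simps)
  moreover have "0 \<le> 1 / p\<^sup>2 + 4 / r\<^sup>2 + 1 / q\<^sup>2"
    by simp
  ultimately have "2 * ?B z w / (p * q) \<le> 4 * ?B z v / (p * r) + 4 * ?B w v / (q * r)"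
    by linarith
  then have "(2 * ?B z w / (p * q)) * (p * q * r / 2) \<le> (4 * ?B z v / (p * r) + 4 * ?B w v / (q * r)) * (p * q * r / 2)"
    using pos by (intro mult_right_mono) auto
  moreover have "(2 * ?B z w / (p * q)) * (p * q * r / 2) = ?B z w * r"
    using pos by simp
  moreover have "(4 * ?B z v / (p * r) + 4 * ?B w v / (q * r)) * (p * q * r / 2)
      = 2 * (?B z v * q + ?B w v * p)"
    using pos by (simp add: field_simps)
  ultimately show ?thesis
    by (simp add: p_def q_def r_def minkowski_commute[of e v y])
qed

text \<open>The reflection in the hyperplane equidistant from \<open>x\<close> and \<open>y\<close>;
  it exchanges the two points. It is set to the identity for \<open>x = y\<close>, so that its users
  need not exclude this case.\<close>

definition hyp_reflection :: "'a::real_inner \<Rightarrow> 'a \<Rightarrow> 'a \<Rightarrow> 'a \<Rightarrow> 'a" where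
  "hyp_reflection e x y v =
     (if x = y then v else v - (2 * minkowski e v (x - y) / minkowski e (x - y) (x - y)) *\<^sub>R (x - y))"

lemma hyp_reflection:
  assumes x: "x \<in> hyperboloid e" and y: "y \<in> hyperboloid e"
  shows minkowski_hyp_reflection:
      "minkowski e (hyp_reflection e x y v) (hyp_reflection e x y w) = minkowski e v w"
    and hyp_reflection_left: "hyp_reflection e x y x = y"
    and hyp_reflection_involution: "hyp_reflection e x y (hyp_reflection e x y v) = v"
    and hyp_reflection_fix:
      "minkowski e v x = minkowski e v y \<Longrightarrow> hyp_reflection e x y v = v"
    and hyp_reflection_mem: "v \<in> hyperboloid e \<Longrightarrow> hyp_reflection e x y v \<in> hyperboloid e"
proof -
  have n: "minkowski e (x - y) (x - y) = 2 - 2 * minkowski e x y"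
    using x y by (simp add: minkowski_bilinear hyperboloidD minkowski_commute[of e y x])
  have n0: "minkowski e (x - y) (x - y) \<noteq> 0" if "x \<noteq> y"
    using minkowski_ge_1(2)[OF x y] that unfolding n by simp
  have inv: "minkowski e (hyp_reflection e x y v) (hyp_reflection e x y w) = minkowski e v w" for v w
  proof (cases "x = y")
    case False
    define u where "u = x - y"
    have R: "hyp_reflection e x y w = w - (2 * minkowski e w u / minkowski e u u) *\<^sub>R u" for w
      using False by (simp add: hyp_reflection_def u_def)
    have "minkowski e u u \<noteq> 0" using n0[OF False] by (simp add: u_def)
    then show ?thesis
      by (simp add: R minkowski_bilinear minkowski_commute[of e u w])
  qed (simp add: hyp_reflection_def)
  show "minkowski e (hyp_reflection e x y v) (hyp_reflection e x y w) = minkowski e v w"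
    by (rule inv)
  show l: "hyp_reflection e x y x = y"
  proof (cases "x = y")
    case False
    have "minkowski e x (x - y) = 1 - minkowski e x y"
      using x by (simp add: minkowski_bilinear hyperboloidD)
    then have "2 * minkowski e x (x - y) / minkowski e (x - y) (x - y) = 1"
      using n0[OF False] unfolding n by simp
    then show ?thesis using False by (simp add: hyp_reflection_def)
  qed (simp add: hyp_reflection_def)
  show "hyp_reflection e x y (hyp_reflection e x y v) = v"
  proof (cases "x = y")
    case False
    define u k where "u = x - y" and "k = 2 * minkowski e v u / minkowski e u u"
    have R: "hyp_reflection e x y w = w - (2 * minkowski e w u / minkowski e u u) *\<^sub>R u" for w
      using False by (simp add: hyp_reflection_def u_def)
    have u: "minkowski e u u \<noteq> 0" using n0[OF False] by (simp add: u_def)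
    have "minkowski e (v - k *\<^sub>R u) u = - minkowski e v u"
      using u by (simp add: minkowski_diff_left minkowski_scaleR_left k_def)
    then have "hyp_reflection e x y (v - k *\<^sub>R u) = v - k *\<^sub>R u - (- k) *\<^sub>R u"
      by (simp add: R k_def)
    then show ?thesis by (simp add: R[of v] flip: k_def)
  qed (simp add: hyp_reflection_def)
  show "hyp_reflection e x y v = v" if "minkowski e v x = minkowski e v y"
    using that by (simp add: hyp_reflection_def minkowski_diff_right)
  show "hyp_reflection e x y v \<in> hyperboloid e" if v: "v \<in> hyperboloid e"
  proof (rule hyperboloid_forward[OF _ y])
    show "minkowski e (hyp_reflection e x y v) (hyp_reflection e x y v) = 1"
      using v by (simp add: inv hyperboloidD)
    have "minkowski e (hyp_reflection e x y v) y = minkowski e v x"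
      using inv[of v x] l by simp
    then show "0 < minkowski e (hyp_reflection e x y v) y"
      using minkowski_ge_1(1)[OF v x] by simp
  qed
qed


section \<open>Isometry groups\<close>

lemma isometry_group_iff:
  "f \<in> carrier (isometry_group m) \<longleftrightarrow> f \<in> extensional (mspace m) \<and> bij_betw f (mspace m) (mspace m)
     \<and> (\<forall>x\<in>mspace m. \<forall>y\<in>mspace m. mdist m (f x) (f y) = mdist m x y)"
  by (auto simp: isometry_group_def Bij_def)

lemma isometry_mem:
  "f \<in> carrier (isometry_group m) \<Longrightarrow> x \<in> mspace m \<Longrightarrow> f x \<in> mspace m"
  unfolding isometry_group_iff using bij_betwE[of f "mspace m" "mspace m"] by blast

lemma isometry_dist:
  "f \<in> carrier (isometry_group m) \<Longrightarrow> x \<in> mspace m \<Longrightarrow> y \<in> mspace m \<Longrightarrow>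
     mdist m (f x) (f y) = mdist m x y"
  by (auto simp: isometry_group_iff)

lemma isometry_group_mult:
  "f \<in> carrier (isometry_group m) \<Longrightarrow> g \<in> carrier (isometry_group m) \<Longrightarrow>
     f \<otimes>\<^bsub>isometry_group m\<^esub> g = compose (mspace m) f g"
  by (simp add: isometry_group_def BijGroup_def)

lemma isometry_compose:
  assumes f: "f \<in> carrier (isometry_group m)" and g: "g \<in> carrier (isometry_group m)"
  shows "compose (mspace m) f g \<in> carrier (isometry_group m)"
  unfolding isometry_group_iff
proof (intro conjI ballI)
  show "bij_betw (compose (mspace m) f g) (mspace m) (mspace m)"
    using f g unfolding isometry_group_iff by (elim conjE) (rule bij_betw_compose)
  show "mdist m (compose (mspace m) f g x) (compose (mspace m) f g y) = mdist m x y"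
    if "x \<in> mspace m" "y \<in> mspace m" for x y
    using isometry_dist[OF f isometry_mem[OF g that(1)] isometry_mem[OF g that(2)]]
      isometry_dist[OF g that] that by (simp only: compose_eq)
qed (rule compose_extensional)

text \<open>The members of \<open>Bij\<close> are extensional functions, so a map given by a formula
  enters the group only after restriction to the space. The inverse \<open>g\<close> serves as the
  witness of bijectivity.\<close>

lemma isometry_restrictI:
  assumes "\<And>x. x \<in> mspace m \<Longrightarrow> f x \<in> mspace m"
    and "\<And>x. x \<in> mspace m \<Longrightarrow> g x \<in> mspace m"
    and "\<And>x. x \<in> mspace m \<Longrightarrow> f (g x) = x"
    and "\<And>x. x \<in> mspace m \<Longrightarrow> g (f x) = x"
    and "\<And>x y. x \<in> mspace m \<Longrightarrow> y \<in> mspace m \<Longrightarrow> mdist m (f x) (f y) = mdist m x y"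
  shows "restrict f (mspace m) \<in> carrier (isometry_group m)"
proof -
  have "bij_betw f (mspace m) (mspace m)"
  proof (rule bij_betw_byWitness[where f' = g])
    show "\<forall>a\<in>mspace m. g (f a) = a" "\<forall>a\<in>mspace m. f (g a) = a"
      "f ` mspace m \<subseteq> mspace m" "g ` mspace m \<subseteq> mspace m"
      unfolding image_subset_iff by (intro ballI assms; assumption)+
  qed
  then have "bij_betw (restrict f (mspace m)) (mspace m) (mspace m)"
    by (subst bij_betw_cong[of _ _ f]) simp_all
  then show ?thesis
    unfolding isometry_group_iff using assms(5) by simp
qed

lemma isometry_id: "restrict (\<lambda>x. x) (mspace m) \<in> carrier (isometry_group m)"
  by (rule isometry_restrictI[where g = "\<lambda>x. x"]) auto

lemma isometry_inverse:
  assumes f: "f \<in> carrier (isometry_group m)"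
  obtains g where "g \<in> carrier (isometry_group m)"
    "\<And>x. x \<in> mspace m \<Longrightarrow> g (f x) = x" "\<And>x. x \<in> mspace m \<Longrightarrow> f (g x) = x"
proof -
  let ?g = "inv_into (mspace m) f"
  have b: "bij_betw f (mspace m) (mspace m)" using f by (simp add: isometry_group_iff)
  have g: "?g x \<in> mspace m" if "x \<in> mspace m" for x
    using bij_betwE[OF bij_betw_inv_into[OF b]] that by blast
  have fg: "f (?g x) = x" "?g (f x) = x" if "x \<in> mspace m" for x
    using b that by (simp_all add: bij_betw_inv_into_right bij_betw_inv_into_left)
  have "mdist m (?g x) (?g y) = mdist m x y" if "x \<in> mspace m" "y \<in> mspace m" for x y
    using isometry_dist[OF f g[OF that(1)] g[OF that(2)]] fg that by simp
  then have "restrict ?g (mspace m) \<in> carrier (isometry_group m)"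
    by (intro isometry_restrictI[where g = f] g fg isometry_mem[OF f])
  then show ?thesis
    using that[of "restrict ?g (mspace m)"] fg isometry_mem[OF f] by simp
qed

lemma hom_isometry_mem:
  "\<rho> \<in> hom (isometry_group m) (isometry_group m') \<Longrightarrow> g \<in> carrier (isometry_group m) \<Longrightarrow>
     \<rho> g \<in> carrier (isometry_group m')"
  by (auto simp: hom_def)

lemma hom_isometry_compose:
  assumes "\<rho> \<in> hom (isometry_group m) (isometry_group m')"
    and "g \<in> carrier (isometry_group m)" "h \<in> carrier (isometry_group m)" "x \<in> mspace m'"
  shows "\<rho> (compose (mspace m) g h) x = \<rho> g (\<rho> h x)"
proof -
  have "\<rho> (compose (mspace m) g h) = compose (mspace m') (\<rho> g) (\<rho> h)"
    using hom_mult[OF assms(1-3)] hom_isometry_mem[OF assms(1)] assms(2,3)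
    by (simp add: isometry_group_mult)
  then show ?thesis using assms by (simp add: compose_eq)
qed

text \<open>The image of the identity is idempotent, and an injective idempotent map is the
  identity.\<close>

lemma hom_isometry_id:
  assumes \<rho>: "\<rho> \<in> hom (isometry_group m) (isometry_group m')" and x: "x \<in> mspace m'"
  shows "\<rho> (restrict (\<lambda>x. x) (mspace m)) x = x"
proof -
  let ?i = "restrict (\<lambda>x. x) (mspace m)"
  have i: "?i \<in> carrier (isometry_group m)" by (rule isometry_id)
  have m: "\<rho> ?i \<in> carrier (isometry_group m')" using hom_isometry_mem[OF \<rho> i] .
  have "compose (mspace m) ?i ?i = ?i"
    by (rule extensionalityI[of _ "mspace m"]) (simp_all add: compose_eq)
  then have "\<rho> ?i (\<rho> ?i x) = \<rho> ?i x"
    using hom_isometry_compose[OF \<rho> i i x] by simp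
  moreover have "inj_on (\<rho> ?i) (mspace m')"
    using m by (simp add: isometry_group_iff bij_betw_def)
  ultimately show ?thesis
    using x isometry_mem[OF m x] by (simp add: inj_on_def)
qed

lemma hyp_reflection_isometry:
  assumes "x \<in> hyperboloid e" "y \<in> hyperboloid e"
  shows "restrict (hyp_reflection e x y) (hyperboloid e) \<in> carrier (isometry_group (hyp_space e))"
proof -
  note R = hyp_reflection_mem[OF assms] hyp_reflection_involution[OF assms]
  have "hyp_dist e (hyp_reflection e x y v) (hyp_reflection e x y w) = hyp_dist e v w"
    if "v \<in> hyperboloid e" "w \<in> hyperboloid e" for v w
    using hyp_dist_eq_iff[OF R(1) R(1) that, OF that] minkowski_hyp_reflection[OF assms] by blast
  then show ?thesis
    using isometry_restrictI[of "hyp_space e" "hyp_reflection e x y" "hyp_reflection e x y"] R by simp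
qed


section \<open>The group of isometries of \<open>\<^bold>H\<^sup>n\<close>\<close>

abbreviation hypn :: "(real \<times> (real ^ 'n)) set" where "hypn \<equiv> hyperboloid (1, 0)"
abbreviation orig :: "real \<times> (real ^ 'n)" where "orig \<equiv> (1, 0)"
abbreviation distn :: "real \<times> (real ^ 'n) \<Rightarrow> real \<times> (real ^ 'n) \<Rightarrow> real" where
  "distn \<equiv> hyp_dist (1, 0)"

lemma hyp_base_n: "hyp_base (1, 0 :: real ^ 'n) = orig"
  by (simp add: hyp_base_def norm_Pair)

lemma orig_mem: "orig \<in> (hypn :: (real \<times> (real ^ 'n)) set)"
  using hyp_base_mem[of "orig :: real \<times> (real ^ 'n)"] by (simp add: hyp_base_n zero_prod_def)

lemma hypn_iff: "(s, v) \<in> (hypn :: (real \<times> (real ^ 'n)) set) \<longleftrightarrow> s\<^sup>2 = 1 + v \<bullet> v \<and> 0 < s"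
  by (auto simp: hyperboloid_def minkowski_Pair power2_eq_square)

lemma mspace_hyp_space_n [simp]: "mspace (hyp_space_n :: (real \<times> (real ^ 'n)) metric) = hypn"
  and mdist_hyp_space_n [simp]: "mdist (hyp_space_n :: (real \<times> (real ^ 'n)) metric) = distn"
  by (simp_all add: hyp_space_n_def)

lemma hyp_reflection_isom_n:
  "x \<in> hypn \<Longrightarrow> y \<in> hypn \<Longrightarrow> restrict (hyp_reflection orig x y) hypn \<in> isom_n"
  using hyp_reflection_isometry[of x orig y] by (simp add: hyp_space_n_def)

lemma isom_n_transitive:
  assumes "x \<in> (hypn :: (real \<times> (real ^ 'n)) set)"
  obtains g where "g \<in> isom_n" "g orig = x"
  using hyp_reflection_isom_n[OF orig_mem assms] hyp_reflection_left[OF orig_mem assms] that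
  by (metis orig_mem restrict_apply')

section \<open>Boosts and the Cartan decomposition\<close>

text \<open>The translations along the geodesic that leaves \<open>orig\<close> in one coordinate
  direction. The index \<open>undefined\<close> stands for a fixed coordinate about which nothing is
  assumed.\<close>

definition boost :: "real \<Rightarrow> real \<times> (real ^ 'n) \<Rightarrow> real \<times> (real ^ 'n)" where
  "boost a x = (let i = undefined in
     (cosh a * fst x + sinh a * snd x $ i, snd x + axis i (sinh a * fst x + (cosh a - 1) * snd x $ i)))"

lemma minkowski_boost:
  fixes x y :: "real \<times> (real ^ 'n)"
  shows "minkowski (1, 0) (boost a x) (boost a y) = minkowski (1, 0) x y"
proof -
  obtain s v s' v' where xy: "x = (s, v)" "y = (s', v')" by fastforce
  define i where "i = (undefined :: 'n)"
  define C S where "C = cosh a" and "S = sinh a"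
  have c: "C * C = 1 + S * S" using cosh_square_eq[of a] by (simp add: C_def S_def power2_eq_square)
  define b b' where "b = v $ i" and "b' = v' $ i"
  have "(C * s + S * b) * (C * s' + S * b') - (v + axis i (S * s + (C - 1) * b)) \<bullet> (v' + axis i (S * s' + (C - 1) * b'))
      = s * s' - v \<bullet> v'"
  proof -
    have "(v + axis i (S * s + (C - 1) * b)) \<bullet> (v' + axis i (S * s' + (C - 1) * b'))
      = v \<bullet> v' + b * (S * s' + (C - 1) * b') + b' * (S * s + (C - 1) * b)
        + (S * s + (C - 1) * b) * (S * s' + (C - 1) * b')"
      by (simp add: inner_add_left inner_add_right inner_axis inner_axis' inner_axis_axis b_def b'_def algebra_simps)
    moreover have "(C * s + S * b) * (C * s' + S * b') - (b * (S * s' + (C - 1) * b') + b' * (S * s + (C - 1) * b)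
        + (S * s + (C - 1) * b) * (S * s' + (C - 1) * b')) = (C * C - S * S) * (s * s') + (1 + S * S - C * C) * (b * b')"
      by (simp add: algebra_simps)
    ultimately show ?thesis using c by simp
  qed
  then show ?thesis
    by (simp add: xy boost_def minkowski_Pair Let_def C_def S_def b_def b'_def i_def)
qed

lemma boost_orig: "boost a orig = (cosh a, axis undefined (sinh a))"
  by (simp add: boost_def)

lemma boost_add: "boost a (boost b x) = boost (a + b) x"
proof -
  obtain s v where x: "x = (s, v)" by fastforce
  show ?thesis
    by (simp add: x boost_def Let_def cosh_add sinh_add vec_eq_iff axis_def algebra_simps)
qed

lemma boost_0: "boost 0 x = x"
  by (simp add: boost_def Let_def prod_eq_iff vec_eq_iff axis_def)

lemma boost_mem:
  assumes "x \<in> (hypn :: (real \<times> (real ^ 'n)) set)"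
  shows "boost a x \<in> hypn"
proof (rule hyperboloid_forward)
  have B: "minkowski (1, 0) (boost a orig :: real \<times> (real ^ 'n)) orig = cosh a"
    by (simp add: boost_orig minkowski_Pair)
  show "boost a orig \<in> (hypn :: (real \<times> (real ^ 'n)) set)"
    by (rule hyperboloid_forward[OF _ orig_mem])
      (simp_all only: minkowski_boost B cosh_real_pos, simp add: minkowski_Pair)
  show "minkowski (1, 0) (boost a x) (boost a x) = 1"
    using assms by (simp add: minkowski_boost hyperboloidD)
  show "0 < minkowski (1, 0) (boost a x) (boost a orig)"
    using minkowski_ge_1(1)[OF assms orig_mem] by (simp add: minkowski_boost)
qed

definition boost_isom :: "real \<Rightarrow> real \<times> (real ^ 'n) \<Rightarrow> real \<times> (real ^ 'n)" where
  "boost_isom a = restrict (boost a) hypn"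

lemma boost_isom_n: "(boost_isom a :: real \<times> (real ^ 'n) \<Rightarrow> _) \<in> isom_n"
proof -
  have "distn (boost a x) (boost a y) = distn x y" if "x \<in> hypn" "y \<in> hypn" for x y :: "real \<times> (real ^ 'n)"
    using that by (subst hyp_dist_eq_iff) (simp_all only: boost_mem minkowski_boost)
  then show ?thesis
    using isometry_restrictI[of "hyp_space_n :: (real \<times> (real ^ 'n)) metric" "boost a" "boost (- a)"]
    by (simp add: boost_isom_def boost_mem boost_add boost_0)
qed

lemma boost_isom_compose: "compose hypn (boost_isom a) (boost_isom b) = boost_isom (a + b)"
  by (auto simp: boost_isom_def compose_def boost_mem boost_add)

lemma distn_boost: "distn (boost a orig) (boost b orig) = \<bar>a - b\<bar>"
proof (rule hyp_distI)
  show "minkowski (1, 0) (boost a orig) (boost b orig :: real \<times> (real ^ 'n)) = cosh (a - b)"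
    by (simp add: boost_orig minkowski_Pair inner_axis_axis cosh_diff)
qed (auto intro: boost_mem orig_mem)

text \<open>The displacement is least on the axis, which passes through \<open>orig\<close>. At a
  point with spatial part \<open>v\<close> its \<open>cosh\<close> exceeds \<open>cosh a\<close> by
  \<open>cosh a - 1\<close> times the squared length of the part of \<open>v\<close> orthogonal to
  the axis.\<close>

lemma translation_length_boost:
  assumes "0 \<le> a"
  shows "translation_length (hyp_space_n :: (real \<times> (real ^ 'n)) metric) (boost_isom a) = a"
  unfolding translation_length_def mspace_hyp_space_n mdist_hyp_space_n
proof (rule cInf_eq_minimum)
  have "distn (boost a orig :: real \<times> (real ^ 'n)) (boost 0 orig) = a"
    using distn_boost[of a 0, where 'a = 'n] assms by simp
  then have "a = distn (boost_isom a orig :: real \<times> (real ^ 'n)) orig"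
    by (simp add: boost_isom_def orig_mem boost_0)
  then show "a \<in> (\<lambda>x. distn (boost_isom a x) x) ` (hypn :: (real \<times> (real ^ 'n)) set)"
    by (rule image_eqI[OF _ orig_mem])
next
  fix d assume "d \<in> (\<lambda>x. distn (boost_isom a x) x) ` (hypn :: (real \<times> (real ^ 'n)) set)"
  then obtain x :: "real \<times> (real ^ 'n)" where x: "x \<in> hypn" and d: "d = distn (boost a x) x"
    by (auto simp: boost_isom_def)
  obtain s v where xy: "x = (s, v)" by fastforce
  define b where "b = v $ undefined"
  have s: "s\<^sup>2 = 1 + v \<bullet> v" using x by (simp add: xy hypn_iff)
  have "b\<^sup>2 \<le> v \<bullet> v"
    using power_mono[OF component_le_norm_cart[of v undefined] abs_ge_zero, of 2]
    by (simp add: b_def power2_norm_eq_inner)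
  then have "0 \<le> (cosh a - 1) * (v \<bullet> v - b\<^sup>2)"
    using cosh_real_ge_1 by simp
  moreover have "minkowski (1, 0) (boost a x) x = cosh a * s\<^sup>2 - v \<bullet> v - (cosh a - 1) * b\<^sup>2"
    by (simp add: xy boost_def minkowski_Pair Let_def inner_add_left inner_axis'
        power2_eq_square algebra_simps flip: b_def)
  ultimately have "cosh a \<le> minkowski (1, 0) (boost a x) x"
    unfolding s by (simp add: algebra_simps)
  also have "\<dots> = cosh d"
    using x by (simp add: d cosh_hyp_dist boost_mem)
  finally show "a \<le> d"
    using assms by (simp add: cosh_real_nonneg_le_iff d hyp_dist_nonneg)
qed

text \<open>The point \<open>g orig\<close> and the boost of \<open>orig\<close> by the same
  distance are equidistant from \<open>orig\<close>, so the reflection that exchanges them fixes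
  \<open>orig\<close>. Being an involution, it also serves as its own inverse later.\<close>

lemma isom_n_polar:
  fixes g :: "real \<times> (real ^ 'n) \<Rightarrow> real \<times> (real ^ 'n)"
  assumes g: "g \<in> isom_n"
  obtains k where "k \<in> isom_n" "k orig = orig" "\<And>x. x \<in> hypn \<Longrightarrow> k (k x) = x"
    "k (boost (distn (g orig) orig) orig) = g orig"
proof -
  define r where "r = distn (g orig) orig"
  have gx: "g orig \<in> hypn" using isometry_mem[OF g] orig_mem by simp
  have bx: "boost r orig \<in> (hypn :: (real \<times> (real ^ 'n)) set)" by (intro boost_mem orig_mem)
  have "distn (boost r orig :: real \<times> (real ^ 'n)) orig = distn (g orig) orig"
    using distn_boost[of r 0, where 'a = 'n] hyp_dist_nonneg[of orig "g orig" orig] unfolding boost_0 r_def by linarith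
  then have "minkowski (1, 0) orig (boost r orig :: real \<times> (real ^ 'n)) = minkowski (1, 0) orig (g orig)"
    using hyp_dist_eq_iff[OF bx orig_mem gx orig_mem] by (simp add: minkowski_commute[of _ orig])
  then have fx: "hyp_reflection orig (boost r orig) (g orig) orig = orig"
    by (rule hyp_reflection_fix[OF bx gx])
  define k where "k = restrict (hyp_reflection orig (boost r orig) (g orig)) hypn"
  have "k \<in> isom_n"
    unfolding k_def by (rule hyp_reflection_isom_n[OF bx gx])
  moreover have "k orig = orig"
    unfolding k_def using fx by (simp add: orig_mem)
  moreover have "k (k x) = x" if "x \<in> hypn" for x
    unfolding k_def using that hyp_reflection_mem[OF bx gx that] hyp_reflection_involution[OF bx gx, of x]
    by simp
  moreover have "k (boost r orig) = g orig"
    unfolding k_def using hyp_reflection_left[OF bx gx] bx by simp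
  ultimately show ?thesis
    using that[of k] unfolding r_def by blast
qed

text \<open>After composition with a reflection the map fixes \<open>orig\<close>, hence preserves
  heights, hence induces a map of the Euclidean space that preserves inner products. Such a map is
  orthogonal, and onto by finite dimension.\<close>

lemma isometric_embedding_surj:
  fixes f :: "real \<times> (real ^ 'n) \<Rightarrow> real \<times> (real ^ 'n)"
  assumes f: "\<And>x. x \<in> hypn \<Longrightarrow> f x \<in> hypn"
    and d: "\<And>x y. x \<in> hypn \<Longrightarrow> y \<in> hypn \<Longrightarrow> distn (f x) (f y) = distn x y"
  shows "f ` hypn = hypn"
proof
  show "f ` hypn \<subseteq> hypn" using f by blast
  show "hypn \<subseteq> f ` hypn"
  proof
    fix z :: "real \<times> (real ^ 'n)" assume z: "z \<in> hypn"
    define R where "R = hyp_reflection orig (f orig) orig"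
    note R = hyp_reflection[OF f[OF orig_mem] orig_mem, folded R_def]
    define h where "h = (\<lambda>x. R (f x))"
    have hH: "h x \<in> hypn" if "x \<in> hypn" for x unfolding h_def by (intro R(5) f that)
    have hB: "minkowski (1, 0) (h x) (h y) = minkowski (1, 0) x y" if "x \<in> hypn" "y \<in> hypn" for x y
      using d[OF that] hyp_dist_eq_iff[OF f f that, OF that] by (simp add: h_def R(1))
    have h0: "h orig = orig" unfolding h_def by (rule R(2))
    \<comment> \<open>The hyperboloid as a graph over its spatial coordinates.\<close>
    define \<iota> where "\<iota> = (\<lambda>v :: real ^ 'n. (sqrt (1 + v \<bullet> v), v))"
    have \<iota>: "\<iota> v \<in> hypn" for v by (simp add: \<iota>_def hypn_iff add_pos_nonneg)
    have fs: "fst (h x) = fst x" if "x \<in> hypn" for x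
      using hB[OF that orig_mem] 
        minkowski_Pair[of "fst (h x)" "snd (h x)" 1 0] minkowski_Pair[of "fst x" "snd x" 1 0]
      unfolding h0 by simp
    define \<phi> where "\<phi> = (\<lambda>v. snd (h (\<iota> v)))"
    have h\<iota>: "h (\<iota> v) = (sqrt (1 + v \<bullet> v), \<phi> v)" for v
      using fs[OF \<iota>, of v] by (simp add: prod_eq_iff \<phi>_def \<iota>_def)
    have in\<phi>: "\<phi> v \<bullet> \<phi> w = v \<bullet> w" for v w
      using hB[OF \<iota> \<iota>, of v w] unfolding h\<iota> by (simp add: \<iota>_def minkowski_Pair)
    have "\<phi> 0 = 0" using in\<phi>[of 0 0] by simp
    moreover have "dist (\<phi> v) (\<phi> w) = dist v w" for v w
      by (simp add: dist_norm norm_eq_sqrt_inner inner_diff_left inner_diff_right in\<phi>)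
    ultimately have "surj \<phi>"
      by (intro orthogonal_transformation_surj) (simp add: orthogonal_transformation_isometry)
    then obtain v where v: "snd (R z) = \<phi> v" by (metis surjD)
    have "R z \<in> hypn" using R(5)[OF z] .
    then have "fst (R z) = sqrt (1 + v \<bullet> v)"
      using v in\<phi>[of v v] hypn_iff[of "fst (R z)" "snd (R z)", unfolded prod.collapse]
      by (auto intro!: real_sqrt_unique[symmetric])
    then have "h (\<iota> v) = R z"
      using v by (simp add: prod_eq_iff h\<iota>)
    then have "R (R (f (\<iota> v))) = R (R z)"
      by (simp only: h_def)
    then have "z = f (\<iota> v)" unfolding R(3) by (rule sym)
    then show "z \<in> f ` hypn" by (rule image_eqI[OF _ \<iota>])
  qed
qed

lemma compact_hypn_cball: "compact {x \<in> (hypn :: (real \<times> (real ^ 'n)) set). distn x orig \<le> R}"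
proof (cases "0 \<le> R")
  case True
  have "{x \<in> (hypn :: (real \<times> (real ^ 'n)) set). distn x orig \<le> R}
      = hypn \<inter> {x. minkowski (1, 0) x orig \<le> cosh R}"
    using hyp_dist_le_iff[OF _ orig_mem True] by auto
  moreover have "closed (hypn \<inter> {x :: real \<times> (real ^ 'n). minkowski (1, 0) x orig \<le> cosh R})"
    by (intro closed_Int closed_hyperboloid closed_Collect_le continuous_intros)
  moreover have "bounded (hypn \<inter> {x :: real \<times> (real ^ 'n). minkowski (1, 0) x orig \<le> cosh R})"
    unfolding bounded_iff
  proof (intro exI ballI)
    fix x :: "real \<times> (real ^ 'n)" assume x: "x \<in> hypn \<inter> {x. minkowski (1, 0) x orig \<le> cosh R}"
    have "(norm x)\<^sup>2 \<le> 2 * (x \<bullet> orig)\<^sup>2"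
      using x norm_sq_hyperboloid[of x orig] by (simp add: hyp_base_n)
    also have "\<dots> \<le> 2 * (cosh R)\<^sup>2"
      using x inner_hyp_base_ge_1[of x orig] minkowski_hyp_base[of "orig :: real \<times> (real ^ 'n)" x]
      by (intro mult_left_mono power_mono) (auto simp: hyp_base_n zero_prod_def)
    also have "\<dots> \<le> (2 * cosh R)\<^sup>2" by (simp add: power_mult_distrib)
    finally show "norm x \<le> 2 * cosh R"
      by (rule power2_le_imp_le) simp
  qed
  ultimately show ?thesis by (simp add: compact_eq_bounded_closed)
next
  case False
  then have "{x \<in> (hypn :: (real \<times> (real ^ 'n)) set). distn x orig \<le> R} = {}"
    using order_trans[OF hyp_dist_nonneg] by blast
  then show ?thesis by (simp only: compact_empty)
qed

text \<open>Tychonoff's theorem; a pointwise limit of isometries is onto by the previous lemma on isometric embeddings.\<close>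

lemma compactin_isom_n:
  "compactin (isometry_topology (hyp_space_n :: (real \<times> (real ^ 'n)) metric))
     {g \<in> isom_n. distn (g orig) orig \<le> R}"
proof -
  let ?m = "hyp_space_n :: (real \<times> (real ^ 'n)) metric"
  let ?P = "product_topology (\<lambda>_. mtopology_of ?m) (hypn :: (real \<times> (real ^ 'n)) set)"
  let ?S = "{g \<in> (isom_n :: (real \<times> (real ^ 'n) \<Rightarrow> _) set). distn (g orig) orig \<le> R}"
  \<comment> \<open>An isometry that moves \<open>orig\<close> by at most \<open>R\<close> maps
    \<open>x\<close> into the ball of radius \<open>R + distn x orig\<close>, so the isometries in
    question lie in a product of compact balls.\<close>
  define K where "K = (\<Pi>\<^sub>E x\<in>(hypn :: (real \<times> (real ^ 'n)) set). {y \<in> (hypn :: (real \<times> (real ^ 'n)) set). distn y orig \<le> R + distn x orig})"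
  have cK: "compactin ?P K"
    unfolding K_def compactin_PiE
    using compact_hypn_cball by (auto simp: hyp_space_n_def compactin_hyp_space)
  have SK: "?S \<subseteq> K"
  proof
    fix g assume g: "g \<in> ?S"
    then have gi: "g \<in> isom_n" by simp
    have "distn (g x) orig \<le> R + distn x orig" if x: "x \<in> hypn" for x
    proof -
      have "distn (g x) orig \<le> distn (g x) (g orig) + distn (g orig) orig"
        using isometry_mem[OF gi] x orig_mem by (intro hyp_dist_triangle) auto
      also have "distn (g x) (g orig) = distn x orig"
        using isometry_dist[OF gi] x orig_mem by simp
      finally show ?thesis using g by simp
    qed
    then show "g \<in> K"
      using gi isometry_mem[OF gi] by (simp add: K_def isometry_group_iff PiE_iff)
  qed
  have tP: "topspace ?P = (\<Pi>\<^sub>E x\<in>hypn. hypn)" by simp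
  have proj: "continuous_map ?P (mtopology_of ?m) (\<lambda>f. f x)" if "x \<in> hypn" for x
    using continuous_map_product_projection[of x hypn "\<lambda>_. mtopology_of ?m"] that by simp
  have cd: "continuous_map ?P euclidean (\<lambda>f. distn (f x) (f y))" if "x \<in> hypn" "y \<in> hypn" for x y
    using continuous_map_mdist[OF proj[OF that(1)] proj[OF that(2)]] by simp
  have "closedin ?P {f \<in> topspace ?P. distn (f (fst z)) (f (snd z)) \<in> {distn (fst z) (snd z)}}"
    if "z \<in> hypn \<times> hypn" for z :: "(real \<times> (real ^ 'n)) \<times> (real \<times> (real ^ 'n))"
    using that by (intro closedin_continuous_map_preimage[OF cd]) auto
  then have 1: "closedin ?P (\<Inter>z\<in>hypn \<times> hypn. {f \<in> topspace ?P. distn (f (fst z)) (f (snd z)) \<in> {distn (fst z) (snd z)}})"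
    using orig_mem by (intro closedin_INT) auto
  have "continuous_map ?P euclidean (\<lambda>f. distn (f orig) orig)"
    using continuous_map_mdist[OF proj[OF orig_mem], of "\<lambda>_. orig"] by (simp add: orig_mem)
  then have 2: "closedin ?P {f \<in> topspace ?P. distn (f orig) orig \<in> {..R}}"
    by (rule closedin_continuous_map_preimage) simp
  have "?S = (\<Inter>z\<in>hypn \<times> hypn. {f \<in> topspace ?P. distn (f (fst z)) (f (snd z)) \<in> {distn (fst z) (snd z)}})
     \<inter> {f \<in> topspace ?P. distn (f orig) orig \<in> {..R}}" (is "_ = ?T")
  proof
    show "?S \<subseteq> ?T"
    proof
      fix g assume g: "g \<in> ?S"
      then have gi: "g \<in> isom_n" by simp
      have "g \<in> topspace ?P"
        using gi isometry_mem[OF gi] unfolding tP by (simp add: isometry_group_iff PiE_iff)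
      then show "g \<in> ?T"
        using g isometry_dist[OF gi] by (simp add: mem_Times_iff)
    qed
    show "?T \<subseteq> ?S"
    proof
      fix f assume f: "f \<in> ?T"
      then have fm: "f \<in> (\<Pi>\<^sub>E x\<in>hypn. hypn)"
        unfolding tP[symmetric] by blast
      have fd: "distn (f x) (f y) = distn x y" if "x \<in> hypn" "y \<in> hypn" for x y
        using INT_D[OF IntD1[OF f], of "(x, y)"] that by simp
      have fo: "distn (f orig) orig \<le> R"
        using IntD2[OF f] by simp
      have "f ` hypn = hypn"
        using fm fd by (intro isometric_embedding_surj) auto
      moreover have "inj_on f hypn"
      proof (rule inj_onI)
        fix x y assume "x \<in> hypn" "y \<in> hypn" "f x = f y"
        then show "x = y"
          using fd[of x y] Metric_space.zero[OF Metric_space_hyperboloid, of x orig y] by (simp add: hyp_dist_self)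
      qed
      ultimately show "f \<in> ?S"
        using fo fm fd by (simp add: isometry_group_iff bij_betw_def PiE_iff)
    qed
  qed
  then have "closedin ?P ?S" using closedin_Int[OF 1 2] by argo
  then have "compactin ?P ?S" using closed_compactin[OF cK SK] by blast
  then show ?thesis
    unfolding isometry_topology_def compactin_subtopology mspace_hyp_space_n by blast
qed


section \<open>Orbits of a representation that scales translation lengths\<close>

text \<open>If some ratio exceeded its limiting bound \<open>exp t\<close> by more than the sum of all later changes,
  the growth rate of \<open>D\<close> would exceed \<open>t\<close>.\<close>

lemma ratio_growth:
  fixes D :: "nat \<Rightarrow> real"
  assumes t: "0 < t" and K: "0 \<le> K" and D: "\<And>k. 0 < D k"
    and ratio: "\<And>k. \<bar>D (Suc (Suc k)) / D (Suc k) - D (Suc k) / D k\<bar> \<le> K * exp (- t * real k)"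
    and growth: "\<And>\<epsilon>. 0 < \<epsilon> \<Longrightarrow> \<exists>M. \<forall>k. D k \<le> M * exp ((t + \<epsilon>) * real k)"
  obtains A where "0 < A" "\<And>k. D k \<le> A * exp (t * real k)"
proof -
  define q where "q = exp (- t)"
  have q: "0 < q" "q < 1" using t by (simp_all add: q_def)
  have qk: "exp (- t * real k) = q ^ k" for k
    by (simp add: q_def exp_of_nat_mult[symmetric] mult.commute)
  define r where "r = (\<lambda>k. D (Suc k) / D k)"
  have r_pos: "0 < r k" for k by (simp add: r_def D)
  \<comment> \<open>\<open>K' * q ^ k\<close> is the sum of the geometric series of all changes from
    index \<open>k\<close> on. Subtracting it from \<open>r k\<close> gives an increasing
    sequence.\<close>
  define K' where "K' = K / (1 - q)"
  have K': "0 \<le> K'" using K q by (simp add: K'_def)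
  have geo: "K' * q ^ k - K' * q ^ Suc k = K * q ^ k" for k
  proof -
    have "K' * q ^ k - K' * q ^ Suc k = K' * (1 - q) * q ^ k" by (simp add: algebra_simps)
    then show ?thesis using q by (simp add: K'_def)
  qed
  have step: "r k - K' * q ^ k \<le> r (Suc k) - K' * q ^ Suc k" for k
    using ratio[of k] geo[of k] unfolding qk by (simp add: r_def)
  have mono: "r k - K' * q ^ k \<le> r (k + j) - K' * q ^ (k + j)" for k j
  proof (induction j)
    case (Suc j)
    then show ?case using step[of "k + j"] by simp
  qed simp
  have r_le: "r k \<le> exp t + K' * q ^ k" for k
  proof (rule ccontr)
    assume gt: "\<not> ?thesis"
    \<comment> \<open>By monotonicity every ratio from index \<open>k\<close> on is at least
      \<open>L\<close>.\<close>
    define L where "L = r k - K' * q ^ k"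
    have L: "exp t < L" using gt by (simp add: L_def)
    then have "0 < L" using exp_gt_zero[of t] by (rule order.strict_trans[rotated])
    note L = L this
    \<comment> \<open>Half of the excess of \<open>ln L\<close> over \<open>t\<close>: then
      \<open>D\<close> grows at rate at least \<open>t + 2 * \<epsilon>\<close>, against the rate
      \<open>t + \<epsilon>\<close> allowed by the hypothesis.\<close>
    define \<epsilon> where "\<epsilon> = (ln L - t) / 2"
    have \<epsilon>: "0 < \<epsilon>" using L ln_less_cancel_iff[of "exp t" L] by (simp add: \<epsilon>_def)
    have "t + 2 * \<epsilon> = ln L" by (simp add: \<epsilon>_def field_simps)
    then have L\<epsilon>: "L = exp (t + 2 * \<epsilon>)" using L by simp
    obtain M where M: "\<And>k. D k \<le> M * exp ((t + \<epsilon>) * real k)" using growth[OF \<epsilon>] by blast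
    have low: "D k * L ^ j \<le> D (k + j)" for j
    proof (induction j)
      case (Suc j)
      have "0 \<le> K' * q ^ (k + j)" using K' q by simp
      then have "L \<le> r (k + j)" using mono[of k j] by (simp add: L_def)
      then have "L * D (k + j) \<le> D (Suc (k + j))" using D[of "k + j"] by (simp add: r_def pos_le_divide_eq)
      moreover have "L * (D k * L ^ j) \<le> L * D (k + j)" using Suc L by (intro mult_left_mono) auto
      ultimately show ?case by (simp add: algebra_simps)
    qed simp
    define M' where "M' = M * exp ((t + \<epsilon>) * real k) / D k"
    have "exp \<epsilon> ^ j \<le> M'" for j
    proof -
      have "D k * exp (t + 2 * \<epsilon>) ^ j \<le> M * exp ((t + \<epsilon>) * real (k + j))"
        using order_trans[OF low[of j] M[of "k + j"]] by (simp only: L\<epsilon>)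
      also have "\<dots> = M * exp ((t + \<epsilon>) * real k) * exp (t + \<epsilon>) ^ j"
        by (simp add: exp_of_nat_mult[symmetric] exp_add[symmetric] algebra_simps)
      finally have "D k * (exp \<epsilon> ^ j * exp (t + \<epsilon>) ^ j) \<le> M * exp ((t + \<epsilon>) * real k) * exp (t + \<epsilon>) ^ j"
        by (simp add: power_mult_distrib[symmetric] exp_add[symmetric] algebra_simps)
      then have "D k * exp \<epsilon> ^ j * exp (t + \<epsilon>) ^ j \<le> M * exp ((t + \<epsilon>) * real k) * exp (t + \<epsilon>) ^ j"
        by (simp only: mult.assoc)
      then have "D k * exp \<epsilon> ^ j \<le> M * exp ((t + \<epsilon>) * real k)"
        by (rule mult_right_le_imp_le) simp
      then show ?thesis using D[of k] by (simp add: M'_def pos_le_divide_eq mult.commute)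
    qed
    moreover obtain j where "M' < exp \<epsilon> ^ j"
      using real_arch_pow[of "exp \<epsilon>" M'] \<epsilon> by auto
    ultimately show False using linorder_not_less by blast
  qed
  \<comment> \<open>Each ratio is at most \<open>exp t * (1 + K' * q ^ k)\<close>, hence at most
    \<open>exp t * exp (K' * q ^ k)\<close>. The exponents of the correction factors add up to at
    most \<open>K' / (1 - q)\<close>.\<close>
  define A where "A = D 0 * exp (K' / (1 - q))"
  have sum_le: "K' * (\<Sum>i<k. q ^ i) \<le> K' / (1 - q)" for k
  proof -
    have "(\<Sum>i<k. q ^ i) = (1 - q ^ k) / (1 - q)" using q by (simp add: sum_gp_strict)
    also have "\<dots> \<le> 1 / (1 - q)" using q by (intro divide_right_mono) auto
    finally show ?thesis using mult_left_mono[OF _ K'] by fastforce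
  qed
  have D_le: "D k \<le> D 0 * exp (t * real k) * exp (K' * (\<Sum>i<k. q ^ i))" for k
  proof (induction k)
    case (Suc k)
    have "r k \<le> exp t * (1 + K' * q ^ k)"
    proof -
      have "1 * (K' * q ^ k) \<le> exp t * (K' * q ^ k)"
        using t K' q by (intro mult_right_mono) auto
      then show ?thesis using r_le[of k] by (simp add: algebra_simps)
    qed
    also have "\<dots> \<le> exp t * exp (K' * q ^ k)"
      by (intro mult_left_mono) (auto simp: exp_ge_add_one_self)
    finally have "r k * D k \<le> (exp t * exp (K' * q ^ k)) * (D 0 * exp (t * real k) * exp (K' * (\<Sum>i<k. q ^ i)))"
      using Suc D[of k] r_pos[of k] by (intro mult_mono) auto
    moreover have "r k * D k = D (Suc k)" using D[of k] by (simp add: r_def)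
    moreover have "(exp t * exp (K' * q ^ k)) * (D 0 * exp (t * real k) * exp (K' * (\<Sum>i<k. q ^ i)))
        = D 0 * exp (t * real (Suc k)) * exp (K' * (\<Sum>i<Suc k. q ^ i))"
      by (simp add: exp_add distrib_left distrib_right)
    ultimately show ?case by simp
  qed simp
  have "D k \<le> A * exp (t * real k)" for k
  proof -
    have "D 0 * exp (t * real k) * exp (K' * (\<Sum>i<k. q ^ i)) \<le> D 0 * exp (t * real k) * exp (K' / (1 - q))"
      using sum_le[of k] D[of 0] by (intro mult_left_mono) auto
    then show ?thesis using D_le[of k] by (simp add: A_def mult.commute mult.left_commute)
  qed
  moreover have "0 < A" using D[of 0] by (simp add: A_def)
  ultimately show ?thesis using that by blast
qed

text \<open>These assumptions cover the exotic representations with \<open>t < 1\<close> and also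
  the standard action on hyperbolic n-space with \<open>t = 1\<close>, so that both are treated at
  once.\<close>

locale length_scaling_rep =
  fixes e :: "'h::{real_inner, complete_space}" and t :: real
    and \<rho> :: "(real \<times> (real ^ 'n) \<Rightarrow> real \<times> (real ^ 'n)) \<Rightarrow> 'h \<Rightarrow> 'h" and b :: 'h
  assumes t_pos: "0 < t"
    and hom: "\<rho> \<in> hom (isometry_group hyp_space_n) (isometry_group (hyp_space e))"
    and cont: "\<And>x. x \<in> hyperboloid e \<Longrightarrow> continuous_map (isometry_topology hyp_space_n)
        (mtopology_of (hyp_space e)) (\<lambda>g. \<rho> g x)"
    and lengths: "\<And>g. g \<in> isom_n \<Longrightarrow>
        translation_length (hyp_space e) (\<rho> g) = t * translation_length hyp_space_n g"
    and b_mem: "b \<in> hyperboloid e"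
begin

lemma act_mem: "g \<in> isom_n \<Longrightarrow> x \<in> hyperboloid e \<Longrightarrow> \<rho> g x \<in> hyperboloid e"
  using isometry_mem[OF hom_isometry_mem[OF hom]] by simp

lemma act_dist: "g \<in> isom_n \<Longrightarrow> x \<in> hyperboloid e \<Longrightarrow> y \<in> hyperboloid e \<Longrightarrow>
    hyp_dist e (\<rho> g x) (\<rho> g y) = hyp_dist e x y"
  using isometry_dist[OF hom_isometry_mem[OF hom]] by simp

lemma act_minkowski: "g \<in> isom_n \<Longrightarrow> x \<in> hyperboloid e \<Longrightarrow> y \<in> hyperboloid e \<Longrightarrow>
    minkowski e (\<rho> g x) (\<rho> g y) = minkowski e x y"
  using act_dist[of g x y] hyp_dist_eq_iff[OF act_mem act_mem, of g x g y x e y] by simp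

lemma act_compose: "g \<in> isom_n \<Longrightarrow> h \<in> isom_n \<Longrightarrow> x \<in> hyperboloid e \<Longrightarrow>
    \<rho> (compose hypn g h) x = \<rho> g (\<rho> h x)"
  using hom_isometry_compose[OF hom] by simp

lemma act_id: "x \<in> hyperboloid e \<Longrightarrow> \<rho> (restrict (\<lambda>x. x) hypn) x = x"
  using hom_isometry_id[OF hom] by simp

lemma isom_n_compose: "g \<in> isom_n \<Longrightarrow> h \<in> isom_n \<Longrightarrow> compose hypn g h \<in> (isom_n :: (real \<times> (real ^ 'n) \<Rightarrow> _) set)"
  using isometry_compose[of g hyp_space_n h] by simp

lemma isom_n_ext:
  assumes "g \<in> isom_n" "h \<in> isom_n" "\<And>x. x \<in> hypn \<Longrightarrow> g x = h x"
  shows "g = (h :: real \<times> (real ^ 'n) \<Rightarrow> _)"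
  using assms extensionalityI[of g hypn h] by (simp add: isometry_group_iff)

lemma isom_n_mem: "g \<in> isom_n \<Longrightarrow> x \<in> hypn \<Longrightarrow> g x \<in> (hypn :: (real \<times> (real ^ 'n)) set)"
  using isometry_mem[of g hyp_space_n] by simp

lemma isom_n_dist: "g \<in> isom_n \<Longrightarrow> x \<in> hypn \<Longrightarrow> y \<in> hypn \<Longrightarrow>
    distn (g x) (g y) = distn x (y :: real \<times> (real ^ 'n))"
  using isometry_dist[of g hyp_space_n] by simp

lemma act_inverse:
  assumes g: "g \<in> isom_n"
  obtains g' where "g' \<in> isom_n" "\<forall>x\<in>hypn. g' (g x) = x" "\<forall>x\<in>hypn. g (g' x) = x"
    "\<forall>x\<in>hyperboloid e. \<rho> g' (\<rho> g x) = x" "\<forall>x\<in>hyperboloid e. \<rho> g (\<rho> g' x) = x"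
proof (rule isometry_inverse[OF g, unfolded mspace_hyp_space_n])
  fix g' assume g': "g' \<in> isom_n" "\<And>x. x \<in> hypn \<Longrightarrow> g' (g x) = x" "\<And>x. x \<in> hypn \<Longrightarrow> g (g' x) = x"
  have i: "restrict (\<lambda>x. x) hypn \<in> (isom_n :: (real \<times> (real ^ 'n) \<Rightarrow> _) set)"
    using isometry_id[of hyp_space_n] by simp
  have 1: "compose hypn g' g = restrict (\<lambda>x. x) hypn"
    by (rule isom_n_ext[OF isom_n_compose[OF g'(1) g] i]) (simp add: compose_eq g')
  have 2: "compose hypn g g' = restrict (\<lambda>x. x) hypn"
    by (rule isom_n_ext[OF isom_n_compose[OF g g'(1)] i]) (simp add: compose_eq g')
  show ?thesis
    using act_compose[OF g g'(1)] act_compose[OF g'(1) g] act_id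
    by (intro that[of g']) (simp_all add: g' 1 2)
qed

section \<open>Displacement along the boosts\<close>

definition D :: "real \<Rightarrow> real" where
  "D s = minkowski e b (\<rho> (boost_isom s) b)"

lemma boost_orbit_mem: "\<rho> (boost_isom s) b \<in> hyperboloid e"
  by (rule act_mem[OF boost_isom_n b_mem])

lemma minkowski_boost_orbit: "minkowski e (\<rho> (boost_isom s) b) (\<rho> (boost_isom s') b) = D (s' - s)"
proof -
  have "\<rho> (boost_isom s') b = \<rho> (boost_isom s) (\<rho> (boost_isom (s' - s)) b)"
    using act_compose[OF boost_isom_n boost_isom_n b_mem, of s "s' - s"] by (simp add: boost_isom_compose)
  then show ?thesis
    using act_minkowski[OF boost_isom_n b_mem boost_orbit_mem] by (simp add: D_def)
qed

lemma D_ge_1: "1 \<le> D s"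
  unfolding D_def by (rule minkowski_ge_1(1)[OF b_mem boost_orbit_mem])

lemma boost_isom_0: "\<rho> (boost_isom 0) b = b"
proof -
  have "boost_isom 0 = restrict (\<lambda>x. x) (hypn :: (real \<times> (real ^ 'n)) set)"
    unfolding boost_isom_def by (rule restrict_ext) (rule boost_0)
  then show ?thesis by (simp only: act_id[OF b_mem])
qed

lemma D_0: "D 0 = 1"
  unfolding D_def boost_isom_0 by (rule hyperboloidD[OF b_mem])

lemma translation_length_le:
  "x \<in> hyperboloid e \<Longrightarrow> translation_length (hyp_space e) f \<le> hyp_dist e (f x) x"
  unfolding translation_length_def mspace_hyp_space mdist_hyp_space
  by (rule cINF_lower[OF bdd_belowI2[of _ 0]]) (rule hyp_dist_nonneg)

text \<open>This half of the orbit estimate is immediate, since the translation length is an infimum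
  of displacements. The matching upper bound is \<open>boost_orbit_bound\<close>.\<close>

lemma dist_boost_orbit_ge: "0 \<le> s \<Longrightarrow> t * s \<le> hyp_dist e (\<rho> (boost_isom s) b) b"
  using translation_length_le[OF b_mem, of "\<rho> (boost_isom s)"]
  by (simp add: lengths boost_isom_n translation_length_boost)

lemma D_ge_exp:
  assumes "0 \<le> s" shows "exp (t * s) / 2 \<le> D s"
proof -
  have "exp (t * s) \<le> exp (hyp_dist e b (\<rho> (boost_isom s) b))"
    using dist_boost_orbit_ge[OF assms] by (simp add: hyp_dist_commute[of e b])
  then show ?thesis
    using minkowski_exp_bounds(1)[OF b_mem boost_orbit_mem[of s]] unfolding D_def by linarith
qed

text \<open>With \<open>x s\<close> the orbit point, the ratio \<open>D (s + 1) / D s\<close> is the product of \<open>x (- 1)\<close> with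
  \<open>x s / D s\<close>, and these vectors of the hyperplane \<open>minkowski e b v = 1\<close> converge exponentially fast.\<close>

lemma D_ratio:
  assumes "0 \<le> s"
  shows "\<bar>D (s + 2) / D (s + 1) - D (s + 1) / D s\<bar> \<le> sqrt (8 * D 1 * ((D 1)\<^sup>2 - 1)) * exp (- t * s)"
proof -
  define x where "x = (\<lambda>s. \<rho> (boost_isom s) b)"
  have Bx: "minkowski e (x s) (x s') = D (s' - s)" for s s'
    unfolding x_def by (rule minkowski_boost_orbit)
  have x0: "x 0 = b" unfolding x_def by (rule boost_isom_0)
  have Dsym: "D (- s) = D s" for s
    using Bx[of 0 s] Bx[of s 0] minkowski_commute[of e "x 0" "x s"] by simp
  \<comment> \<open>\<open>w\<close> is the part of \<open>x (- 1)\<close> orthogonal to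
    \<open>b\<close>, and \<open>v\<close> is a difference of two vectors whose product with
    \<open>b\<close> is 1. Both lie in the complement of \<open>b\<close>, where the form is
    semidefinite and the Cauchy-Schwarz inequality holds.\<close>
  define w where "w = x (- 1) - D 1 *\<^sub>R b"
  define v where "v = x (s + 1) /\<^sub>R D (s + 1) - x s /\<^sub>R D s"
  have nz: "D (s + 1) \<noteq> 0" "D s \<noteq> 0" using D_ge_1[of s] D_ge_1[of "s + 1"] by auto
  have Bb: "minkowski e (x s') b = D s'" "minkowski e b (x s') = D s'" for s'
    using Bx[of s' 0] Bx[of 0 s'] Dsym by (simp_all add: x0)
  have bb: "minkowski e b b = 1" by (rule hyperboloidD[OF b_mem])
  have wb: "minkowski e w b = 0"
    using Dsym[of 1] by (simp add: w_def minkowski_bilinear Bb bb)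
  have vb: "minkowski e v b = 0"
    using nz by (simp add: v_def minkowski_bilinear Bb)
  have ww: "minkowski e w w = 1 - (D 1)\<^sup>2"
    using Dsym[of 1] by (simp add: w_def minkowski_bilinear Bx Bb bb D_0 power2_eq_square)
  have vv: "minkowski e v v = 1 / (D (s + 1))\<^sup>2 + 1 / (D s)\<^sup>2 - 2 * D 1 / (D s * D (s + 1))"
    using nz Dsym[of 1] by (simp add: v_def minkowski_bilinear Bx D_0 power2_eq_square field_simps)
  \<comment> \<open>The part of \<open>x (- 1)\<close> along \<open>b\<close> does not contribute,
    as \<open>v\<close> is orthogonal to \<open>b\<close>.\<close>
  have "minkowski e w v = minkowski e (x (- 1)) v"
    using vb by (simp add: w_def minkowski_diff_left minkowski_scaleR_left minkowski_commute[of e b v])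
  also have "\<dots> = D (s + 2) / D (s + 1) - D (s + 1) / D s"
  proof -
    have "s + 1 - - 1 = s + 2" "s - - 1 = s + 1" by simp_all
    then show ?thesis
      unfolding v_def minkowski_diff_right minkowski_scaleR_right Bx by (simp only: divide_inverse mult.commute)
  qed
  finally have wv: "minkowski e w v = D (s + 2) / D (s + 1) - D (s + 1) / D s" .
  have swap: "(1 - p) * (x + y - z) = (p - 1) * (z - x - y)" for p x y z :: real
    by (simp add: algebra_simps)
  have "(minkowski e w v)\<^sup>2 \<le> minkowski e w w * minkowski e v v"
    by (rule minkowski_cauchy_schwarz[OF b_mem wb vb])
  also have "\<dots> = ((D 1)\<^sup>2 - 1) * (2 * D 1 / (D s * D (s + 1)) - 1 / (D (s + 1))\<^sup>2 - 1 / (D s)\<^sup>2)"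
    unfolding ww vv by (rule swap)
  also have "\<dots> \<le> ((D 1)\<^sup>2 - 1) * (8 * D 1 * (exp (- t * s))\<^sup>2)"
  proof (rule mult_left_mono)
    \<comment> \<open>The two lower bounds for \<open>D\<close> contribute a factor 4 and the
      exponential decay; with the 2 already present this makes the 8 of the statement.\<close>
    have "exp (t * s) / 2 * (exp (t * s) / 2) \<le> D s * D (s + 1)"
    proof (rule mult_mono)
      have "exp (t * s) \<le> exp (t * (s + 1))" using t_pos by simp
      moreover have "exp (t * (s + 1)) / 2 \<le> D (s + 1)" using assms by (intro D_ge_exp) simp
      ultimately show "exp (t * s) / 2 \<le> D (s + 1)" by linarith
    qed (use D_ge_exp[OF assms] D_ge_1[of s] in auto)
    then have "2 * D 1 / (D s * D (s + 1)) \<le> 2 * D 1 / (exp (t * s) / 2 * (exp (t * s) / 2))"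
      using D_ge_1[of 1] D_ge_1[of s] D_ge_1[of "s + 1"] by (intro divide_left_mono mult_pos_pos) auto
    also have "\<dots> = 8 * D 1 * (exp (- t * s))\<^sup>2"
      by (simp add: exp_minus power2_eq_square field_simps)
    finally have "2 * D 1 / (D s * D (s + 1)) \<le> 8 * D 1 * (exp (- t * s))\<^sup>2" .
    moreover have "0 \<le> 1 / (D (s + 1))\<^sup>2" "0 \<le> 1 / (D s)\<^sup>2" by simp_all
    ultimately show "2 * D 1 / (D s * D (s + 1)) - 1 / (D (s + 1))\<^sup>2 - 1 / (D s)\<^sup>2 \<le> 8 * D 1 * (exp (- t * s))\<^sup>2"
      by linarith
    show "0 \<le> (D 1)\<^sup>2 - 1" using D_ge_1[of 1] by simp
  qed
  finally have "sqrt ((minkowski e w v)\<^sup>2) \<le> sqrt (8 * D 1 * ((D 1)\<^sup>2 - 1) * (exp (- t * s))\<^sup>2)"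
    by (intro real_sqrt_le_mono) (simp only: mult.commute mult.left_commute)
  then show ?thesis
    unfolding wv real_sqrt_mult[of _ "(exp _)\<^sup>2"] real_sqrt_abs by (simp only: abs_exp_cancel)
qed

lemma dist_boost_orbit_power:
  assumes z: "z \<in> hyperboloid e"
  shows "hyp_dist e (\<rho> (boost_isom (real k)) z) z \<le> real k * hyp_dist e (\<rho> (boost_isom 1) z) z"
proof (induction k)
  case 0
  have "boost_isom 0 = restrict (\<lambda>x. x) (hypn :: (real \<times> (real ^ 'n)) set)"
    unfolding boost_isom_def by (rule restrict_ext) (rule boost_0)
  then have "\<rho> (boost_isom 0) z = z" by (simp only: act_id[OF z])
  then show ?case by (simp add: hyp_dist_self)
next
  case (Suc k)
  note m = act_mem[OF boost_isom_n z]
  have "\<rho> (boost_isom (real (Suc k))) z = \<rho> (boost_isom (real k)) (\<rho> (boost_isom 1) z)"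
    using act_compose[OF boost_isom_n boost_isom_n z, of "real k" 1]
    by (simp add: boost_isom_compose add.commute)
  then have "hyp_dist e (\<rho> (boost_isom (real (Suc k))) z) (\<rho> (boost_isom (real k)) z)
      = hyp_dist e (\<rho> (boost_isom 1) z) z"
    using act_dist[OF boost_isom_n m z] by simp
  then show ?case
    using hyp_dist_triangle[OF m[of "real (Suc k)"] m[of "real k"] z] Suc
    by (simp add: algebra_simps)
qed

lemma boost_orbit_bound:
  obtains A where "\<And>k. hyp_dist e (\<rho> (boost_isom (real k)) b) b \<le> t * real k + A"
proof -
  let ?K = "sqrt (8 * D 1 * ((D 1)\<^sup>2 - 1))"
  have K: "0 \<le> ?K" using D_ge_1[of 1] by simp
  have "\<exists>M. \<forall>k. D (real k) \<le> M * exp ((t + \<epsilon>) * real k)" if \<epsilon>: "0 < \<epsilon>" for \<epsilon>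
  proof -
    \<comment> \<open>A point \<open>z\<close> whose displacement is within \<epsilon> of the
      infimum is enough here. Iterating at \<open>z\<close> and going from \<open>b\<close> to
      \<open>z\<close> and back gives the growth rate \<open>t + \<epsilon>\<close>, with a factor
      that depends on \<epsilon>.\<close>
    have "translation_length (hyp_space e) (\<rho> (boost_isom 1)) < t + \<epsilon>"
      using \<epsilon> by (simp add: lengths boost_isom_n translation_length_boost)
    then obtain z where z: "z \<in> hyperboloid e" "hyp_dist e (\<rho> (boost_isom 1) z) z < t + \<epsilon>"
      unfolding translation_length_def mspace_hyp_space mdist_hyp_space
      using cInf_lessD[of "(\<lambda>x. hyp_dist e (\<rho> (boost_isom 1) x) x) ` hyperboloid e"] b_mem by auto
    have "D (real k) \<le> exp (2 * hyp_dist e b z) * exp ((t + \<epsilon>) * real k)" for k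
    proof -
      let ?g = "\<rho> (boost_isom (real k))"
      have "hyp_dist e b (?g b) \<le> hyp_dist e b z + hyp_dist e z (?g b)"
        by (rule hyp_dist_triangle[OF b_mem z(1) boost_orbit_mem])
      also have "hyp_dist e z (?g b) \<le> hyp_dist e z (?g z) + hyp_dist e (?g z) (?g b)"
        by (rule hyp_dist_triangle[OF z(1) act_mem[OF boost_isom_n z(1)] boost_orbit_mem])
      also have "hyp_dist e (?g z) (?g b) = hyp_dist e b z"
        using act_dist[OF boost_isom_n z(1) b_mem] by (simp add: hyp_dist_commute)
      also have "hyp_dist e z (?g z) \<le> real k * (t + \<epsilon>)"
      proof -
        have "real k * hyp_dist e (\<rho> (boost_isom 1) z) z \<le> real k * (t + \<epsilon>)"
          using z(2) by (intro mult_left_mono) auto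
        then show ?thesis
          using dist_boost_orbit_power[OF z(1), of k] by (simp add: hyp_dist_commute[of e z])
      qed
      finally have "hyp_dist e b (?g b) \<le> 2 * hyp_dist e b z + (t + \<epsilon>) * real k"
        by (simp add: mult.commute)
      then have "exp (hyp_dist e b (?g b)) \<le> exp (2 * hyp_dist e b z) * exp ((t + \<epsilon>) * real k)"
        by (simp add: exp_add[symmetric])
      then show ?thesis
        using minkowski_exp_bounds(2)[OF b_mem boost_orbit_mem[of "real k"]] by (simp add: D_def)
    qed
    then show ?thesis by blast
  qed
  moreover have "\<bar>D (real (Suc (Suc k))) / D (real (Suc k)) - D (real (Suc k)) / D (real k)\<bar>
      \<le> ?K * exp (- t * real k)" for k
  proof -
    have "real (Suc (Suc k)) = real k + 2" "real (Suc k) = real k + 1" by simp_all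
    then show ?thesis using D_ratio[of "real k"] by (simp only:)
  qed
  moreover have "0 < D (real k)" for k using D_ge_1[of "real k"] by linarith
  ultimately obtain A where A: "0 < A" "\<And>k. D (real k) \<le> A * exp (t * real k)"
    using ratio_growth[OF t_pos K, of "\<lambda>k. D (real k)"] by blast
  have "hyp_dist e (\<rho> (boost_isom (real k)) b) b \<le> t * real k + ln (2 * A)" for k
  proof -
    have "exp (hyp_dist e (\<rho> (boost_isom (real k)) b) b) \<le> 2 * D (real k)"
      using minkowski_exp_bounds(1)[OF b_mem boost_orbit_mem[of "real k"]]
      by (simp add: D_def hyp_dist_commute)
    also have "\<dots> \<le> exp (t * real k + ln (2 * A))"
      using A(2)[of k] A(1) by (simp add: exp_add mult.commute)
    finally show ?thesis by simp
  qed
  then show ?thesis using that by blast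
qed

section \<open>From boosts to all isometries\<close>

lemma compact_orbit_piece: "compact ((\<lambda>g. \<rho> g b) ` {g \<in> isom_n. distn (g orig) orig \<le> R})"
  using image_compactin[OF compactin_isom_n cont[OF b_mem]] by (simp add: compactin_hyp_space)

text \<open>Continuity of the orbit map on a compact set of isometries. Radius 1 is enough: what is
  left of an isometry after a rotation and an integer boost moves \<open>orig\<close> by at most
  1.\<close>

lemma orbit_piece_bound:
  obtains M where "0 \<le> M" "\<And>g. g \<in> isom_n \<Longrightarrow> distn (g orig) orig \<le> 1 \<Longrightarrow> hyp_dist e (\<rho> g b) b \<le> M"
proof -
  let ?S = "(\<lambda>g. \<rho> g b) ` {g \<in> isom_n. distn (g orig) orig \<le> 1}"
  have S: "?S \<subseteq> hyperboloid e" by (intro image_subsetI) (simp add: act_mem b_mem)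
  have "compact ((\<lambda>x. hyp_dist e x b) ` ?S)"
    by (rule compact_continuous_image[OF continuous_on_hyp_dist[OF continuous_on_id continuous_on_const] compact_orbit_piece])
      (use S b_mem in \<open>simp_all add: image_subset_iff\<close>)
  then have "bdd_above ((\<lambda>x. hyp_dist e x b) ` ?S)"
    by (intro bounded_imp_bdd_above compact_imp_bounded)
  then obtain M where M: "\<And>d. d \<in> (\<lambda>x. hyp_dist e x b) ` ?S \<Longrightarrow> d \<le> M"
    unfolding bdd_above_def by blast
  show ?thesis
    by (rule that[of "max 0 M"]) (auto intro!: M max.coboundedI2)
qed

lemma orbit_rough_isometry_base:
  obtains K where "0 \<le> K" "\<And>g. g \<in> isom_n \<Longrightarrow> \<bar>hyp_dist e (\<rho> g b) b - t * distn (g orig) orig\<bar> \<le> K"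
proof -
  obtain A where A: "\<And>k. hyp_dist e (\<rho> (boost_isom (real k)) b) b \<le> t * real k + A"
    using boost_orbit_bound by blast
  obtain M where M: "0 \<le> M" "\<And>g. g \<in> isom_n \<Longrightarrow> distn (g orig) orig \<le> 1 \<Longrightarrow> hyp_dist e (\<rho> g b) b \<le> M"
    using orbit_piece_bound by blast
  \<comment> \<open>Here \<open>A\<close> comes from the integer boost, \<open>t\<close> from
    rounding the length down to an integer, and each \<open>M\<close> from one of the factors on the
    two sides of the boost.\<close>
  have "\<bar>hyp_dist e (\<rho> g b) b - t * distn (g orig) orig\<bar> \<le> \<bar>A\<bar> + t + 2 * M" if g: "g \<in> isom_n" for g
  proof -
    define r where "r = distn (g orig) orig"
    obtain k where k: "k \<in> isom_n" "k orig = orig" "\<And>x. x \<in> hypn \<Longrightarrow> k (k x) = x"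
      and kr: "k (boost r orig) = g orig"
      using isom_n_polar[OF g] unfolding r_def by blast
    define j where "j = nat \<lfloor>r\<rfloor>"
    have r0: "0 \<le> r" by (simp add: r_def hyp_dist_nonneg)
    have j: "real j \<le> r" "r \<le> real j + 1" using r0 unfolding j_def by linarith+
    note T = boost_isom_n[where 'n = 'n]
    \<comment> \<open>The remainder in the factorisation of \<open>g\<close> as \<open>k\<close>,
      then integer boost, then \<open>h\<close>. It takes \<open>orig\<close> to the boost of
      \<open>orig\<close> by \<open>r - j\<close>, which is at most 1.\<close>
    define h where "h = compose hypn (boost_isom (- real j)) (compose hypn k g)"
    have h: "h \<in> isom_n" unfolding h_def by (intro isom_n_compose T k g)
    have hx: "h x = boost (- real j) (k (g x))" if "x \<in> hypn" for x
      using that isom_n_mem[OF g that] isom_n_mem[OF k(1) isom_n_mem[OF g that]]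
      by (simp add: h_def compose_eq boost_isom_def)
    have "compose hypn k (compose hypn (boost_isom (real j)) h) = g"
    proof (rule isom_n_ext)
      show "compose hypn k (compose hypn (boost_isom (real j)) h) \<in> isom_n"
        by (intro isom_n_compose T k h)
      fix x :: "real \<times> (real ^ 'n)" assume x: "x \<in> hypn"
      have "boost_isom (real j) (h x) = k (g x)"
        using isom_n_mem[OF h x] by (simp add: boost_isom_def hx[OF x] boost_add boost_0)
      then show "compose hypn k (compose hypn (boost_isom (real j)) h) x = g x"
        using x k(3)[OF isom_n_mem[OF g x]] by (simp add: compose_eq)
    qed (rule g)
    then have gb: "\<rho> g b = \<rho> k (\<rho> (boost_isom (real j)) (\<rho> h b))"
      using act_compose[OF k(1) isom_n_compose[OF T h] b_mem, of "real j"] act_compose[OF T h b_mem, of "real j"]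
      by simp
    have "distn (h orig) orig = distn (boost (- real j) (boost r orig)) (boost (- real j) (boost (real j) orig) :: real \<times> (real ^ 'n))"
      using k(3)[OF boost_mem[OF orig_mem], of r] by (simp add: hx orig_mem boost_add boost_0 flip: kr)
    also have "\<dots> \<le> 1" using j unfolding boost_add distn_boost by simp
    finally have hM: "hyp_dist e (\<rho> h b) b \<le> M" by (rule M(2)[OF h])
    have "distn (k orig) orig \<le> 1" unfolding k(2) hyp_dist_self by simp
    then have kM: "hyp_dist e (\<rho> k b) b \<le> M" by (rule M(2)[OF k(1)])
    let ?T = "\<rho> (boost_isom (real j))"
    have m: "\<rho> k b \<in> hyperboloid e" "\<rho> h b \<in> hyperboloid e" "?T b \<in> hyperboloid e" "?T (\<rho> h b) \<in> hyperboloid e"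
      "\<rho> g b \<in> hyperboloid e"
      by (intro act_mem k(1) h g T b_mem)+
    have kk: "\<rho> k (\<rho> k b) = b"
    proof -
      have "compose hypn k k = restrict (\<lambda>x. x) hypn"
        using isom_n_compose[OF k(1) k(1)] by (intro extensionalityI[of _ hypn]) (simp_all add: compose_eq k(3) isometry_group_iff)
      then show ?thesis using act_compose[OF k(1) k(1) b_mem] act_id[OF b_mem] by simp
    qed
    have 1: "hyp_dist e (\<rho> g b) b = hyp_dist e (?T (\<rho> h b)) (\<rho> k b)"
      using act_dist[OF k(1) m(4) m(1)] unfolding kk gb .
    have 2: "hyp_dist e (?T (\<rho> h b)) (?T b) \<le> M"
      using act_dist[OF T m(2) b_mem] hM by simp
    have "hyp_dist e (?T (\<rho> h b)) (\<rho> k b) \<le> hyp_dist e (?T (\<rho> h b)) (?T b) + (hyp_dist e (?T b) b + hyp_dist e b (\<rho> k b))"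
      using hyp_dist_triangle[OF m(4) m(3) m(1)] hyp_dist_triangle[OF m(3) b_mem m(1)] by linarith
    moreover have "hyp_dist e (?T b) b \<le> hyp_dist e (?T b) (?T (\<rho> h b)) + (hyp_dist e (?T (\<rho> h b)) (\<rho> k b) + hyp_dist e (\<rho> k b) b)"
      using hyp_dist_triangle[OF m(3) m(4) b_mem] hyp_dist_triangle[OF m(4) m(1) b_mem] by linarith
    ultimately have 3: "\<bar>hyp_dist e (\<rho> g b) b - hyp_dist e (?T b) b\<bar> \<le> 2 * M"
      using 1 2 kM by (simp add: hyp_dist_commute[of e b] hyp_dist_commute[of e "?T b" "?T (\<rho> h b)"])
    have "t * real j \<le> t * r" "t * r \<le> t * (real j + 1)" using j t_pos by simp_all
    moreover have "t * (real j + 1) = t * real j + t" by (simp add: algebra_simps)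
    ultimately show ?thesis
      using 3 A[of j] dist_boost_orbit_ge[of "real j"] t_pos unfolding r_def[symmetric] by linarith
  qed
  then show ?thesis using that[of "\<bar>A\<bar> + t + 2 * M"] M(1) t_pos by force
qed

text \<open>Equivariance: the inverse of \<open>h\<close> moves the pair so that its second member
  becomes the base point.\<close>

lemma orbit_rough_isometry:
  obtains K where "0 \<le> K" "\<And>g h. g \<in> isom_n \<Longrightarrow> h \<in> isom_n \<Longrightarrow>
     \<bar>hyp_dist e (\<rho> g b) (\<rho> h b) - t * distn (g orig) (h orig)\<bar> \<le> K"
proof -
  obtain K where K: "0 \<le> K" "\<And>g. g \<in> isom_n \<Longrightarrow> \<bar>hyp_dist e (\<rho> g b) b - t * distn (g orig) orig\<bar> \<le> K"
    using orbit_rough_isometry_base by blast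
  have "\<bar>hyp_dist e (\<rho> g b) (\<rho> h b) - t * distn (g orig) (h orig)\<bar> \<le> K"
    if g: "g \<in> isom_n" and h: "h \<in> isom_n" for g h
  proof -
    obtain h' where h': "h' \<in> isom_n" "\<forall>x\<in>hypn. h' (h x) = x" "\<forall>x\<in>hyperboloid e. \<rho> h' (\<rho> h x) = x"
      by (rule act_inverse[OF h])
    have "hyp_dist e (\<rho> (compose hypn h' g) b) b = hyp_dist e (\<rho> g b) (\<rho> h b)"
      using act_dist[OF h'(1) act_mem[OF g b_mem] act_mem[OF h b_mem]]
      by (simp add: act_compose[OF h'(1) g b_mem] bspec[OF h'(3) b_mem])
    moreover have "distn (compose hypn h' g orig) orig = distn (g orig) (h orig)"
      using isom_n_dist[OF h'(1) isom_n_mem[OF g orig_mem] isom_n_mem[OF h orig_mem]]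
      by (simp add: compose_eq orig_mem bspec[OF h'(2) orig_mem])
    ultimately show ?thesis using K(2)[OF isom_n_compose[OF h'(1) g]] by simp
  qed
  then show ?thesis using that K(1) by blast
qed

text \<open>Orbit points are indexed by isometries, so an intermediate point of a geodesic is wanted
  in the form \<open>k orig\<close>; transitivity provides \<open>k\<close>.\<close>

lemma isom_n_between:
  fixes g h :: "real \<times> (real ^ 'n) \<Rightarrow> real \<times> (real ^ 'n)"
  assumes g: "g \<in> isom_n" and h: "h \<in> isom_n" and a: "0 \<le> a" "a \<le> distn (g orig) (h orig)"
  obtains k where "k \<in> isom_n" "distn (g orig) (k orig) = a"
    "distn (k orig) (h orig) = distn (g orig) (h orig) - a"
proof -
  obtain c where c: "geodesic (hyp_space orig) (distn (g orig) (h orig)) c" "c 0 = g orig"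
    "c (distn (g orig) (h orig)) = h orig"
    using geodesic_hyp_exists[OF isom_n_mem[OF g orig_mem] isom_n_mem[OF h orig_mem]] by blast
  define d where "d = distn (g orig) (h orig)"
  have cm: "c s \<in> hypn" and cd: "distn (c s) (c s') = \<bar>s - s'\<bar>" if "s \<in> {0..d}" "s' \<in> {0..d}" for s s'
    using c(1) that unfolding geodesic_def d_def[symmetric] mdist_hyp_space mspace_hyp_space by blast+
  have ad: "a \<in> {0..d}" "0 \<in> {0..d}" "d \<in> {0..d}" using a by (simp_all add: d_def)
  have "c a \<in> hypn" using cm[OF ad(1) ad(1)] .
  moreover have "distn (g orig) (c a) = a" "distn (c a) (h orig) = d - a"
    using cd[OF ad(2,1)] cd[OF ad(1,3)] a unfolding c(2) c(3)[folded d_def] by (simp_all add: d_def)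
  moreover obtain k where "k \<in> isom_n" "k orig = c a"
    using isom_n_transitive[OF \<open>c a \<in> hypn\<close>] by blast
  ultimately show ?thesis using that[of k] by (simp add: d_def)
qed

end


section \<open>Compactness and the minimal convex set\<close>

text \<open>A theorem of Mazur. If a finite set \<open>k\<close> approximates \<open>S\<close>, then
  the convex hull of \<open>S\<close> stays near that of \<open>k\<close>, which is compact because
  \<open>k\<close> is finite.\<close>

lemma compact_closure_convex_hull:
  fixes S :: "'a::{real_inner, complete_space} set"
  assumes "\<And>\<epsilon>. 0 < \<epsilon> \<Longrightarrow> \<exists>k. finite k \<and> S \<subseteq> (\<Union>x\<in>k. ball x \<epsilon>)"
  shows "compact (closure (convex hull S))"
  unfolding compact_eq_totally_bounded
proof (intro conjI allI impI)
  show "complete (closure (convex hull S))"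
    by (simp add: complete_eq_closed)
  fix \<epsilon> :: real assume \<epsilon>: "0 < \<epsilon>"
  obtain k where k: "finite k" "S \<subseteq> (\<Union>x\<in>k. ball x (\<epsilon> / 4))"
    using assms[of "\<epsilon> / 4"] \<epsilon> by auto
  have "compact (convex hull k)" by (rule finite_imp_compact_convex_hull[OF k(1)])
  then obtain k' where k': "finite k'" "convex hull k \<subseteq> (\<Union>x\<in>k'. ball x (\<epsilon> / 4))"
    using divide_pos_pos[OF \<epsilon> zero_less_numeral[of "Num.Bit0 (Num.Bit0 Num.One)"]]
    unfolding compact_eq_totally_bounded by blast
  \<comment> \<open>A sum of two convex sets, hence convex, so it contains the hull of
    \<open>S\<close> as soon as it contains \<open>S\<close>.\<close>
  let ?A = "\<Union>x\<in>convex hull k. \<Union>y\<in>ball 0 (\<epsilon> / 4). {x + y}"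
  have "S \<subseteq> ?A"
  proof
    fix s assume "s \<in> S"
    then obtain x where x: "x \<in> k" "dist x s < \<epsilon> / 4" using k(2) by auto
    then have "s - x \<in> ball 0 (\<epsilon> / 4)" by (simp add: dist_norm norm_minus_commute)
    moreover have "x \<in> convex hull k" using x(1) by (rule hull_inc)
    moreover have "s = x + (s - x)" by simp
    ultimately show "s \<in> ?A" by blast
  qed
  then have "convex hull S \<subseteq> ?A"
    by (intro hull_minimal convex_sums convex_convex_hull convex_ball)
  also have "?A \<subseteq> (\<Union>x\<in>k'. cball x (\<epsilon> / 2))"
  proof
    fix z assume "z \<in> ?A"
    then obtain x y where xy: "x \<in> convex hull k" "norm y < \<epsilon> / 4" "z = x + y" by auto
    then obtain x' where x': "x' \<in> k'" "dist x' x < \<epsilon> / 4" using k'(2) by auto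
    have "dist x' z \<le> dist x' x + dist x z" by (rule dist_triangle)
    also have "dist x z = norm y" by (simp add: xy(3) dist_norm)
    finally have "dist x' z \<le> \<epsilon> / 2" using x' xy by simp
    then show "z \<in> (\<Union>x\<in>k'. cball x (\<epsilon> / 2))" using x'(1) by auto
  qed
  finally have "closure (convex hull S) \<subseteq> (\<Union>x\<in>k'. cball x (\<epsilon> / 2))"
    by (rule closure_minimal) (intro closed_UN k'(1) ballI closed_cball)
  also have "\<dots> \<subseteq> (\<Union>x\<in>k'. ball x \<epsilon>)" using \<epsilon> by (intro UN_mono) auto
  finally show "\<exists>k. finite k \<and> closure (convex hull S) \<subseteq> (\<Union>x\<in>k. ball x \<epsilon>)"
    using k'(1) by blast
qed

lemma continuous_on_klein: "continuous_on (hyperboloid e) (klein e)"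
  unfolding klein_def using inner_hyp_base_ge_1[of _ e]
  by (intro continuous_intros) fastforce

text \<open>Central projection straightens geodesics: dividing by the height turns a nonnegative
  combination into a convex one, with weights \<open>\<alpha> * p x / p z\<close> and
  \<open>\<beta> * p y / p z\<close> for z the combined point.\<close>

lemma geodesically_convex_klein:
  assumes Q: "convex Q"
  shows "geodesically_convex (hyp_space e) {z \<in> hyperboloid e. klein e z \<in> Q}"
proof (rule geodesically_convexI)
  fix x y \<alpha> \<beta>
  assume x: "x \<in> {z \<in> hyperboloid e. klein e z \<in> Q}" and y: "y \<in> {z \<in> hyperboloid e. klein e z \<in> Q}"
    and pos: "0 \<le> \<alpha>" "0 \<le> \<beta>" and z: "\<alpha> *\<^sub>R x + \<beta> *\<^sub>R y \<in> hyperboloid e"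
  define p where "p = (\<lambda>v. v \<bullet> hyp_base e)"
  let ?z = "\<alpha> *\<^sub>R x + \<beta> *\<^sub>R y"
  have p: "p x \<ge> 1" "p y \<ge> 1" "p ?z \<ge> 1"
    using x y z by (simp_all add: p_def inner_hyp_base_ge_1)
  have pz: "p ?z = \<alpha> * p x + \<beta> * p y" by (simp add: p_def inner_add_left)
  have kl: "klein e v = inverse (p v) *\<^sub>R v" for v by (simp add: klein_def p_def)
  have "\<alpha> * p x / p ?z * inverse (p x) = \<alpha> * inverse (p ?z)" "\<beta> * p y / p ?z * inverse (p y) = \<beta> * inverse (p ?z)"
    using p(1,2) by (simp_all add: divide_inverse)
  then have "klein e ?z = (\<alpha> * p x / p ?z) *\<^sub>R klein e x + (\<beta> * p y / p ?z) *\<^sub>R klein e y"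
    unfolding kl scaleR_scaleR by (simp only: scaleR_add_right scaleR_scaleR mult.commute)
  also have "\<dots> \<in> Q"
    by (rule convexD[OF Q]) (use x y pos p in \<open>simp_all add: pz add_divide_distrib[symmetric]\<close>)
  finally show "?z \<in> {z \<in> hyperboloid e. klein e z \<in> Q}" using z by simp
qed simp

locale minimal_convex_rep = length_scaling_rep e t \<rho> b
  for e :: "'h::{real_inner, complete_space}" and t :: real
    and \<rho> :: "(real \<times> (real ^ 'n) \<Rightarrow> real \<times> (real ^ 'n)) \<Rightarrow> 'h \<Rightarrow> 'h" and b :: 'h +
  fixes C :: "'h set"
  assumes minimal: "minimal_closed_convex_invariant isom_n \<rho> (hyp_space e) C"
    and b_C: "b \<in> C"
begin

lemma C_closed: "closed C" and C_sub: "C \<subseteq> hyperboloid e"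
  and C_convex: "geodesically_convex (hyp_space e) C"
  and C_invariant: "g \<in> isom_n \<Longrightarrow> x \<in> C \<Longrightarrow> \<rho> g x \<in> C"
  using minimal unfolding minimal_closed_convex_invariant_def closed_convex_invariant_def closedin_hyp_space
  by (blast+)

lemma orbit_C: "g \<in> isom_n \<Longrightarrow> \<rho> g b \<in> C"
  by (rule C_invariant[OF _ b_C])

lemma act_continuous:
  assumes g: "g \<in> isom_n"
  shows "continuous_on (hyperboloid e) (\<rho> g)"
proof -
  have "Lipschitz_continuous_map (hyp_space e) (hyp_space e) (\<rho> g)"
    unfolding Lipschitz_continuous_map_def mspace_hyp_space mdist_hyp_space
  proof (intro conjI exI ballI)
    fix x y assume "x \<in> hyperboloid e" "y \<in> hyperboloid e"
    then show "hyp_dist e (\<rho> g x) (\<rho> g y) \<le> 1 * hyp_dist e x y" by (simp add: act_dist[OF g])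
  qed (intro Pi_I act_mem[OF g])
  then have "continuous_map (mtopology_of (hyp_space e)) (mtopology_of (hyp_space e)) (\<rho> g)"
    by (intro uniformly_continuous_imp_continuous_map Lipschitz_imp_uniformly_continuous_map)
  then show ?thesis
    unfolding mtopology_hyp_space by (simp add: continuous_map_in_subtopology)
qed

text \<open>The set need not be invariant: the part of \<open>C\<close> that lies in all its translates is.\<close>

lemma C_hull:
  assumes S: "closed S" "geodesically_convex (hyp_space e) S" and orb: "\<And>g. g \<in> isom_n \<Longrightarrow> \<rho> g b \<in> S"
  shows "C \<subseteq> S"
proof -
  have i: "restrict (\<lambda>x. x) hypn \<in> (isom_n :: (real \<times> (real ^ 'n) \<Rightarrow> _) set)"
    using isometry_id[of "hyp_space_n :: (real \<times> (real ^ 'n)) metric"] by simp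
  \<comment> \<open>The points of \<open>C\<close> whose whole orbit lies in \<open>S\<close>. This
    set is closed because the action is continuous, convex because isometries preserve geodesics,
    and invariant by the group law; minimality makes it all of \<open>C\<close>.\<close>
  define W where "W = C \<inter> (\<Inter>g\<in>isom_n. hyperboloid e \<inter> \<rho> g -` S)"
  have WC: "W \<subseteq> C" by (auto simp: W_def)
  have Wiff: "w \<in> W \<longleftrightarrow> w \<in> C \<and> (\<forall>g\<in>isom_n. \<rho> g w \<in> S)" for w
    using C_sub unfolding W_def by blast
  have "closed_convex_invariant isom_n \<rho> (hyp_space e) W"
    unfolding closed_convex_invariant_def closedin_hyp_space
  proof (intro conjI ballI)
    have "b \<in> W" unfolding Wiff using b_C orb by blast
    then show "W \<noteq> {}" by blast
    show "W \<subseteq> hyperboloid e" using WC C_sub by (rule order_trans)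
    show "closed W"
      unfolding W_def
      by (intro closed_Int closed_INT C_closed ballI continuous_closed_preimage act_continuous closed_hyperboloid S(1))
    show "geodesically_convex (hyp_space e) W"
      unfolding geodesically_convex_def
    proof (intro conjI allI impI subsetI)
      show "x \<in> mspace (hyp_space e)" if "x \<in> W" for x
        using that WC C_sub by auto
      fix l c z assume c: "geodesic (hyp_space e) l c \<and> c 0 \<in> W \<and> c l \<in> W" and "z \<in> c ` {0..l}"
      then obtain s where s: "s \<in> {0..l}" "z = c s" by blast
      have g: "geodesic (hyp_space e) l c" and W0: "c 0 \<in> W" "c l \<in> W" using c by blast+
      have cH: "c s \<in> hyperboloid e" if "s \<in> {0..l}" for s
        using g that unfolding geodesic_def mspace_hyp_space by blast
      have "z \<in> C"
        using C_convex g W0 WC s unfolding geodesically_convex_def by blast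
      moreover have "\<rho> h z \<in> S" if h: "h \<in> isom_n" for h
      proof -
        have "geodesic (hyp_space e) l (\<lambda>s. \<rho> h (c s))"
          unfolding geodesic_def mspace_hyp_space mdist_hyp_space
        proof (intro conjI ballI)
          show "0 \<le> l" using g by (simp add: geodesic_def)
          show "(\<lambda>s. \<rho> h (c s)) ` {0..l} \<subseteq> hyperboloid e"
            by (intro image_subsetI act_mem[OF h] cH)
          fix s s' assume "s \<in> {0..l}" "s' \<in> {0..l}"
          then show "hyp_dist e (\<rho> h (c s)) (\<rho> h (c s')) = \<bar>s - s'\<bar>"
            using g by (simp add: act_dist[OF h cH cH] geodesic_def)
        qed
        moreover have "\<rho> h (c 0) \<in> S" "\<rho> h (c l) \<in> S" using W0 h unfolding Wiff by blast+
        ultimately have "(\<lambda>s. \<rho> h (c s)) ` {0..l} \<subseteq> S"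
          using S(2) unfolding geodesically_convex_def by blast
        then show ?thesis using s by blast
      qed
      ultimately show "z \<in> W" unfolding Wiff by blast
    qed
    fix h :: "real \<times> (real ^ 'n) \<Rightarrow> real \<times> (real ^ 'n)" assume h: "h \<in> isom_n"
    show "\<rho> h ` W \<subseteq> W"
    proof (rule image_subsetI)
      fix w assume w: "w \<in> W"
      have wC: "w \<in> C" and wH: "w \<in> hyperboloid e" using w WC C_sub by blast+
      have "\<rho> g (\<rho> h w) \<in> S" if g: "g \<in> isom_n" for g
        using w isom_n_compose[OF g h] unfolding Wiff act_compose[OF g h wH, symmetric] by blast
      then show "\<rho> h w \<in> W" unfolding Wiff using C_invariant[OF h wC] by blast
    qed
  qed
  then have "W = C"
    using minimal WC unfolding minimal_closed_convex_invariant_def by blast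
  show ?thesis
  proof
    fix z assume "z \<in> C"
    then have "\<rho> (restrict (\<lambda>x. x) hypn) z \<in> S" "z \<in> hyperboloid e"
      using Wiff[of z] i \<open>W = C\<close> C_sub by blast+
    then show "z \<in> S" by (simp add: act_id)
  qed
qed

text \<open>A far orbit point is projected close to the projection of an orbit point at distance \<open>R\<close> on the
  way to it, and the orbit points at bounded distance form a compact set.\<close>

lemma klein_orbit_totally_bounded:
  assumes \<epsilon>: "0 < \<epsilon>"
  shows "\<exists>k. finite k \<and> (\<lambda>g. klein e (\<rho> g b)) ` isom_n \<subseteq> (\<Union>x\<in>k. ball x \<epsilon>)"
proof -
  define u where "u = hyp_base e"
  have e: "e \<noteq> 0" by (rule hyperboloid_nonzero[OF b_mem])
  have u: "u \<in> hyperboloid e" unfolding u_def by (rule hyp_base_mem[OF e])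
  obtain K where K: "0 \<le> K" "\<And>g h. g \<in> isom_n \<Longrightarrow> h \<in> isom_n \<Longrightarrow>
     \<bar>hyp_dist e (\<rho> g b) (\<rho> h b) - t * distn (g orig) (h orig)\<bar> \<le> K"
    by (rule orbit_rough_isometry) blast
  define i where "i = restrict (\<lambda>x. x) (hypn :: (real \<times> (real ^ 'n)) set)"
  have i: "i \<in> isom_n"
    unfolding i_def using isometry_id[of "hyp_space_n :: (real \<times> (real ^ 'n)) metric"] by simp
  have ib: "\<rho> i b = b" unfolding i_def by (rule act_id[OF b_mem])
  have io: "i orig = orig" unfolding i_def by (simp add: orig_mem)
  \<comment> \<open>The Klein model is centred at \<open>u\<close> and the orbit estimate at
    \<open>b\<close>; \<open>c\<close> pays for both the change of centre and the error
    \<open>K\<close>.\<close>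
  define c where "c = K + hyp_dist e b u"
  have p_low: "exp (t * distn (g orig) orig - c) / 2 \<le> \<rho> g b \<bullet> u" if g: "g \<in> isom_n" for g
  proof -
    have "t * distn (g orig) orig - c \<le> hyp_dist e (\<rho> g b) u"
      using K(2)[OF g i] hyp_dist_triangle[OF act_mem[OF g b_mem] u b_mem]
      unfolding ib io c_def by (simp add: hyp_dist_commute[of e u b])
    then have "exp (t * distn (g orig) orig - c) \<le> exp (hyp_dist e (\<rho> g b) u)" by simp
    then show ?thesis
      using minkowski_exp_bounds(1)[OF act_mem[OF g b_mem] u] minkowski_hyp_base[OF e, of "\<rho> g b"]
      unfolding u_def by linarith
  qed
  \<comment> \<open>Chosen so that the final bound \<open>8 * exp (K + 2 * c) * \<delta>\<close> for
    the squared Klein distance is the square of \<open>\<epsilon> / 2\<close>; \<open>R\<close> is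
    then taken so large that \<open>exp (- 2 * t * R)\<close> is at most \<delta>.\<close>
  define \<delta> where "\<delta> = (\<epsilon> / 2)\<^sup>2 / (8 * exp (K + 2 * c))"
  have \<delta>: "0 < \<delta>" using \<epsilon> by (simp add: \<delta>_def)
  define R where "R = max 0 (- ln \<delta> / (2 * t))"
  have R: "0 \<le> R" "exp (- 2 * t * R) \<le> \<delta>"
  proof -
    show "0 \<le> R" by (simp add: R_def)
    have "- ln \<delta> / (2 * t) \<le> R" by (simp add: R_def)
    then have "2 * t * (- ln \<delta> / (2 * t)) \<le> 2 * t * R" using t_pos by (intro mult_left_mono) auto
    then have "- ln \<delta> \<le> 2 * t * R" using t_pos by simp
    then have "exp (- 2 * t * R) \<le> exp (ln \<delta>)" by simp
    then show "exp (- 2 * t * R) \<le> \<delta>" using \<delta> by simp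
  qed
  let ?Y = "(\<lambda>g. \<rho> g b) ` {g \<in> isom_n. distn (g orig) orig \<le> R}"
  have "?Y \<subseteq> hyperboloid e" by (intro image_subsetI) (simp add: act_mem b_mem)
  then have "compact (klein e ` ?Y)"
    by (rule compact_continuous_image[OF continuous_on_subset[OF continuous_on_klein] compact_orbit_piece])
  then obtain k where k: "finite k" "klein e ` ?Y \<subseteq> (\<Union>x\<in>k. ball x (\<epsilon> / 2))"
    using half_gt_zero[OF \<epsilon>] compact_eq_totally_bounded[of "klein e ` ?Y"] by meson
  have "klein e (\<rho> g b) \<in> (\<Union>x\<in>k. ball x \<epsilon>)" if g: "g \<in> isom_n" for g
  proof -
    define r where "r = distn (g orig) orig"
    obtain h where h: "h \<in> isom_n" "distn (h orig) orig \<le> R"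
      and close: "norm (klein e (\<rho> g b) - klein e (\<rho> h b)) \<le> \<epsilon> / 2"
    proof (cases "r \<le> R")
      case True
      then show ?thesis using that[OF g] \<epsilon> by (simp add: r_def)
    next
      case False
      have ig: "distn (i orig) (g orig) = r" unfolding io r_def by (rule hyp_dist_commute)
      obtain h where h: "h \<in> isom_n" "distn (i orig) (h orig) = R" "distn (h orig) (g orig) = r - R"
        by (rule isom_n_between[OF i g R(1), unfolded ig]) (use False in \<open>linarith+\<close>)
      have hR: "distn (h orig) orig = R" "distn (g orig) (h orig) = r - R"
        using h(2,3) hyp_dist_commute[of orig "h orig" orig] hyp_dist_commute[of orig "h orig" "g orig"]
        unfolding io by linarith+
      note m = act_mem[OF g b_mem] act_mem[OF h(1) b_mem]
      let ?p = "\<rho> g b \<bullet> u" and ?q = "\<rho> h b \<bullet> u"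
      have "hyp_dist e (\<rho> g b) (\<rho> h b) \<le> t * (r - R) + K"
        using K(2)[OF g h(1)] unfolding hR by linarith
      then have "exp (hyp_dist e (\<rho> g b) (\<rho> h b)) \<le> exp (t * (r - R) + K)" by simp
      then have Bgh: "minkowski e (\<rho> g b) (\<rho> h b) \<le> exp (t * (r - R) + K)"
        using minkowski_exp_bounds(2)[OF m] by (rule order_trans[rotated])
      have p: "exp (t * r - c) / 2 \<le> ?p" "exp (t * R - c) / 2 \<le> ?q"
        using p_low[OF g] p_low[OF h(1)] unfolding hR r_def by simp_all
      define X Z where "X = exp (t * r - c)" and "Z = exp (t * R - c)"
      have pos: "0 < X" "0 < Z" by (simp_all add: X_def Z_def)
      have pq: "(X / 2) * (Z / 2) \<le> ?p * ?q"
        using p pos unfolding X_def[symmetric] Z_def[symmetric] by (intro mult_mono) linarith+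
      \<comment> \<open>The distance of the two orbit points grows like \<open>t * (r - R)\<close>,
        their heights have exponents \<open>t * r\<close> and \<open>t * R\<close>: the quotient
        decays in \<open>R\<close> and does not depend on \<open>r\<close>.\<close>
      have split: "exp (t * (r - R) + K) = exp (K + 2 * c) * exp (- 2 * t * R) * (X * Z)"
        unfolding X_def Z_def exp_add[symmetric] by (simp add: algebra_simps)
      have "2 * minkowski e (\<rho> g b) (\<rho> h b) / (?p * ?q) \<le> 2 * exp (t * (r - R) + K) / ((X / 2) * (Z / 2))"
        by (rule frac_le) (use Bgh pq pos in simp_all)
      also have "2 * exp (t * (r - R) + K) / ((X / 2) * (Z / 2)) = 8 * exp (K + 2 * c) * exp (- 2 * t * R)"
        unfolding split using pos by simp
      also have "8 * exp (K + 2 * c) * exp (- 2 * t * R) \<le> 8 * exp (K + 2 * c) * \<delta>"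
        by (rule mult_left_mono[OF R(2)]) simp
      also have "8 * exp (K + 2 * c) * \<delta> = (\<epsilon> / 2)\<^sup>2"
        unfolding \<delta>_def by simp
      finally have "(norm (klein e (\<rho> g b) - klein e (\<rho> h b)))\<^sup>2 \<le> (\<epsilon> / 2)\<^sup>2"
        by (rule order_trans[OF klein_dist_le[OF m, folded u_def]])
      then have "norm (klein e (\<rho> g b) - klein e (\<rho> h b)) \<le> \<epsilon> / 2"
        by (rule power2_le_imp_le) (use \<epsilon> in simp)
      then show ?thesis using that[OF h(1)] hR(1) by simp
    qed
    have "klein e (\<rho> h b) \<in> klein e ` ?Y" using h by blast
    then obtain x where x: "x \<in> k" "dist x (klein e (\<rho> h b)) < \<epsilon> / 2"
      using k(2) by (meson UN_E mem_ball subsetD)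
    have "dist x (klein e (\<rho> g b)) \<le> dist x (klein e (\<rho> h b)) + dist (klein e (\<rho> h b)) (klein e (\<rho> g b))"
      by (rule dist_triangle)
    then have "dist x (klein e (\<rho> g b)) < \<epsilon>"
      using x(2) close by (simp add: dist_norm norm_minus_commute)
    then show ?thesis using x(1) by auto
  qed
  then show ?thesis using k(1) by blast
qed

section \<open>Local compactness\<close>

text \<open>\<open>C\<close> projects into the compact convex set \<open>Q\<close>. A point is its
  height times its Klein projection, and in a ball the heights stay in a compact interval, which
  also keeps the points away from the ideal boundary that \<open>Q\<close> may touch.\<close>

lemma compact_C_ball: "compact {z \<in> C. hyp_dist e z b \<le> R}"
proof (cases "0 \<le> R")
  case True
  have e: "e \<noteq> 0" by (rule hyperboloid_nonzero[OF b_mem])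
  have u: "hyp_base e \<in> hyperboloid e" by (rule hyp_base_mem[OF e])
  define Q where "Q = closure (convex hull ((\<lambda>g. klein e (\<rho> g b)) ` isom_n))"
  have Q: "compact Q" "convex Q"
    unfolding Q_def
    by (rule compact_closure_convex_hull, erule klein_orbit_totally_bounded)
      (rule convex_closure[OF convex_convex_hull])
  have "C \<subseteq> {z \<in> hyperboloid e. klein e z \<in> Q}"
  proof (rule C_hull)
    have "closed (hyperboloid e \<inter> klein e -` Q)"
      by (intro continuous_closed_preimage continuous_on_klein closed_hyperboloid compact_imp_closed Q(1))
    moreover have "hyperboloid e \<inter> klein e -` Q = {z \<in> hyperboloid e. klein e z \<in> Q}" by blast
    ultimately show "closed {z \<in> hyperboloid e. klein e z \<in> Q}" by simp
    show "geodesically_convex (hyp_space e) {z \<in> hyperboloid e. klein e z \<in> Q}"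
      by (rule geodesically_convex_klein[OF Q(2)])
    fix g :: "real \<times> (real ^ 'n) \<Rightarrow> real \<times> (real ^ 'n)" assume g: "g \<in> isom_n"
    then have "klein e (\<rho> g b) \<in> convex hull ((\<lambda>g. klein e (\<rho> g b)) ` isom_n)"
      by (intro hull_inc imageI)
    then show "\<rho> g b \<in> {z \<in> hyperboloid e. klein e z \<in> Q}"
      using act_mem[OF g b_mem] closure_subset unfolding Q_def by blast
  qed
  then have CQ: "klein e z \<in> Q" if "z \<in> C" for z using that by blast
  define P where "P = cosh (R + hyp_dist e b (hyp_base e))"
  let ?J = "(\<lambda>x. fst x *\<^sub>R snd x) ` ({1..P} \<times> Q)"
  have J: "compact ?J"
    by (intro compact_continuous_image continuous_intros compact_Times compact_Icc Q(1))
  have eq: "{z \<in> C. hyp_dist e z b \<le> R} = C \<inter> {z. minkowski e z b \<le> cosh R}"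
    using hyp_dist_le_iff[OF _ b_mem True] C_sub by blast
  have "C \<inter> {z. minkowski e z b \<le> cosh R} = (C \<inter> {z. minkowski e z b \<le> cosh R}) \<inter> ?J"
  proof -
    have "z \<in> ?J" if z: "z \<in> C" "hyp_dist e z b \<le> R" for z
    proof -
      have zH: "z \<in> hyperboloid e" using z C_sub by blast
      have p1: "1 \<le> z \<bullet> hyp_base e" by (rule inner_hyp_base_ge_1[OF zH])
      have "hyp_dist e z (hyp_base e) \<le> R + hyp_dist e b (hyp_base e)"
        using hyp_dist_triangle[OF zH b_mem u] z(2) by simp
      then have "z \<bullet> hyp_base e \<le> P"
        using hyp_dist_le_iff[OF zH u] True hyp_dist_nonneg[of e b] minkowski_hyp_base[OF e, of z]
        unfolding P_def by simp
      then have "(z \<bullet> hyp_base e, klein e z) \<in> {1..P} \<times> Q" using p1 CQ[OF z(1)] by simp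
      moreover have "z = (z \<bullet> hyp_base e) *\<^sub>R klein e z" using p1 by (simp add: klein_def)
      ultimately show ?thesis by (intro image_eqI[of _ _ "(z \<bullet> hyp_base e, klein e z)"]) simp_all
    qed
    then show ?thesis unfolding eq[symmetric] by blast
  qed
  moreover have "closed (C \<inter> {z. minkowski e z b \<le> cosh R})"
    by (intro closed_Int C_closed closed_Collect_le continuous_intros)
  ultimately show ?thesis
    unfolding eq using closed_Int_compact[OF _ J, of "C \<inter> {z. minkowski e z b \<le> cosh R}"] by argo
next
  case False
  then have "{z \<in> C. hyp_dist e z b \<le> R} = {}"
    using order_trans[OF hyp_dist_nonneg] by blast
  then show ?thesis by (simp only: compact_empty)
qed

lemma mtopology_C: "mtopology_of (submetric (hyp_space e) C) = top_of_set C"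
  using C_sub by (simp add: mtopology_of_submetric mtopology_hyp_space subtopology_subtopology inf.absorb2)

lemma locally_compact_C: "locally_compact_space (mtopology_of (submetric (hyp_space e) C))"
  unfolding locally_compact_space_def mtopology_C
proof (intro ballI)
  fix x assume "x \<in> topspace (top_of_set C)"
  then have x: "x \<in> C" by simp
  define R where "R = hyp_dist e x b + 1"
  let ?U = "C \<inter> hyp_dist e b -` {..<R}" and ?K = "{z \<in> C. hyp_dist e z b \<le> R}"
  have "continuous_on C (hyp_dist e b)"
    using C_sub b_mem by (intro continuous_on_hyp_dist continuous_on_const continuous_on_id) auto
  then have "openin (top_of_set C) ?U"
    by (rule continuous_openin_preimage_gen) simp
  moreover have "compactin (top_of_set C) ?K"
    unfolding compactin_subtopology using compact_C_ball[of R] by auto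
  moreover have "x \<in> ?U" using x by (simp add: R_def hyp_dist_commute[of e b])
  moreover have "?U \<subseteq> ?K" by (auto simp: hyp_dist_commute[of e b])
  ultimately show "\<exists>U K. openin (top_of_set C) U \<and> compactin (top_of_set C) K \<and> x \<in> U \<and> U \<subseteq> K"
    by blast
qed

section \<open>Cocompactness\<close>

text \<open>Up to a bounded error \<open>z\<close> lies between two orbit points: otherwise a family of linear inequalities
  that fails at \<open>z\<close> would hold on the orbit, hence on \<open>C\<close>.\<close>

lemma C_opposite_orbit_points:
  assumes z: "z \<in> C"
  obtains g h where "g \<in> isom_n" "h \<in> isom_n"
    "minkowski e z (\<rho> g b) * minkowski e z (\<rho> h b) \<le> 2 * minkowski e (\<rho> g b) (\<rho> h b)"
proof (rule ccontr)
  assume no: "\<not> thesis"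
  note found = that
  let ?B = "minkowski e"
  have zH: "z \<in> hyperboloid e" using z C_sub by blast
  \<comment> \<open>For fixed \<open>z\<close> and \<open>h\<close> the inequality is linear in
    \<open>w\<close>, so \<open>S\<close> is closed and convex. The denied conclusion says precisely
    that the orbit lies in \<open>S\<close>.\<close>
  define S where "S = hyperboloid e \<inter> (\<Inter>h\<in>isom_n. {w. ?B w (\<rho> h b) \<le> (1/2) * (?B z w * ?B z (\<rho> h b))})"
  have Siff: "w \<in> S \<longleftrightarrow> w \<in> hyperboloid e \<and> (\<forall>h\<in>isom_n. ?B w (\<rho> h b) \<le> (1/2) * (?B z w * ?B z (\<rho> h b)))" for w
    unfolding S_def by blast
  have "C \<subseteq> S"
  proof (rule C_hull)
    show "closed S"
      unfolding S_def by (intro closed_Int closed_hyperboloid closed_INT ballI closed_Collect_le continuous_intros)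
    show "geodesically_convex (hyp_space e) S"
    proof (rule geodesically_convexI)
      fix x y \<alpha> \<beta>
      assume xy: "x \<in> S" "y \<in> S" and pos: "0 \<le> \<alpha>" "0 \<le> \<beta>" and m: "\<alpha> *\<^sub>R x + \<beta> *\<^sub>R y \<in> hyperboloid e"
      have "?B (\<alpha> *\<^sub>R x + \<beta> *\<^sub>R y) (\<rho> h b) \<le> (1/2) * (?B z (\<alpha> *\<^sub>R x + \<beta> *\<^sub>R y) * ?B z (\<rho> h b))"
        if h: "h \<in> isom_n" for h
      proof -
        have "\<alpha> * ?B x (\<rho> h b) + \<beta> * ?B y (\<rho> h b)
            \<le> \<alpha> * ((1/2) * (?B z x * ?B z (\<rho> h b))) + \<beta> * ((1/2) * (?B z y * ?B z (\<rho> h b)))"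
          using xy h pos unfolding Siff by (intro add_mono mult_left_mono) blast+
        then show ?thesis by (simp add: minkowski_bilinear algebra_simps)
      qed
      then show "\<alpha> *\<^sub>R x + \<beta> *\<^sub>R y \<in> S" unfolding Siff using m by blast
    qed (unfold S_def, blast)
    fix g :: "real \<times> (real ^ 'n) \<Rightarrow> real \<times> (real ^ 'n)" assume g: "g \<in> isom_n"
    have "?B (\<rho> g b) (\<rho> h b) \<le> (1/2) * (?B z (\<rho> g b) * ?B z (\<rho> h b))" if h: "h \<in> isom_n" for h
    proof (rule ccontr)
      assume "\<not> ?thesis"
      then have "?B z (\<rho> g b) * ?B z (\<rho> h b) \<le> 2 * ?B (\<rho> g b) (\<rho> h b)" by simp
      then show False using no found[OF g h] by blast
    qed
    then show "\<rho> g b \<in> S" unfolding Siff using act_mem[OF g b_mem] by blast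
  qed
  then have "z \<in> S" using z by blast
  moreover have i: "restrict (\<lambda>x. x) hypn \<in> (isom_n :: (real \<times> (real ^ 'n) \<Rightarrow> _) set)"
    using isometry_id[of "hyp_space_n :: (real \<times> (real ^ 'n)) metric"] by simp
  \<comment> \<open>At \<open>w = z\<close> the factor \<open>minkowski e z z\<close> is 1, and a
    positive number would be at most half of itself. Any constant below 1 in place of
    \<open>1/2\<close> would give the same contradiction.\<close>
  ultimately have "?B z (\<rho> (restrict (\<lambda>x. x) hypn) b) \<le> (1/2) * (?B z z * ?B z (\<rho> (restrict (\<lambda>x. x) hypn) b))"
    unfolding Siff by blast
  then have "?B z b \<le> (1/2) * ?B z b" by (simp add: act_id[OF b_mem] hyperboloidD[OF zH])
  then show False using minkowski_ge_1(1)[OF zH b_mem] by simp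
qed

text \<open>Let \<open>y\<close> and \<open>v\<close> be nearly opposite orbit points as seen from
  \<open>z\<close>. The orbit point \<open>w\<close> on the way from \<open>y\<close> to
  \<open>v\<close> at about the distance of \<open>z\<close> from \<open>y\<close> must be close to
  \<open>z\<close>, by the four point inequality.\<close>

lemma C_near_orbit:
  obtains \<Delta> where "0 \<le> \<Delta>" "\<And>z. z \<in> C \<Longrightarrow> \<exists>g\<in>isom_n. hyp_dist e z (\<rho> g b) \<le> \<Delta>"
proof -
  obtain K where K: "0 \<le> K" "\<And>g h. g \<in> isom_n \<Longrightarrow> h \<in> isom_n \<Longrightarrow>
     \<bar>hyp_dist e (\<rho> g b) (\<rho> h b) - t * distn (g orig) (h orig)\<bar> \<le> K"
    by (rule orbit_rough_isometry) blast
  have "\<exists>g\<in>isom_n. hyp_dist e z (\<rho> g b) \<le> ln (24 * exp (2 * K))" if z: "z \<in> C" for z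
  proof -
    let ?B = "minkowski e"
    have zH: "z \<in> hyperboloid e" using z C_sub by blast
    obtain g h where g: "g \<in> isom_n" and h: "h \<in> isom_n"
      and opp: "?B z (\<rho> g b) * ?B z (\<rho> h b) \<le> 2 * ?B (\<rho> g b) (\<rho> h b)"
      by (rule C_opposite_orbit_points[OF z])
    define y v where "y = \<rho> g b" and "v = \<rho> h b"
    note opp = opp[folded y_def v_def]
    have yH: "y \<in> hyperboloid e" and vH: "v \<in> hyperboloid e"
      unfolding y_def v_def by (intro act_mem g h b_mem)+
    define L where "L = distn (g orig) (h orig)"
    \<comment> \<open>The parameter at which \<open>w\<close> would be as far from \<open>y\<close>
      as \<open>z\<close> is, up to \<open>K\<close>. It may overshoot the end of the segment, hence
      the minimum with \<open>L\<close>.\<close>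
    define a where "a = min (hyp_dist e z y / t) L"
    have a: "0 \<le> a" "a \<le> L" "t * a \<le> hyp_dist e z y"
    proof -
      show "0 \<le> a" using t_pos by (simp add: a_def L_def hyp_dist_nonneg)
      show "a \<le> L" by (simp add: a_def)
      have "a \<le> hyp_dist e z y / t" by (simp add: a_def)
      then show "t * a \<le> hyp_dist e z y" using t_pos by (simp add: pos_le_divide_eq mult.commute)
    qed
    obtain k where k: "k \<in> isom_n" "distn (g orig) (k orig) = a" "distn (k orig) (h orig) = L - a"
      unfolding L_def by (rule isom_n_between[OF g h a(1) a(2)[unfolded L_def]])
    define w where "w = \<rho> k b"
    have wH: "w \<in> hyperboloid e" unfolding w_def by (intro act_mem k(1) b_mem)
    have ge1: "1 \<le> ?B z y" "1 \<le> ?B z v" "1 \<le> ?B w y" "1 \<le> ?B w v" "1 \<le> ?B y v"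
      by (intro minkowski_ge_1(1) zH yH vH wH)+
    have wy: "?B w y \<le> exp K * (2 * ?B z y)"
    proof -
      have "hyp_dist e w y \<le> K + hyp_dist e z y"
        using K(2)[OF g k(1)] a(3) unfolding k(2) w_def y_def by (simp add: hyp_dist_commute[of e "\<rho> k b"])
      then have "exp (hyp_dist e w y) \<le> exp K * exp (hyp_dist e z y)" by (simp add: exp_add[symmetric])
      also have "\<dots> \<le> exp K * (2 * ?B z y)"
        using minkowski_exp_bounds(1)[OF zH yH] by (intro mult_left_mono) auto
      finally show ?thesis using minkowski_exp_bounds(2)[OF wH yH] by linarith
    qed
    have 1: "?B z v * ?B w y \<le> 4 * exp (2 * K) * ?B y v"
    proof -
      have "?B z v * ?B w y \<le> ?B z v * (exp K * (2 * ?B z y))" using wy ge1 by (intro mult_left_mono) auto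
      also have "\<dots> = 2 * exp K * (?B z y * ?B z v)" by (simp only: mult.commute mult.left_commute)
      also have "\<dots> \<le> 2 * exp K * (2 * ?B y v)" using opp by (intro mult_left_mono) auto
      also have "\<dots> = 4 * exp K * ?B y v" by simp
      also have "\<dots> \<le> 4 * exp (2 * K) * ?B y v" using K(1) ge1 by (intro mult_right_mono) auto
      finally show ?thesis .
    qed
    have wv: "hyp_dist e w v \<le> t * (L - a) + K"
      using K(2)[OF k(1) h] unfolding k(3) w_def v_def by linarith
    have 2: "?B w v * ?B z y \<le> 2 * exp (2 * K) * ?B y v"
    proof (cases "a = L")
      \<comment> \<open>Capped case: \<open>w\<close> is within \<open>K\<close> of
        \<open>v\<close>, and the opposition inequality alone suffices because the factor
        \<open>?B z v\<close> that it adds is at least 1.\<close>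
      case True
      then have "exp (hyp_dist e w v) \<le> exp K" using wv by simp
      then have "?B w v \<le> exp K" using minkowski_exp_bounds(2)[OF wH vH] by linarith
      then have "?B w v * ?B z y \<le> exp K * (?B z y * ?B z v)"
        using ge1 by (intro mult_mono) (auto simp: mult_le_cancel_left1)
      also have "\<dots> \<le> exp K * (2 * ?B y v)" using opp by (intro mult_left_mono) auto
      also have "\<dots> = 2 * exp K * ?B y v" by simp
      also have "\<dots> \<le> 2 * exp (2 * K) * ?B y v" using K(1) ge1 by (intro mult_right_mono) auto
      finally show ?thesis .
    next
      case False
      then have "a = hyp_dist e z y / t" by (simp add: a_def min_def split: if_splits)
      then have ta: "t * a = hyp_dist e z y" using t_pos by simp
      have "t * L \<le> hyp_dist e y v + K"
        using K(2)[OF g h] unfolding L_def y_def v_def by linarith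
      then have "hyp_dist e w v + hyp_dist e z y \<le> 2 * K + hyp_dist e y v"
        using wv ta by (simp add: algebra_simps)
      then have "exp (hyp_dist e w v) * exp (hyp_dist e z y) \<le> exp (2 * K) * exp (hyp_dist e y v)"
        by (simp add: exp_add[symmetric])
      moreover have "?B w v * ?B z y \<le> exp (hyp_dist e w v) * exp (hyp_dist e z y)"
        using ge1 by (intro mult_mono minkowski_exp_bounds(2) wH vH zH yH) auto
      moreover have "exp (2 * K) * exp (hyp_dist e y v) \<le> exp (2 * K) * (2 * ?B y v)"
        using minkowski_exp_bounds(1)[OF yH vH] by (intro mult_left_mono) auto
      ultimately have "?B w v * ?B z y \<le> exp (2 * K) * (2 * ?B y v)" by linarith
      then show ?thesis by (simp only: mult.assoc mult.left_commute[of "exp _"])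
    qed
    \<comment> \<open>Both products on the right are bounded by multiples of \<open>?B y v\<close>,
      which then cancels.\<close>
    have "?B z w * ?B y v \<le> 2 * (?B z v * ?B w y + ?B w v * ?B z y)"
      by (rule hyp_four_point[OF zH wH yH vH])
    also have "\<dots> \<le> (12 * exp (2 * K)) * ?B y v" using 1 2 by simp
    finally have "?B z w \<le> 12 * exp (2 * K)"
      using ge1(5) by (simp add: mult_le_cancel_right)
    then have "exp (hyp_dist e z w) \<le> 24 * exp (2 * K)"
      using minkowski_exp_bounds(1)[OF zH wH] by simp
    then have "hyp_dist e z w \<le> ln (24 * exp (2 * K))"
      by (subst ln_ge_iff) simp_all
    then show ?thesis using k(1) unfolding w_def by blast
  qed
  moreover have "0 \<le> ln (24 * exp (2 * K))"
  proof -
    have "1 \<le> exp (2 * K)" using K(1) by simp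
    then show ?thesis by (intro ln_ge_zero) linarith
  qed
  ultimately show ?thesis using that by blast
qed

lemma cocompact_C: "cocompact_action isom_n \<rho> (submetric (hyp_space e) C)"
proof -
  obtain \<Delta> where \<Delta>: "0 \<le> \<Delta>" "\<And>z. z \<in> C \<Longrightarrow> \<exists>g\<in>isom_n. hyp_dist e z (\<rho> g b) \<le> \<Delta>"
    by (rule C_near_orbit) blast
  let ?K = "{z \<in> C. hyp_dist e z b \<le> \<Delta>}"
  have "compactin (top_of_set C) ?K"
    unfolding compactin_subtopology using compact_C_ball[of \<Delta>] by auto
  moreover have "C = (\<Union>g\<in>isom_n. \<rho> g ` ?K)"
  proof (intro equalityI subsetI)
    fix z assume z: "z \<in> C"
    then have zH: "z \<in> hyperboloid e" using C_sub by blast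
    obtain g where g: "g \<in> isom_n" "hyp_dist e z (\<rho> g b) \<le> \<Delta>" using \<Delta>(2)[OF z] by blast
    obtain g' where g': "g' \<in> isom_n" "\<forall>x\<in>hyperboloid e. \<rho> g' (\<rho> g x) = x" "\<forall>x\<in>hyperboloid e. \<rho> g (\<rho> g' x) = x"
      by (rule act_inverse[OF g(1)])
    have "hyp_dist e (\<rho> g' z) b = hyp_dist e z (\<rho> g b)"
      using act_dist[OF g'(1) zH act_mem[OF g(1) b_mem]] bspec[OF g'(2) b_mem] by simp
    then have "\<rho> g' z \<in> ?K" using C_invariant[OF g'(1) z] g(2) by simp
    moreover have "z = \<rho> g (\<rho> g' z)" using g'(3) zH by simp
    ultimately show "z \<in> (\<Union>g\<in>isom_n. \<rho> g ` ?K)" using g(1) by blast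
  next
    fix z assume "z \<in> (\<Union>g\<in>isom_n. \<rho> g ` ?K)"
    then show "z \<in> C" using C_invariant by blast
  qed
  ultimately show ?thesis
    unfolding cocompact_action_def mtopology_C mspace_submetric using C_sub
    by (intro exI[of _ ?K]) (simp add: inf.absorb1)
qed

text \<open>For each \<open>x\<close> some isometry taking \<open>orig\<close> to \<open>x\<close>
  is selected. The stabiliser of \<open>orig\<close> may move \<open>b\<close>, but by the orbit
  estimate two choices give orbit points at distance at most \<open>K\<close>.\<close>

lemma C_roughly_similar:
  obtains F K where "0 \<le> K" "\<And>x. x \<in> hypn \<Longrightarrow> F x \<in> C"
    "\<And>x y. x \<in> hypn \<Longrightarrow> y \<in> hypn \<Longrightarrow> \<bar>hyp_dist e (F x) (F y) - t * distn x (y :: real \<times> (real ^ 'n))\<bar> \<le> K"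
    "\<And>z. z \<in> C \<Longrightarrow> \<exists>x\<in>hypn. hyp_dist e z (F x) \<le> K"
proof -
  obtain K where K: "0 \<le> K" "\<And>g h. g \<in> isom_n \<Longrightarrow> h \<in> isom_n \<Longrightarrow>
     \<bar>hyp_dist e (\<rho> g b) (\<rho> h b) - t * distn (g orig) (h orig)\<bar> \<le> K"
    by (rule orbit_rough_isometry) blast
  obtain \<Delta> where \<Delta>: "0 \<le> \<Delta>" "\<And>z. z \<in> C \<Longrightarrow> \<exists>g\<in>isom_n. hyp_dist e z (\<rho> g b) \<le> \<Delta>"
    by (rule C_near_orbit) blast
  define \<gamma> where "\<gamma> = (\<lambda>x :: real \<times> (real ^ 'n). SOME g. g \<in> isom_n \<and> g orig = x)"
  have \<gamma>: "\<gamma> x \<in> isom_n" "\<gamma> x orig = x" if x: "x \<in> hypn" for x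
  proof -
    obtain g where "g \<in> isom_n" "g orig = x" by (rule isom_n_transitive[OF x])
    then have "\<exists>g. g \<in> isom_n \<and> g orig = x" by blast
    then show "\<gamma> x \<in> isom_n" "\<gamma> x orig = x"
      using someI_ex[of "\<lambda>g. g \<in> isom_n \<and> g orig = x"] unfolding \<gamma>_def by blast+
  qed
  define F where "F = (\<lambda>x. \<rho> (\<gamma> x) b)"
  show ?thesis
  proof (rule that[of "K + \<Delta>" F])
    show "0 \<le> K + \<Delta>" using K(1) \<Delta>(1) by simp
    show "F x \<in> C" if "x \<in> hypn" for x unfolding F_def by (rule orbit_C[OF \<gamma>(1)[OF that]])
    show "\<bar>hyp_dist e (F x) (F y) - t * distn x y\<bar> \<le> K + \<Delta>" if "x \<in> hypn" "y \<in> hypn" for x y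
      using K(2)[OF \<gamma>(1) \<gamma>(1), OF that] \<Delta>(1) unfolding F_def \<gamma>(2)[OF that(1)] \<gamma>(2)[OF that(2)] by linarith
    fix z assume z: "z \<in> C"
    then have zH: "z \<in> hyperboloid e" using C_sub by blast
    obtain g where g: "g \<in> isom_n" "hyp_dist e z (\<rho> g b) \<le> \<Delta>" using \<Delta>(2)[OF z] by blast
    have x: "g orig \<in> hypn" by (rule isom_n_mem[OF g(1) orig_mem])
    have "hyp_dist e (\<rho> g b) (F (g orig)) \<le> K"
      using K(2)[OF g(1) \<gamma>(1)[OF x]] unfolding \<gamma>(2)[OF x] F_def by (simp add: hyp_dist_self)
    then have "hyp_dist e z (F (g orig)) \<le> K + \<Delta>"
      using hyp_dist_triangle[OF zH act_mem[OF g(1) b_mem] act_mem[OF \<gamma>(1)[OF x] b_mem]] g(2)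
      unfolding F_def by linarith
    then show "\<exists>x\<in>hypn. hyp_dist e z (F x) \<le> K + \<Delta>" using x by blast
  qed
qed

end


section \<open>Rigidity of the scaling\<close>

lemma exp_decay_contradiction:
  fixes \<eta> M a :: real
  assumes "\<And>R. 0 \<le> R \<Longrightarrow> \<eta> \<le> M * exp (- a * R)" and \<eta>: "0 < \<eta>" and a: "0 < a"
  shows False
proof -
  define R where "R = max 0 (M / (\<eta> * a))"
  have "\<eta> * exp (a * R) \<le> M * exp (- a * R) * exp (a * R)"
    using assms(1)[of R] by (intro mult_right_mono) (simp_all add: R_def)
  also have "\<dots> = M" by (simp add: exp_minus)
  finally have "\<eta> * exp (a * R) \<le> M" .
  moreover have "\<eta> * (1 + a * R) \<le> \<eta> * exp (a * R)"
    using \<eta> by (intro mult_left_mono exp_ge_add_one_self) auto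
  moreover have "\<eta> * a * (M / (\<eta> * a)) \<le> \<eta> * a * R"
    using \<eta> a by (intro mult_left_mono) (auto simp: R_def)
  moreover have "\<eta> * a * (M / (\<eta> * a)) = M" using \<eta> a by simp
  ultimately show False using \<eta> by (simp add: algebra_simps)
qed

text \<open>Superadditivity of the power, with an explicit gain. In
  \<open>A * (A + B) powr (m - 1) + B * (A + B) powr (m - 1)\<close> with \<open>A\<close> the
  smaller number, the first base is at least \<open>2 * A\<close> and the second at least
  \<open>B\<close>.\<close>

lemma sum_powr_gt:
  fixes A B m :: real
  assumes "0 < A" "0 < B" "1 < m"
  shows "A powr m + B powr m + (2 powr (m - 1) - 1) * (min A B) powr m \<le> (A + B) powr m"
proof -
  have *: "A powr m + B powr m + (2 powr (m - 1) - 1) * A powr m \<le> (A + B) powr m"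
    if A: "0 < A" and B: "0 < B" and le: "A \<le> B" for A B :: real
  proof -
    have p: "x powr m = x * x powr (m - 1)" if "0 < x" for x :: real
      using that powr_add[of x 1 "m - 1"] by simp
    have "A * (2 * A) powr (m - 1) + B * B powr (m - 1) \<le> A * (A + B) powr (m - 1) + B * (A + B) powr (m - 1)"
      using assms(3) A B le by (intro add_mono mult_left_mono powr_mono2) auto
    then show ?thesis
      using A B p[of "A + B"] p[OF A] p[OF B] by (simp add: powr_mult algebra_simps)
  qed
  show ?thesis
  proof (cases "A \<le> B")
    case True
    then show ?thesis using *[OF assms(1,2)] by (simp add: min_absorb1)
  next
    case False
    then show ?thesis using *[OF assms(2,1)] by (simp add: min_absorb2 add.commute add.left_commute)
  qed
qed

lemma two_indices:
  assumes n: "CARD('n::finite) \<ge> 2"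
  obtains i j :: "'n::finite" where "i \<noteq> j"
proof -
  have "\<not> (\<forall>i j :: 'n. i = j)"
  proof
    assume "\<forall>i j :: 'n. i = j"
    then have "(UNIV :: 'n set) = {undefined}" by auto
    then have "card (UNIV :: 'n set) = card {undefined :: 'n}" by (rule arg_cong)
    then show False using n by simp
  qed
  then show ?thesis using that by blast
qed

section \<open>Large circles and rough self-similarities\<close>

definition circle_point :: "'n::finite \<Rightarrow> 'n \<Rightarrow> real \<Rightarrow> real \<Rightarrow> real \<times> (real ^ 'n)" where
  "circle_point i j R \<theta> = (cosh R, axis i (sinh R * cos \<theta>) + axis j (sinh R * sin \<theta>))"

lemma minkowski_circle_point:
  assumes "i \<noteq> j"
  shows "minkowski (1, 0) (circle_point i j R \<theta>) (circle_point i j R \<phi>) = 1 + (sinh R)\<^sup>2 * (1 - cos (\<theta> - \<phi>))"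
proof -
  have "minkowski (1, 0) (circle_point i j R \<theta>) (circle_point i j R \<phi>)
      = (cosh R)\<^sup>2 - (sinh R)\<^sup>2 * (cos \<theta> * cos \<phi> + sin \<theta> * sin \<phi>)"
    using assms by (simp add: circle_point_def minkowski_Pair inner_add_left inner_add_right inner_axis_axis
        power2_eq_square algebra_simps)
  then show ?thesis
    using cosh_square_eq[of R] by (simp add: cos_diff algebra_simps)
qed

lemma circle_point_mem:
  assumes "i \<noteq> j"
  shows "circle_point i j R \<theta> \<in> hypn"
  by (rule hyperboloid_forward[OF _ orig_mem])
    (simp_all add: minkowski_circle_point[OF assms], simp add: circle_point_def minkowski_Pair)

lemma distn_circle_point_orig:
  assumes "i \<noteq> j" "0 \<le> R"
  shows "distn (circle_point i j R \<theta>) orig = R"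
  using hyp_distI[OF circle_point_mem[OF assms(1)] orig_mem, of R \<theta> R] assms(2)
  by (simp add: circle_point_def minkowski_Pair)

lemma distn_circle_point_antipodal:
  assumes "i \<noteq> j" "0 \<le> R"
  shows "distn (circle_point i j R 0) (circle_point i j R pi) = 2 * R"
proof -
  have "minkowski (1, 0) (circle_point i j R 0) (circle_point i j R pi) = cosh (2 * R)"
    using cosh_square_eq[of R] by (simp add: minkowski_circle_point[OF assms(1)] cosh_double)
  from hyp_distI[OF circle_point_mem[OF assms(1)] circle_point_mem[OF assms(1)] this]
  show ?thesis using assms(2) by simp
qed

lemma no_rough_dilation:
  fixes f :: "real \<times> (real ^ 'n) \<Rightarrow> 'a::real_inner"
  assumes n: "CARD('n) \<ge> 2" and s: "1 < s" and K: "0 \<le> K"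
    and f: "\<And>x. x \<in> hypn \<Longrightarrow> f x \<in> hyperboloid e"
    and rough: "\<And>x y. x \<in> hypn \<Longrightarrow> y \<in> hypn \<Longrightarrow> \<bar>hyp_dist e (f x) (f y) - s * distn x y\<bar> \<le> K"
  shows False
proof -
  obtain i j :: 'n where ij: "i \<noteq> j" by (rule two_indices[OF n])
  have e: "e \<noteq> 0" by (rule hyperboloid_nonzero[OF f[OF orig_mem]])
  define u where "u = hyp_base e"
  have u: "u \<in> hyperboloid e" unfolding u_def by (rule hyp_base_mem[OF e])
  define c where "c = K + hyp_dist e (f orig) u"
  have c: "0 \<le> c" using K hyp_dist_nonneg[of e "f orig" u] by (simp add: c_def)
  \<comment> \<open>Neighbouring points of the subdivided half circle are at distance at most
    \<open>ln 6\<close>, so \<open>C1\<close> bounds the distance of their images.\<close>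
  define C1 where "C1 = s * ln 6 + K"
  define M where "M = 8 * exp (C1 + 2 * c)"
  have M: "0 < M" by (simp add: M_def)
  \<comment> \<open>The left side is a lower bound, free of \<open>R\<close>, for the squared chord
    between the images of two antipodal points, up to the inverse squared heights. The right side
    collects the square of the Klein length of the image of a half circle and these inverse heights;
    it decays because \<open>s > 1\<close>.\<close>
  have "exp (- K - 2 * c) \<le> (4 * M + 8 * exp (2 * c)) * exp (- (2 * (s - 1)) * R)" if R: "0 \<le> R" for R
  proof -
    define P where "P = circle_point i j R"
    have P: "P \<theta> \<in> hypn" for \<theta> unfolding P_def by (rule circle_point_mem[OF ij])
    note fP = f[OF P]
    define p where "p = (\<lambda>\<theta>. f (P \<theta>) \<bullet> u)"
    have pd: "p \<theta> = minkowski e (f (P \<theta>)) u" for \<theta>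
      unfolding p_def u_def by (simp add: minkowski_hyp_base[OF e])
    have dR: "\<bar>hyp_dist e (f (P \<theta>)) u - s * R\<bar> \<le> c" for \<theta>
      using rough[OF P orig_mem, of \<theta>] hyp_dist_triangle[OF fP f[OF orig_mem] u, of \<theta>]
        hyp_dist_triangle[OF fP u f[OF orig_mem], of \<theta>] hyp_dist_commute[of e u "f orig"]
      unfolding P_def distn_circle_point_orig[OF ij R] c_def by linarith
    have p_low: "exp (s * R - c) / 2 \<le> p \<theta>" for \<theta>
    proof -
      have "exp (s * R - c) \<le> exp (hyp_dist e (f (P \<theta>)) u)" using dR[of \<theta>] by simp
      then show ?thesis unfolding pd using minkowski_exp_bounds(1)[OF fP u, of \<theta>] by linarith
    qed
    have p_up: "p \<theta> \<le> exp (s * R + c)" for \<theta>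
    proof -
      have "exp (hyp_dist e (f (P \<theta>)) u) \<le> exp (s * R + c)" using dR[of \<theta>] by simp
      then show ?thesis unfolding pd using minkowski_exp_bounds(2)[OF fP u, of \<theta>] by linarith
    qed
    have p_pos: "0 < p \<theta>" for \<theta> using p_low[of \<theta>] exp_gt_zero[of "s * R - c"] by linarith
    define X where "X = exp (s * R - c)"
    have X: "0 < X" by (simp add: X_def)
    have pp: "(X / 2) * (X / 2) \<le> p \<theta> * p \<phi>" for \<theta> \<phi>
      using p_low[of \<theta>] p_low[of \<phi>] X p_pos[of \<theta>] unfolding X_def by (intro mult_mono) auto
    \<comment> \<open>About as many arcs as the half circle has length, so that each arc has bounded
      length. Each image step has Klein length at most
      \<open>sqrt M * exp (- s * R)\<close>.\<close>
    define N where "N = nat \<lceil>exp R\<rceil>"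
    have N: "exp R \<le> real N" "real N \<le> 2 * exp R"
    proof -
      show "exp R \<le> real N" unfolding N_def by (rule real_nat_ceiling_ge)
      have "1 \<le> exp R" using R by simp
      then show "real N \<le> 2 * exp R" unfolding N_def using ceiling_correct[of "exp R"] by linarith
    qed
    have N0: "0 < real N" using N(1) exp_gt_zero[of R] by linarith
    define \<alpha> where "\<alpha> = pi / real N"
    define q where "q = (\<lambda>k. klein e (f (P (real k * \<alpha>))))"
    have step: "norm (q (Suc k) - q k) \<le> sqrt M * exp (- s * R)" for k
    proof -
      let ?\<theta> = "real (Suc k) * \<alpha>" and ?\<phi> = "real k * \<alpha>"
      have diff: "?\<theta> - ?\<phi> = \<alpha>" by (simp add: algebra_simps)
      have "(sin (\<alpha> / 2))\<^sup>2 \<le> (\<alpha> / 2)\<^sup>2"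
        using abs_sin_x_le_abs_x[of "\<alpha> / 2"] by (simp only: abs_le_square_iff)
      then have "1 - cos \<alpha> \<le> \<alpha>\<^sup>2 / 2"
        using cos_double_sin[of "\<alpha> / 2"] by (simp add: power_divide)
      moreover have "(sinh R)\<^sup>2 \<le> (real N)\<^sup>2 / 4"
      proof -
        have "0 \<le> sinh R" using R by simp
        moreover have "sinh R \<le> exp R / 2" by (simp add: sinh_def)
        ultimately have "(sinh R)\<^sup>2 \<le> (real N / 2)\<^sup>2" using N(1) by (intro power_mono) auto
        then show ?thesis by (simp add: power_divide)
      qed
      ultimately have "(sinh R)\<^sup>2 * (1 - cos \<alpha>) \<le> (real N)\<^sup>2 / 4 * (\<alpha>\<^sup>2 / 2)"
        by (intro mult_mono) auto
      also have "\<dots> = pi\<^sup>2 / 8" using N0 by (simp add: \<alpha>_def power_divide)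
      also have "\<dots> \<le> 2"
      proof -
        have "pi\<^sup>2 \<le> 4\<^sup>2" by (intro power_mono) (use pi_less_4 in auto)
        then show ?thesis by simp
      qed
      finally have "minkowski (1, 0) (P ?\<theta>) (P ?\<phi>) \<le> 3"
        unfolding P_def minkowski_circle_point[OF ij] diff by simp
      then have "exp (distn (P ?\<theta>) (P ?\<phi>)) \<le> 6"
        using minkowski_exp_bounds(1)[OF P P, of ?\<theta> ?\<phi>] by linarith
      then have "distn (P ?\<theta>) (P ?\<phi>) \<le> ln 6" by (subst ln_ge_iff) simp_all
      then have "s * distn (P ?\<theta>) (P ?\<phi>) \<le> s * ln 6" using s by (intro mult_left_mono) auto
      then have "hyp_dist e (f (P ?\<theta>)) (f (P ?\<phi>)) \<le> C1"
        using rough[OF P P, of ?\<theta> ?\<phi>] unfolding C1_def by linarith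
      then have "exp (hyp_dist e (f (P ?\<theta>)) (f (P ?\<phi>))) \<le> exp C1" by simp
      then have B: "minkowski e (f (P ?\<theta>)) (f (P ?\<phi>)) \<le> exp C1"
        using minkowski_exp_bounds(2)[OF fP fP, of ?\<theta> ?\<phi>] by linarith
      have "(norm (q (Suc k) - q k))\<^sup>2 \<le> 2 * minkowski e (f (P ?\<theta>)) (f (P ?\<phi>)) / (p ?\<theta> * p ?\<phi>)"
        using klein_dist_le[OF fP fP] unfolding q_def p_def u_def .
      also have "2 * minkowski e (f (P ?\<theta>)) (f (P ?\<phi>)) / (p ?\<theta> * p ?\<phi>) \<le> 2 * exp C1 / ((X / 2) * (X / 2))"
        by (rule frac_le) (use B pp X in simp_all)
      also have "2 * exp C1 / ((X / 2) * (X / 2)) = (sqrt M * exp (- s * R))\<^sup>2"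
      proof -
        have "exp C1 = exp (C1 + 2 * c) * exp (- s * R) * exp (- s * R) * (X * X)"
          unfolding X_def exp_add[symmetric] by (simp add: algebra_simps)
        then have "2 * exp C1 / ((X / 2) * (X / 2)) = 8 * (exp (C1 + 2 * c) * exp (- s * R) * exp (- s * R))"
          using X by simp
        also have "\<dots> = (sqrt M * exp (- s * R))\<^sup>2"
          using M by (simp add: power_mult_distrib power2_eq_square M_def)
        finally show ?thesis .
      qed
      finally show ?thesis
        by (rule power2_le_imp_le) (use M in simp)
    qed
    have "norm (q k - q 0) \<le> real k * (sqrt M * exp (- s * R))" for k
    proof (induction k)
      case (Suc k)
      have "norm (q (Suc k) - q 0) \<le> norm (q (Suc k) - q k) + norm (q k - q 0)"
        using norm_triangle_ineq[of "q (Suc k) - q k" "q k - q 0"] by simp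
      then show ?case using step[of k] Suc by (simp add: algebra_simps)
    qed simp
    then have "norm (q N - q 0) \<le> real N * (sqrt M * exp (- s * R))" .
    also have "\<dots> \<le> 2 * exp R * (sqrt M * exp (- s * R))"
      using N(2) M by (intro mult_right_mono) auto
    finally have "(norm (q N - q 0))\<^sup>2 \<le> (2 * exp R * (sqrt M * exp (- s * R)))\<^sup>2"
      by (intro power_mono) auto
    also have "(2 * exp R * (sqrt M * exp (- s * R)))\<^sup>2 = 4 * M * exp (- (2 * (s - 1)) * R)"
    proof -
      have "exp (- (2 * (s - 1)) * R) = exp R * exp R * exp (- s * R) * exp (- s * R)"
        unfolding exp_add[symmetric] by (simp add: algebra_simps)
      then show ?thesis using M by (simp add: power_mult_distrib power2_eq_square)
    qed
    finally have up: "(norm (q N - q 0))\<^sup>2 \<le> 4 * M * exp (- (2 * (s - 1)) * R)" .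
    have "real N * \<alpha> = pi" using N0 by (simp add: \<alpha>_def)
    then have qN: "q N = klein e (f (P pi))" "q 0 = klein e (f (P 0))" by (simp_all add: q_def)
    let ?B = "minkowski e (f (P pi)) (f (P 0))"
    have "distn (P pi) (P 0) = 2 * R"
      using distn_circle_point_antipodal[OF ij R] unfolding P_def by (subst hyp_dist_commute)
    then have "s * (2 * R) - K \<le> hyp_dist e (f (P pi)) (f (P 0))"
      using rough[OF P P, of pi 0] by auto
    then have "exp (s * (2 * R) - K) \<le> exp (hyp_dist e (f (P pi)) (f (P 0)))" by simp
    then have B: "exp (s * (2 * R) - K) \<le> 2 * ?B"
      using minkowski_exp_bounds(1)[OF fP fP, of pi 0] by linarith
    \<comment> \<open>The images of antipodal points are at distance at least
      \<open>2 * s * R - K\<close>, while their heights are at most \<open>exp (s * R + c)\<close>: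
      seen from the base point they remain apart.\<close>
    have "exp (- K - 2 * c) = exp (s * (2 * R) - K) / (exp (s * R + c) * exp (s * R + c))"
      unfolding exp_add[symmetric] exp_diff[symmetric] by (simp add: algebra_simps)
    also have "\<dots> \<le> 2 * ?B / (p pi * p 0)"
    proof (rule frac_le)
      show "p pi * p 0 \<le> exp (s * R + c) * exp (s * R + c)"
        using p_up[of pi] p_up[of 0] p_pos[of pi] p_pos[of 0] by (intro mult_mono) auto
    qed (use B p_pos[of pi] p_pos[of 0] order_trans[OF exp_ge_zero B] in simp_all)
    also have "2 * ?B / (p pi * p 0) = (norm (q N - q 0))\<^sup>2 + 1 / (p pi)\<^sup>2 + 1 / (p 0)\<^sup>2"
      using klein_dist_sq[OF fP fP, of pi 0] unfolding qN p_def u_def by simp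
    finally have low: "exp (- K - 2 * c) \<le> (norm (q N - q 0))\<^sup>2 + 1 / (p pi)\<^sup>2 + 1 / (p 0)\<^sup>2" .
    have inv: "1 / (p \<theta>)\<^sup>2 \<le> 4 * exp (2 * c) * exp (- (2 * (s - 1)) * R)" for \<theta>
    proof -
      have "1 / (p \<theta>)\<^sup>2 \<le> 1 / ((X / 2) * (X / 2))"
        unfolding power2_eq_square by (rule frac_le) (use pp X in simp_all)
      also have "\<dots> = 4 * exp (2 * c) * exp (- 2 * s * R)"
      proof -
        have "1 = exp (2 * c) * exp (- 2 * s * R) * (X * X)"
          unfolding X_def exp_add[symmetric] by (simp add: algebra_simps)
        moreover have "1 / ((X / 2) * (X / 2)) = 4 * Z" if "1 = Z * (X * X)" for Z
          using X that by (simp add: field_simps)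
        ultimately show ?thesis by (simp only: mult.assoc)
      qed
      also have "\<dots> \<le> 4 * exp (2 * c) * exp (- (2 * (s - 1)) * R)"
      proof -
        have "- 2 * s * R \<le> - (2 * (s - 1)) * R" using R by (simp add: algebra_simps)
        then show ?thesis by (intro mult_left_mono) auto
      qed
      finally show ?thesis .
    qed
    show ?thesis using low up inv[of pi] inv[of 0] by (simp add: algebra_simps)
  qed
  then show False
    by (rule exp_decay_contradiction) (use s in simp_all)
qed

section \<open>The ratio of a similarity\<close>

text \<open>Existence of midpoints and the law of the median, expressed by distances only, so that
  the property passes to isometric copies and can be compared on both sides of a similarity. The law
  is not invariant under rescaling: it encodes curvature -1.\<close>

definition hyp_midpoints :: "'a metric \<Rightarrow> bool" where
  "hyp_midpoints m \<longleftrightarrow>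
     (\<forall>x\<in>mspace m. \<forall>y\<in>mspace m. \<exists>w\<in>mspace m. mdist m x w = mdist m x y / 2 \<and> mdist m w y = mdist m x y / 2) \<and>
     (\<forall>x\<in>mspace m. \<forall>y\<in>mspace m. \<forall>w\<in>mspace m. \<forall>z\<in>mspace m.
        mdist m x w = mdist m x y / 2 \<and> mdist m w y = mdist m x y / 2 \<longrightarrow>
        2 * cosh (mdist m x y / 2) * cosh (mdist m z w) = cosh (mdist m z x) + cosh (mdist m z y))"

definition roughly_scales :: "real \<Rightarrow> real \<Rightarrow> 'a metric \<Rightarrow> (real \<times> (real ^ 'n) \<Rightarrow> 'a) \<Rightarrow> bool" where
  "roughly_scales t K m F \<longleftrightarrow> 0 \<le> K \<and> (\<forall>x\<in>hypn. F x \<in> mspace m) \<and>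
     (\<forall>x\<in>hypn. \<forall>y\<in>hypn. \<bar>mdist m (F x) (F y) - t * distn x y\<bar> \<le> K) \<and>
     (\<forall>z\<in>mspace m. \<exists>x\<in>hypn. mdist m z (F x) \<le> K)"

lemma hyp_midpoints_submetric:
  assumes C: "geodesically_convex (hyp_space e) C"
  shows "hyp_midpoints (submetric (hyp_space e) C)"
proof -
  have CH: "C \<subseteq> hyperboloid e" using C by (simp add: geodesically_convex_def)
  have "\<exists>w\<in>C. hyp_dist e x w = hyp_dist e x y / 2 \<and> hyp_dist e w y = hyp_dist e x y / 2"
    if xy: "x \<in> C" "y \<in> C" for x y
  proof -
    have "0 \<le> hyp_dist e x y / 2" "hyp_dist e x y = hyp_dist e x y / 2 + hyp_dist e x y / 2"
      using hyp_dist_nonneg[of e x y] by simp_all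
    then obtain w where "w \<in> C" "hyp_dist e x w = hyp_dist e x y / 2" "hyp_dist e w y = hyp_dist e x y / 2"
      using geodesically_convex_between[OF C xy] by metis
    then show ?thesis by blast
  qed
  moreover have "2 * cosh (hyp_dist e x y / 2) * cosh (hyp_dist e z w) = cosh (hyp_dist e z x) + cosh (hyp_dist e z y)"
    if m: "x \<in> C" "y \<in> C" "w \<in> C" "z \<in> C"
      and d: "hyp_dist e x w = hyp_dist e x y / 2" "hyp_dist e w y = hyp_dist e x y / 2" for x y w z
  proof -
    have H: "x \<in> hyperboloid e" "y \<in> hyperboloid e" "w \<in> hyperboloid e" "z \<in> hyperboloid e"
      using m CH by blast+
    show ?thesis
      unfolding cosh_hyp_dist[OF H(4) H(1)] cosh_hyp_dist[OF H(4) H(2)] cosh_hyp_dist[OF H(4) H(3)]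
      by (rule hyp_midpoint[OF H(1-3) d]) simp
  qed
  ultimately show ?thesis
    unfolding hyp_midpoints_def mspace_submetric mdist_submetric mspace_hyp_space mdist_hyp_space
      inf.absorb1[OF CH] by blast
qed

text \<open>In a large triangle that is equilateral up to a bounded error, the law of the median determines
  the curvature: after raising the law for \<open>m\<close> to the power \<open>\<mu>\<close>, superadditivity of the power
  exceeds the law for \<open>m'\<close> by a definite factor.\<close>

lemma no_expanding_similarity:
  fixes F :: "real \<times> (real ^ 'n) \<Rightarrow> 'a"
  assumes n: "CARD('n) \<ge> 2" and t: "0 < t" and F: "roughly_scales t K m F"
    and mid: "hyp_midpoints m" and mid': "hyp_midpoints m'" and \<mu>: "1 < \<mu>"
    and h: "\<And>x. x \<in> mspace m \<Longrightarrow> h x \<in> mspace m'"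
    and sim: "\<And>x y. x \<in> mspace m \<Longrightarrow> y \<in> mspace m \<Longrightarrow> mdist m' (h x) (h y) = \<mu> * mdist m x y"
  shows False
proof -
  have K: "0 \<le> K" and Fm: "\<And>x. x \<in> hypn \<Longrightarrow> F x \<in> mspace m"
    and Fd: "\<And>x y. x \<in> hypn \<Longrightarrow> y \<in> hypn \<Longrightarrow> \<bar>mdist m (F x) (F y) - t * distn x y\<bar> \<le> K"
    using F unfolding roughly_scales_def by blast+
  obtain i j :: 'n where ij: "i \<noteq> j" by (rule two_indices[OF n])
  \<comment> \<open>The two sides at \<open>z\<close> differ by at most \<open>2 * K\<close>, so
    their exponentials, after scaling by \<mu>, differ at most by the factor \<open>L\<close>. The
    next constant is the gain in \<open>sum_powr_gt\<close>.\<close>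
  define L where "L = exp (\<mu> * (2 * K))"
  define c where "c = 2 powr (\<mu> - 1) - (1 :: real)"
  have c: "0 < c" using \<mu> by (simp add: c_def)
  \<comment> \<open>The total error relative to \<open>q\<close> when all lengths exceed \<zeta> and
    \<open>v = exp (- \<zeta>)\<close>. It vanishes at 0, so that a large \<zeta> brings it below
    the gain \<open>c\<close>.\<close>
  define G where "G = (\<lambda>v :: real. (1 + L) * ((1 + v) powr (2 * \<mu>) - 1) + 2 * (1 + v) powr (2 * \<mu>) * v)"
  have "isCont G 0" unfolding G_def by (intro continuous_intros) auto
  moreover have "G 0 = 0" by (simp add: G_def)
  ultimately obtain \<delta> where \<delta>: "\<delta> > 0" "\<And>v. \<bar>v\<bar> < \<delta> \<Longrightarrow> \<bar>G v\<bar> < c"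
    using c unfolding continuous_at_eps_delta dist_real_def by (metis diff_zero)
  define \<zeta> where "\<zeta> = 1 + \<bar>ln \<delta>\<bar>"
  have \<zeta>: "0 \<le> \<zeta>" "exp (- \<zeta>) < \<delta>"
  proof -
    show "0 \<le> \<zeta>" by (simp add: \<zeta>_def)
    have "- \<zeta> < ln \<delta>" unfolding \<zeta>_def by linarith
    then have "exp (- \<zeta>) < exp (ln \<delta>)" by simp
    then show "exp (- \<zeta>) < \<delta>" using \<delta>(1) by simp
  qed
  \<comment> \<open>Large enough that \<open>a\<close>, \<open>2 * M\<close>, \<open>s1\<close> and
    \<open>s2\<close> below all exceed \<zeta>, whatever the rough errors are.\<close>
  define R where "R = (\<zeta> + 4 * t + 3 * K) / t"
  have tR: "t * R = \<zeta> + 4 * t + 3 * K" using t by (simp add: R_def)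
  have R: "0 \<le> R" using t K \<zeta>(1) by (simp add: R_def)
  define P where "P = circle_point i j R"
  have P: "P \<theta> \<in> hypn" for \<theta> unfolding P_def by (rule circle_point_mem[OF ij])
  \<comment> \<open>Two antipodal points of the circle and one halfway between them. All three
    distances in hyperbolic n-space are \<open>2 * R\<close> up to a bounded error.\<close>
  define x y z where "x = F (P 0)" and "y = F (P pi)" and "z = F (P (pi / 2))"
  have xyz: "x \<in> mspace m" "y \<in> mspace m" "z \<in> mspace m"
    unfolding x_def y_def z_def by (intro Fm P)+
  obtain w where w: "w \<in> mspace m" and xw: "mdist m x w = mdist m x y / 2" and wy: "mdist m w y = mdist m x y / 2"
    using mid xyz(1,2) unfolding hyp_midpoints_def by blast
  define a s1 s2 M where "a = mdist m x y" and "s1 = mdist m z x" and "s2 = mdist m z y" and "M = mdist m z w"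
  define D where "D = distn (P (pi / 2)) (P 0)"
  have B: "minkowski (1, 0) (P (pi / 2)) (P 0) = 1 + (sinh R)\<^sup>2" "minkowski (1, 0) (P (pi / 2)) (P pi) = 1 + (sinh R)\<^sup>2"
    unfolding P_def minkowski_circle_point[OF ij] by (simp_all add: cos_diff)
  then have D': "distn (P (pi / 2)) (P pi) = D"
    unfolding D_def using hyp_dist_eq_iff[OF P P P P, of "pi / 2" pi "pi / 2" 0] by simp
  have "2 * R - 2 \<le> D"
  proof -
    have "exp (R - 1) \<le> exp R / 2"
      using exp_ge_add_one_self[of 1] divide_left_mono[of 2 "exp 1" "exp R"] by (simp add: exp_diff)
    also have "\<dots> \<le> cosh R" by (rule cosh_exp_bounds(1)[OF R])
    finally have "exp (R - 1) * exp (R - 1) \<le> cosh R * cosh R" by (intro mult_mono) auto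
    also have "\<dots> = 1 + (sinh R)\<^sup>2" using cosh_square_eq[of R] by (simp add: power2_eq_square)
    also have "\<dots> \<le> exp D"
      using minkowski_exp_bounds(2)[OF P P, of "pi / 2" 0] unfolding B D_def .
    finally have "exp ((R - 1) + (R - 1)) \<le> exp D" unfolding exp_add .
    then show ?thesis by simp
  qed
  then have "t * (2 * R - 2) \<le> t * D" using t by (intro mult_left_mono) auto
  then have tD: "2 * (t * R) - 2 * t \<le> t * D" by (simp add: algebra_simps)
  have a: "\<bar>a - 2 * (t * R)\<bar> \<le> K"
    using Fd[OF P P, of 0 pi] distn_circle_point_antipodal[OF ij R]
    unfolding P_def a_def x_def y_def by (simp add: mult.left_commute)
  have s: "\<bar>s1 - t * D\<bar> \<le> K" "\<bar>s2 - t * D\<bar> \<le> K"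
    using Fd[OF P P, of "pi / 2" 0] Fd[OF P P, of "pi / 2" pi]
    unfolding s1_def s2_def x_def y_def z_def D' D_def[symmetric] by simp_all
  have "s1 \<le> M + a / 2"
    using mdist_triangle[OF xyz(3) w xyz(1)] xw unfolding s1_def M_def a_def by (simp add: mdist_commute)
  then have M: "\<zeta> \<le> 2 * M" using s a tD tR K t \<zeta>(1) by linarith
  have a\<zeta>: "\<zeta> \<le> a" using a tR K t \<zeta>(1) by linarith
  have s\<zeta>: "\<zeta> \<le> min s1 s2" using s tD tR K t \<zeta>(1) by linarith
  have med: "2 * cosh (a / 2) * cosh M = cosh s1 + cosh s2"
    using mid xyz w xw wy unfolding hyp_midpoints_def a_def s1_def s2_def M_def by blast
  have med': "2 * cosh (\<mu> * (a / 2)) * cosh (\<mu> * M) = cosh (\<mu> * s1) + cosh (\<mu> * s2)"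
  proof -
    have hd: "mdist m' (h x) (h w) = mdist m' (h x) (h y) / 2" "mdist m' (h w) (h y) = mdist m' (h x) (h y) / 2"
      by (simp_all add: sim xyz w xw wy)
    have "2 * cosh (mdist m' (h x) (h y) / 2) * cosh (mdist m' (h z) (h w)) = cosh (mdist m' (h z) (h x)) + cosh (mdist m' (h z) (h y))"
      using mid' h[OF xyz(1)] h[OF xyz(2)] h[OF xyz(3)] h[OF w] hd unfolding hyp_midpoints_def by blast
    then show ?thesis
      unfolding sim[OF xyz(1,2)] sim[OF xyz(3) w] sim[OF xyz(3,1)] sim[OF xyz(3,2)] a_def s1_def s2_def M_def
      by simp
  qed
  define v where "v = exp (- \<zeta>)"
  have v: "0 < v" "v < \<delta>" using \<zeta>(2) by (simp_all add: v_def)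
  define E where "E = exp (M + a / 2)"
  define A1 A2 where "A1 = exp s1" and "A2 = exp s2"
  have Apos: "0 < A1" "0 < A2" by (simp_all add: A1_def A2_def)
  have powE: "exp r powr \<mu> = exp (\<mu> * r)" for r by (simp add: powr_def)
  \<comment> \<open>The law of the median in \<open>m\<close>, with each \<open>cosh\<close>
    replaced by an exponential at the cost of a factor near 1.\<close>
  have S: "A1 + A2 \<le> E * ((1 + v) * (1 + v))"
  proof -
    have "0 \<le> s1" "0 \<le> s2" using s\<zeta> \<zeta>(1) by simp_all
    then have "A1 + A2 \<le> 2 * (cosh s1 + cosh s2)"
      using cosh_exp_bounds(1)[of s1] cosh_exp_bounds(1)[of s2] by (simp add: A1_def A2_def)
    also have "\<dots> = 4 * cosh (a / 2) * cosh M" using med by simp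
    also have "\<dots> = E * ((1 + exp (- (2 * M))) * (1 + exp (- a)))"
    proof -
      have two_cosh: "2 * cosh r = exp r * (1 + exp (- (2 * r)))" for r :: real
        by (simp add: cosh_def algebra_simps exp_add[symmetric])
      have "4 * cosh (a / 2) * cosh M = (2 * cosh M) * (2 * cosh (a / 2))" by simp
      also have "\<dots> = (exp M * exp (a / 2)) * ((1 + exp (- (2 * M))) * (1 + exp (- a)))"
        unfolding two_cosh by simp
      finally show ?thesis by (simp only: E_def exp_add)
    qed
    also have "\<dots> \<le> E * ((1 + v) * (1 + v))"
      using M a\<zeta> by (intro mult_left_mono mult_mono) (auto simp: v_def E_def)
    finally show ?thesis .
  qed
  define T where "T = exp (\<mu> * s1) + exp (\<mu> * s2)"
  \<comment> \<open>The law in \<open>m'\<close> bounds the same exponential \<open>E\<close>,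
    raised to the power \<mu>, from above. Combined with the power of the previous bound, this
    leaves no room for the gain of \<open>sum_powr_gt\<close>.\<close>
  have ET: "E powr \<mu> \<le> T + 2"
  proof -
    have pos: "0 \<le> \<mu> * (a / 2)" "0 \<le> \<mu> * M" "0 \<le> \<mu> * s1" "0 \<le> \<mu> * s2"
      using \<mu> a\<zeta> M s\<zeta> \<zeta>(1) by simp_all
    have "E powr \<mu> = exp (\<mu> * (a / 2)) * exp (\<mu> * M)"
      unfolding E_def powE exp_add[symmetric] by (simp add: algebra_simps)
    also have "\<dots> \<le> (2 * cosh (\<mu> * (a / 2))) * (2 * cosh (\<mu> * M))"
      using cosh_exp_bounds(1)[OF pos(1)] cosh_exp_bounds(1)[OF pos(2)] by (intro mult_mono) auto
    also have "\<dots> = 2 * (cosh (\<mu> * s1) + cosh (\<mu> * s2))" using med' by simp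
    also have "\<dots> \<le> T + 2"
    proof -
      have "2 * cosh r \<le> exp r + 1" if "0 \<le> r" for r :: real
        using that by (simp add: cosh_def)
      from this[OF pos(3)] this[OF pos(4)] show ?thesis by (simp add: T_def)
    qed
    finally show ?thesis .
  qed
  define q where "q = exp (\<mu> * min s1 s2)"
  define V where "V = (1 + v) powr (2 * \<mu>)"
  have V: "1 \<le> V" unfolding V_def using v \<mu> by (intro ge_one_powr_ge_zero) auto
  have q: "0 < q" by (simp add: q_def)
  have "min A1 A2 powr \<mu> = q"
    unfolding A1_def A2_def q_def powE[symmetric] by (simp add: min_def)
  then have "T + c * q \<le> (A1 + A2) powr \<mu>"
    using sum_powr_gt[OF Apos \<mu>] by (simp add: T_def c_def A1_def A2_def powE)
  also have "\<dots> \<le> (E * ((1 + v) * (1 + v))) powr \<mu>"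
    using S Apos \<mu> by (intro powr_mono2) auto
  also have "\<dots> = E powr \<mu> * V"
  proof -
    have "((1 + v) * (1 + v)) powr \<mu> = V"
      unfolding V_def using v by (simp add: powr_mult powr_add[symmetric])
    then show ?thesis using v by (simp add: powr_mult E_def)
  qed
  also have "\<dots> \<le> (T + 2) * V" using ET V by (intro mult_right_mono) auto
  finally have main: "c * q \<le> T * (V - 1) + 2 * V" by (simp add: algebra_simps)
  have TL: "T \<le> (1 + L) * q"
  proof -
    have "s1 \<le> min s1 s2 + 2 * K" "s2 \<le> min s1 s2 + 2 * K" using s K by linarith+
    then have "\<mu> * s1 \<le> \<mu> * (min s1 s2 + 2 * K)" "\<mu> * s2 \<le> \<mu> * (min s1 s2 + 2 * K)"
      using \<mu> by (intro mult_left_mono; simp)+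
    then have up: "exp (\<mu> * s1) \<le> L * q" "exp (\<mu> * s2) \<le> L * q"
      unfolding L_def q_def exp_add[symmetric] by (simp_all add: algebra_simps)
    show ?thesis
    proof (cases "s1 \<le> s2")
      case True
      then have "exp (\<mu> * s1) = q" by (simp add: q_def)
      then show ?thesis using up by (simp add: T_def algebra_simps)
    next
      case False
      then have "exp (\<mu> * s2) = q" by (simp add: q_def)
      then show ?thesis using up by (simp add: T_def algebra_simps)
    qed
  qed
  \<comment> \<open>This absorbs the additive constant 2 into a multiple of
    \<open>q\<close>.\<close>
  have "1 \<le> v * q"
  proof -
    have "1 * \<zeta> \<le> \<mu> * min s1 s2" using \<mu> s\<zeta> \<zeta>(1) by (intro mult_mono) auto
    then show ?thesis by (simp add: v_def q_def exp_add[symmetric])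
  qed
  then have "2 * V * 1 \<le> 2 * V * (v * q)" using V by (intro mult_left_mono) auto
  moreover have "T * (V - 1) \<le> (1 + L) * q * (V - 1)" using TL V by (intro mult_right_mono) auto
  ultimately have "c * q \<le> G v * q"
    using main unfolding G_def V_def[symmetric] by (simp add: algebra_simps)
  then have "c \<le> G v" using q by (simp add: mult_le_cancel_right)
  then show False using \<delta>(2)[of v] v by simp
qed


section \<open>The family of minimal sets\<close>

lemma continuous_map_metric_copy:
  assumes inj: "inj_on f (mspace m)"
  shows "continuous_map (mtopology_of m) (mtopology_of (metric_copy f m)) f"
    and "continuous_map (mtopology_of (metric_copy f m)) (mtopology_of m) (inv_into (mspace m) f)"
proof -
  have "Lipschitz_continuous_map m (metric_copy f m) f"
    unfolding Lipschitz_continuous_map_def mspace_metric_copy[OF inj]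
  proof (intro conjI exI ballI)
    fix x y assume "x \<in> mspace m" "y \<in> mspace m"
    then show "mdist (metric_copy f m) (f x) (f y) \<le> 1 * mdist m x y"
      by (simp add: mdist_metric_copy[OF inj])
  qed (rule Pi_I, rule imageI)
  then show "continuous_map (mtopology_of m) (mtopology_of (metric_copy f m)) f"
    by (rule Lipschitz_continuous_imp_continuous_map)
  have "Lipschitz_continuous_map (metric_copy f m) m (inv_into (mspace m) f)"
    unfolding Lipschitz_continuous_map_def mspace_metric_copy[OF inj]
  proof (intro conjI exI ballI)
    fix x y assume "x \<in> f ` mspace m" "y \<in> f ` mspace m"
    then obtain x' y' where "x' \<in> mspace m" "y' \<in> mspace m" "x = f x'" "y = f y'" by blast
    then show "mdist m (inv_into (mspace m) f x) (inv_into (mspace m) f y) \<le> 1 * mdist (metric_copy f m) x y"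
      by (simp add: mdist_metric_copy[OF inj] inv_into_f_f[OF inj])
  qed (rule Pi_I, rule inv_into_into)
  then show "continuous_map (mtopology_of (metric_copy f m)) (mtopology_of m) (inv_into (mspace m) f)"
    by (rule Lipschitz_continuous_imp_continuous_map)
qed

lemma locally_compact_metric_copy:
  assumes inj: "inj_on f (mspace m)" and lc: "locally_compact_space (mtopology_of m)"
  shows "locally_compact_space (mtopology_of (metric_copy f m))"
proof -
  have "homeomorphic_maps (mtopology_of m) (mtopology_of (metric_copy f m)) f (inv_into (mspace m) f)"
    unfolding homeomorphic_maps_def
    using continuous_map_metric_copy[OF inj] by (auto simp: inj f_inv_into_f)
  then have "(mtopology_of m) homeomorphic_space (mtopology_of (metric_copy f m))"
    unfolding homeomorphic_space_def by blast
  then show ?thesis using homeomorphic_locally_compact_space lc by blast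
qed

lemma cocompact_metric_copy:
  assumes inj: "inj_on f (mspace m)" and co: "cocompact_action G act m"
    and act': "\<And>g x. g \<in> G \<Longrightarrow> x \<in> mspace m \<Longrightarrow> act' g (f x) = f (act g x)"
  shows "cocompact_action G act' (metric_copy f m)"
proof -
  obtain K where K: "compactin (mtopology_of m) K" "mspace m = (\<Union>g\<in>G. act g ` K)"
    using co unfolding cocompact_action_def by blast
  have Km: "K \<subseteq> mspace m" using compactin_subset_topspace[OF K(1)] by simp
  have "compactin (mtopology_of (metric_copy f m)) (f ` K)"
    by (rule image_compactin[OF K(1) continuous_map_metric_copy(1)[OF inj]])
  moreover have "mspace (metric_copy f m) = (\<Union>g\<in>G. act' g ` f ` K)"
  proof -
    have "act' g ` f ` K = f ` act g ` K" if "g \<in> G" for g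
      unfolding image_image using act'[OF that] Km by (intro image_cong) auto
    then have "(\<Union>g\<in>G. act' g ` f ` K) = (\<Union>g\<in>G. f ` act g ` K)" by simp
    also have "\<dots> = f ` mspace m" unfolding K(2) by blast
    finally show ?thesis by (simp add: mspace_metric_copy[OF inj])
  qed
  ultimately show ?thesis unfolding cocompact_action_def by blast
qed

lemma hyp_midpoints_metric_copy:
  assumes inj: "inj_on f (mspace m)" and mid: "hyp_midpoints m"
  shows "hyp_midpoints (metric_copy f m)"
  using mid unfolding hyp_midpoints_def mspace_metric_copy[OF inj]
  by (simp add: mdist_metric_copy[OF inj])

lemma roughly_scales_metric_copy:
  assumes inj: "inj_on f (mspace m)" and F: "roughly_scales t K m F"
  shows "roughly_scales t K (metric_copy f m) (f \<circ> F)"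
  using F unfolding roughly_scales_def mspace_metric_copy[OF inj]
  by (simp add: mdist_metric_copy[OF inj])

context minimal_convex_rep
begin

lemma C_roughly_scales:
  "\<exists>F K. roughly_scales t K (submetric (hyp_space e) C) (F :: real \<times> (real ^ 'n) \<Rightarrow> 'h)"
proof -
  obtain F K where F: "0 \<le> K" "\<And>x. x \<in> hypn \<Longrightarrow> F x \<in> C"
    "\<And>x y. x \<in> hypn \<Longrightarrow> y \<in> hypn \<Longrightarrow> \<bar>hyp_dist e (F x) (F y) - t * distn x (y :: real \<times> (real ^ 'n))\<bar> \<le> K"
    "\<And>z. z \<in> C \<Longrightarrow> \<exists>x\<in>hypn. hyp_dist e z (F x) \<le> K"
    by (rule C_roughly_similar) blast
  have "roughly_scales t K (submetric (hyp_space e) C) F"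
    unfolding roughly_scales_def mspace_submetric mdist_submetric mspace_hyp_space mdist_hyp_space
      inf.absorb1[OF C_sub]
    using F by blast
  then show ?thesis by blast
qed

lemma hyp_midpoints_C: "hyp_midpoints (submetric (hyp_space e) C)"
  by (rule hyp_midpoints_submetric[OF C_convex])

end

lemma exotic_minimal_convex_rep:
  fixes e :: "'h::{real_inner, complete_space}"
    and \<rho> :: "(real \<times> (real ^ 'n) \<Rightarrow> real \<times> (real ^ 'n)) \<Rightarrow> 'h \<Rightarrow> 'h"
  assumes "0 < t" and \<rho>: "exotic_rep e t \<rho>"
    and C: "minimal_closed_convex_invariant isom_n \<rho> (hyp_space e) C"
  obtains b where "minimal_convex_rep e t \<rho> b C"
proof -
  have "C \<noteq> {}" "C \<subseteq> hyperboloid e"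
    using C unfolding minimal_closed_convex_invariant_def closed_convex_invariant_def closedin_hyp_space
    by blast+
  then obtain b where b: "b \<in> C" "b \<in> hyperboloid e" by blast
  have "minimal_convex_rep e t \<rho> b C"
    by unfold_locales (use assms b in \<open>auto simp: exotic_rep_def\<close>)
  then show ?thesis by (rule that)
qed

text \<open>Hyperbolic n-space itself is the minimal set of its own isometry group, since
  reflections act transitively. This brings the convention for \<open>t = 1\<close> under the same
  locale.\<close>

lemma standard_minimal_convex_rep:
  "minimal_convex_rep (orig :: real \<times> (real ^ 'n)) 1 (\<lambda>g. g) orig hypn"
proof unfold_locales
  show "(\<lambda>g. g) \<in> hom (isometry_group hyp_space_n) (isometry_group (hyp_space (orig :: real \<times> (real ^ 'n))))"
    by (simp add: hom_def hyp_space_n_def)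
  show "continuous_map (isometry_topology hyp_space_n) (mtopology_of (hyp_space orig)) (\<lambda>g. g x)"
    if "x \<in> hypn" for x :: "real \<times> (real ^ 'n)"
    unfolding isometry_topology_def
    by (rule continuous_map_from_subtopology)
      (use that continuous_map_product_projection[of x hypn "\<lambda>_. mtopology_of (hyp_space orig)"]
        in \<open>simp add: hyp_space_n_def\<close>)
  show "translation_length (hyp_space orig) g = 1 * translation_length hyp_space_n g"
    for g :: "real \<times> (real ^ 'n) \<Rightarrow> real \<times> (real ^ 'n)"
    by (simp add: hyp_space_n_def)
  have "closed_convex_invariant isom_n (\<lambda>g. g) (hyp_space orig) (hypn :: (real \<times> (real ^ 'n)) set)"
    unfolding closed_convex_invariant_def closedin_hyp_space
  proof (intro conjI ballI closed_hyperboloid order_refl)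
    show "(hypn :: (real \<times> (real ^ 'n)) set) \<noteq> {}" using orig_mem by (rule ex_in_conv[THEN iffD1, OF exI])
    show "geodesically_convex (hyp_space orig) (hypn :: (real \<times> (real ^ 'n)) set)"
      by (rule geodesically_convexI[OF order_refl])
    show "g ` hypn \<subseteq> hypn" if g: "g \<in> isom_n" for g :: "real \<times> (real ^ 'n) \<Rightarrow> real \<times> (real ^ 'n)"
      using isometry_mem[OF g] by (intro image_subsetI) simp
  qed
  moreover have "S = hypn"
    if S: "closed_convex_invariant isom_n (\<lambda>g. g) (hyp_space orig) S" for S :: "(real \<times> (real ^ 'n)) set"
  proof -
    have S': "S \<noteq> {}" "S \<subseteq> hypn" "\<And>g x. g \<in> isom_n \<Longrightarrow> x \<in> S \<Longrightarrow> g x \<in> S"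
      using S unfolding closed_convex_invariant_def closedin_hyp_space by blast+
    obtain x where x: "x \<in> S" "x \<in> hypn" using S' by blast
    have "y \<in> S" if y: "y \<in> hypn" for y
    proof -
      have "restrict (hyp_reflection orig x y) hypn x \<in> S"
        by (rule S'(3)[OF hyp_reflection_isom_n[OF x(2) y] x(1)])
      then show ?thesis using x(2) by (simp add: hyp_reflection_left[OF x(2) y])
    qed
    then show ?thesis using S'(2) by blast
  qed
  ultimately show "minimal_closed_convex_invariant isom_n (\<lambda>g. g) (hyp_space orig) (hypn :: (real \<times> (real ^ 'n)) set)"
    unfolding minimal_closed_convex_invariant_def by blast
qed (simp_all add: orig_mem)

lemma submetric_hypn: "submetric (hyp_space orig) (hypn :: (real \<times> (real ^ 'n)) set) = hyp_space_n"
  using submetric_mspace[of "hyp_space (orig :: real \<times> (real ^ 'n))"] by (simp add: hyp_space_n_def)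

lemma minimal_space_properties:
  fixes e :: "'h::{real_inner, complete_space}"
    and \<rho> :: "real \<Rightarrow> (real \<times> (real ^ 'n) \<Rightarrow> real \<times> (real ^ 'n)) \<Rightarrow> 'h \<Rightarrow> 'h"
  assumes t: "0 < t" "t \<le> 1"
    and \<rho>: "t < 1 \<Longrightarrow> exotic_rep e t (\<rho> t)"
    and C: "t < 1 \<Longrightarrow> minimal_closed_convex_invariant isom_n (\<rho> t) (hyp_space e) (C t)"
  defines "X \<equiv> (minimal_space e C t :: ('h + real \<times> (real ^ 'n)) metric)"
  shows "locally_compact_space (mtopology_of X)"
    and "cocompact_action isom_n (minimal_action \<rho> t) X"
    and "hyp_midpoints X"
    and "\<exists>(F :: real \<times> (real ^ 'n) \<Rightarrow> _) K. roughly_scales t K X F"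
proof -
  have "locally_compact_space (mtopology_of X) \<and> cocompact_action isom_n (minimal_action \<rho> t) X \<and>
    hyp_midpoints X \<and> (\<exists>(F :: real \<times> (real ^ 'n) \<Rightarrow> _) K. roughly_scales t K X F)"
  proof (cases "t = 1")
    case True
    interpret S: minimal_convex_rep "orig :: real \<times> (real ^ 'n)" 1 "\<lambda>g. g" orig hypn
      by (rule standard_minimal_convex_rep)
    have X: "X = metric_copy Inr hyp_space_n" by (simp add: X_def minimal_space_def True)
    have inj: "inj_on Inr (mspace (hyp_space_n :: (real \<times> (real ^ 'n)) metric))" by simp
    obtain F :: "real \<times> (real ^ 'n) \<Rightarrow> real \<times> (real ^ 'n)" and K where F: "roughly_scales 1 K hyp_space_n F"
      using S.C_roughly_scales unfolding submetric_hypn by blast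
    have "cocompact_action isom_n (minimal_action \<rho> t) X"
      unfolding X by (rule cocompact_metric_copy[OF inj S.cocompact_C[unfolded submetric_hypn]])
        (simp add: minimal_action_def)
    then show ?thesis
      using locally_compact_metric_copy[OF inj S.locally_compact_C[unfolded submetric_hypn]]
        hyp_midpoints_metric_copy[OF inj S.hyp_midpoints_C[unfolded submetric_hypn]]
        roughly_scales_metric_copy[OF inj F]
      unfolding X True by blast
  next
    case False
    then have t1: "t < 1" using t by simp
    obtain b where "minimal_convex_rep e t (\<rho> t) b (C t)"
      by (rule exotic_minimal_convex_rep[OF t(1) \<rho>[OF t1] C[OF t1]])
    then interpret S: minimal_convex_rep e t "\<rho> t" b "C t" .
    have X: "X = metric_copy Inl (submetric (hyp_space e) (C t))" using False by (simp add: X_def minimal_space_def)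
    have inj: "inj_on Inl (mspace (submetric (hyp_space e) (C t)))" by simp
    obtain F :: "real \<times> (real ^ 'n) \<Rightarrow> 'h" and K where F: "roughly_scales t K (submetric (hyp_space e) (C t)) F"
      using S.C_roughly_scales by blast
    have "cocompact_action isom_n (minimal_action \<rho> t) X"
      unfolding X by (rule cocompact_metric_copy[OF inj S.cocompact_C])
        (simp add: minimal_action_def)
    then show ?thesis
      using locally_compact_metric_copy[OF inj S.locally_compact_C]
        hyp_midpoints_metric_copy[OF inj S.hyp_midpoints_C]
        roughly_scales_metric_copy[OF inj F]
      unfolding X by blast
  qed
  then show "locally_compact_space (mtopology_of X)" "cocompact_action isom_n (minimal_action \<rho> t) X"
    "hyp_midpoints X" "\<exists>(F :: real \<times> (real ^ 'n) \<Rightarrow> _) K. roughly_scales t K X F"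
    by blast+
qed

text \<open>If \<open>t > t'\<close>, then \<open>F\<close>, followed by \<open>h\<close> and a
  rough inverse of \<open>F'\<close>, is a rough self-similarity of hyperbolic n-space of ratio
  \<open>t / t' > 1\<close>, against \<open>no_rough_dilation\<close>. Moving both image points to
  the image of \<open>F'\<close> costs \<open>2 * K'\<close>, and \<open>F'\<close> itself another
  \<open>K'\<close>.\<close>

lemma scaling_le:
  fixes F :: "real \<times> (real ^ 'n) \<Rightarrow> 'a" and F' :: "real \<times> (real ^ 'n) \<Rightarrow> 'b"
  assumes n: "CARD('n) \<ge> 2" and t: "0 < t'"
    and F: "roughly_scales t K m F" and F': "roughly_scales t' K' m' F'"
    and h: "\<And>x. x \<in> mspace m \<Longrightarrow> h x \<in> mspace m'"
    and iso: "\<And>x y. x \<in> mspace m \<Longrightarrow> y \<in> mspace m \<Longrightarrow> mdist m' (h x) (h y) = mdist m x y"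
  shows "t \<le> t'"
proof (rule ccontr)
  assume "\<not> t \<le> t'"
  then have s: "1 < t / t'" using t by simp
  have K: "0 \<le> K" "0 \<le> K'" and Fm: "\<And>x. x \<in> hypn \<Longrightarrow> F x \<in> mspace m"
    and Fm': "\<And>x. x \<in> hypn \<Longrightarrow> F' x \<in> mspace m'"
    and Fd: "\<And>x y. x \<in> hypn \<Longrightarrow> y \<in> hypn \<Longrightarrow> \<bar>mdist m (F x) (F y) - t * distn x y\<bar> \<le> K"
    and Fd': "\<And>x y. x \<in> hypn \<Longrightarrow> y \<in> hypn \<Longrightarrow> \<bar>mdist m' (F' x) (F' y) - t' * distn x y\<bar> \<le> K'"
    and near: "\<And>z. z \<in> mspace m' \<Longrightarrow> \<exists>x\<in>hypn. mdist m' z (F' x) \<le> K'"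
    using F F' unfolding roughly_scales_def by blast+
  have "\<exists>y\<in>hypn. mdist m' (h (F x)) (F' y) \<le> K'" if "x \<in> hypn" for x
    using near[OF h[OF Fm[OF that]]] .
  then obtain f where f: "\<And>x. x \<in> hypn \<Longrightarrow> f x \<in> hypn"
    and close: "\<And>x. x \<in> hypn \<Longrightarrow> mdist m' (h (F x)) (F' (f x)) \<le> K'"
    by metis
  have rough: "\<bar>distn (f x) (f y) - t / t' * distn x y\<bar> \<le> (K + 3 * K') / t'"
    if xy: "x \<in> hypn" "y \<in> hypn" for x y
  proof -
    note M = h[OF Fm[OF xy(1)]] h[OF Fm[OF xy(2)]] Fm'[OF f[OF xy(1)]] Fm'[OF f[OF xy(2)]]
    have "\<bar>mdist m' (F' (f x)) (F' (f y)) - mdist m' (h (F x)) (h (F y))\<bar> \<le> 2 * K'"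
      using mdist_triangle[OF M(3) M(1) M(4)] mdist_triangle[OF M(1) M(2) M(4)]
        mdist_triangle[OF M(1) M(3) M(2)] mdist_triangle[OF M(3) M(4) M(2)]
        close[OF xy(1)] close[OF xy(2)] mdist_commute[of m' "h (F x)"] mdist_commute[of m' "h (F y)"]
      by (smt (verit))
    then have "\<bar>t' * distn (f x) (f y) - t * distn x y\<bar> \<le> K + 3 * K'"
      using Fd[OF xy] Fd'[OF f[OF xy(1)] f[OF xy(2)]] iso[OF Fm[OF xy(1)] Fm[OF xy(2)]] by linarith
    moreover have "t' * distn (f x) (f y) - t * distn x y = t' * (distn (f x) (f y) - t / t' * distn x y)"
      using t by (simp add: field_simps)
    ultimately have "t' * \<bar>distn (f x) (f y) - t / t' * distn x y\<bar> \<le> K + 3 * K'"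
      using t by (simp add: abs_mult)
    then show ?thesis using t by (simp add: pos_le_divide_eq mult.commute)
  qed
  show False
    by (rule no_rough_dilation[OF n s _ f rough]) (use K t in simp_all)
qed

text \<open>Both rigidity results exclude only expansion, so each is applied to the map and to its
  inverse.\<close>

lemma isometric_up_to_scaling_same_scale:
  fixes F :: "real \<times> (real ^ 'n) \<Rightarrow> 'a" and F' :: "real \<times> (real ^ 'n) \<Rightarrow> 'b"
  assumes n: "CARD('n) \<ge> 2" and t: "0 < t" "0 < t'"
    and F: "roughly_scales t K m F" and F': "roughly_scales t' K' m' F'"
    and mid: "hyp_midpoints m" "hyp_midpoints m'"
    and sim: "isometric_up_to_scaling m m'"
  shows "t = t'"
proof -
  obtain \<mu> h where \<mu>: "0 < \<mu>" and h: "bij_betw h (mspace m) (mspace m')"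
    and d: "\<And>x y. x \<in> mspace m \<Longrightarrow> y \<in> mspace m \<Longrightarrow> mdist m' (h x) (h y) = \<mu> * mdist m x y"
    using sim unfolding isometric_up_to_scaling_def by blast
  define k where "k = inv_into (mspace m) h"
  have hm: "h x \<in> mspace m'" if "x \<in> mspace m" for x using bij_betwE[OF h] that by blast
  have km: "k x \<in> mspace m" if "x \<in> mspace m'" for x
    using bij_betwE[OF bij_betw_inv_into[OF h]] that unfolding k_def by blast
  have hk: "h (k x) = x" if "x \<in> mspace m'" for x
    using bij_betw_inv_into_right[OF h that] unfolding k_def .
  have kd: "mdist m (k x) (k y) = (1 / \<mu>) * mdist m' x y" if "x \<in> mspace m'" "y \<in> mspace m'" for x y
    using d[OF km[OF that(1)] km[OF that(2)]] \<mu> by (simp add: hk[OF that(1)] hk[OF that(2)])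
  have "\<not> 1 < \<mu>"
    using no_expanding_similarity[OF n t(1) F mid _ hm d] by blast
  moreover have "\<not> 1 < 1 / \<mu>"
    using no_expanding_similarity[OF n t(2) F' mid(2,1) _ km kd] by blast
  ultimately have "\<mu> = 1" using \<mu> by (simp add: field_simps)
  show ?thesis
  proof (rule antisym)
    show "t \<le> t'" by (rule scaling_le[OF n t(2) F F', of h]) (simp_all add: hm d \<open>\<mu> = 1\<close>)
    show "t' \<le> t" by (rule scaling_le[OF n t(1) F' F, of k]) (simp_all add: km kd \<open>\<mu> = 1\<close>)
  qed
qed

theorem theorem4:
  fixes e :: "'h::{real_inner, polish_space}"
    and \<rho> :: "real \<Rightarrow> (real \<times> (real ^ 'n) \<Rightarrow> real \<times> (real ^ 'n)) \<Rightarrow> 'h \<Rightarrow> 'h"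
    and C :: "real \<Rightarrow> 'h set"
  assumes "CARD('n) \<ge> 2"
    and "\<nexists>S :: 'h set. finite S \<and> span S = UNIV"
    and "e \<noteq> 0"
    and "\<And>t. 0 < t \<Longrightarrow> t < 1 \<Longrightarrow> exotic_rep e t (\<rho> t)"
    and "\<And>t. 0 < t \<Longrightarrow> t < 1 \<Longrightarrow>
           minimal_closed_convex_invariant isom_n (\<rho> t) (hyp_space e) (C t)"
  shows "let X = (minimal_space e C :: real \<Rightarrow> ('h + real \<times> (real ^ 'n)) metric) in
     (\<forall>t\<in>{0<..1}. locally_compact_space (mtopology_of (X t)) \<and>
        cocompact_action isom_n (minimal_action \<rho> t) (X t)) \<and>
     (\<forall>t\<in>{0<..1}. \<forall>t'\<in>{0<..1}. isometric_up_to_scaling (X t) (X t') \<longrightarrow> t = t')"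
proof -
  let ?X = "minimal_space e C :: real \<Rightarrow> ('h + real \<times> (real ^ 'n)) metric"
  have props: "locally_compact_space (mtopology_of (?X t))" "cocompact_action isom_n (minimal_action \<rho> t) (?X t)"
    "hyp_midpoints (?X t)" "\<exists>(F :: real \<times> (real ^ 'n) \<Rightarrow> _) K. roughly_scales t K (?X t) F"
    if "t \<in> {0<..1}" for t
    using that minimal_space_properties[of t e \<rho> C] assms(4,5) by simp_all
  have "t = t'" if t: "t \<in> {0<..1}" "t' \<in> {0<..1}" and sim: "isometric_up_to_scaling (?X t) (?X t')" for t t'
  proof -
    obtain F F' :: "real \<times> (real ^ 'n) \<Rightarrow> 'h + real \<times> (real ^ 'n)" and K K'
      where "roughly_scales t K (?X t) F" "roughly_scales t' K' (?X t') F'"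
      using props(4)[OF t(1)] props(4)[OF t(2)] by blast
    then show ?thesis
      using isometric_up_to_scaling_same_scale[OF assms(1), of t t'] props(3)[OF t(1)] props(3)[OF t(2)] sim t
      by simp
  qed
  then show ?thesis unfolding Let_def using props(1,2) by blast
qed

end
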